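(* Let $w:\mathbb R^{d_Z}\to\mathbb R$ be measurable and assume there exists $C>0$ with $|w(z)|\le C$ for all $z\in\mathbb R^{d_Z}$. For $P\in\mathcal P_0$ define $\sigma_P^2=\operatorname{Var}_P(\epsilon_P\xi_P w(Z))=\mathbb E_P[\epsilon_P^2\xi_P^2w(Z)^2]$. 1. Let $P\in\mathcal P_0$. Assume $A_fA_g=o_P(n^{-1})$, $B_f=o_P(1)$, $B_g=o_P(1)$, $\sigma_P^2>0$ and $\mathbb E_P[\epsilon_P^2\xi_P^2]<\infty$. Then $\sup_{t\in\mathbb R}|\mathbb P_P(T^{(n)}\le t)-\Phi(t)|\to0$ as $n\to\infty$. 2. Let $\mathcal P\subset\mathcal P_0$. Assume $A_fA_g=o_{\mathcal P}(n^{-1})$, $B_f=o_{\mathcal P}(1)$, $B_g=o_{\mathcal P}(1)$, $\inf_{P\in\mathcal P}\sigma_P^2>0$, and that there exists $\eta>0$ with $\sup_{P\in\mathcal P}\mathbb E_P[|\epsilon_P\xi_P|^{2+\eta}]<\infty$. Then $\sup_{P\in\mathcal P}\sup_{t\in\mathbb R}|\mathbb P_P(T^{(n)}\le t)-\Phi(t)|\to0$.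
   Context: Let $X,Y$ be real-valued random variables and $Z$ a random vector in $\mathbb R^{d_Z}$, $d_Z\ge1$. $\mathcal E_0$ is the set of all distributions of $(X,Y,Z)$ that are absolutely continuous with respect to Lebesgue measure, and $\mathcal P_0\subseteq\mathcal E_0$ is the subset of those under which $X$ and $Y$ are conditionally independent given $Z$. For $P\in\mathcal E_0$ let $f_P(z)=\mathbb E_P[X\mid Z=z]$, $g_P(z)=\mathbb E_P[Y\mid Z=z]$, $\epsilon_P=X-f_P(Z)$, $\xi_P=Y-g_P(Z)$, $u_P(z)=\mathbb E_P[\epsilon_P^2\mid Z=z]$, $v_P(z)=\mathbb E_P[\xi_P^2\mid Z=z]$. Let $(x_i,y_i,z_i)$, $i=1,\dots,n$, be i.i.d. copies of $(X,Y,Z)$, forming data $\mathbf X^{(n)},\mathbf Y^{(n)},\mathbf Z^{(n)}$. Let $\hat f=\hat f^{(n)}$ be an estimate of $f_P$ obtained by regressing $\mathbf X^{(n)}$ on $\mathbf Z^{(n)}$, and $\hat g=\hat g^{(n)}$ an estimate of $g_P$ obtained by regressing $\mathbf Y^{(n)}$ on $\mathbf Z^{(n)}$. Define $A_f=\frac1n\sum_{i=1}^n(f_P(z_i)-\hat f(z_i))^2$, $A_g=\frac1n\sum_{i=1}^n(g_P(z_i)-\hat g(z_i))^2$, $B_f=\frac1n\sum_{i=1}^n(f_P(z_i)-\hat f(z_i))^2v_P(z_i)$, $B_g=\frac1n\sum_{i=1}^n(g_P(z_i)-\hat g(z_i))^2u_P(z_i)$. For the weight function $w$ let $R_i=(x_i-\hat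 f(z_i))(y_i-\hat g(z_i))w(z_i)$ and $T^{(n)}=\tau_N^{(n)}/\tau_D^{(n)}$ with $\tau_N^{(n)}=\frac{1}{\sqrt n}\sum_{i=1}^nR_i$, $\tau_D^{(n)}=\big(\frac1n\sum_{i=1}^nR_i^2-(\frac1n\sum_{r=1}^nR_r)^2\big)^{1/2}$. $\Phi$ is the standard normal distribution function. For a family $\mathcal P$ of distributions, random variables $V_n$ with laws determined by $P\in\mathcal P$, and positive $W_n$, $V_n=o_{\mathcal P}(W_n)$ means $\lim_{n\to\infty}\sup_{P\in\mathcal P}\mathbb P_P(|V_n/W_n|>\delta)=0$ for all $\delta>0$; $o_P$ denotes the case $\mathcal P=\{P\}$. *)

theory Defs
  imports "HOL-Probability.Probability"
begin

type_synonym 'd pt = "real \<times> real \<times> (real ^ 'd)"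

definition Xv :: "('d::finite) pt \<Rightarrow> real" where "Xv p = fst p"
definition Yv :: "('d::finite) pt \<Rightarrow> real" where "Yv p = fst (snd p)"
definition Zv :: "('d::finite) pt \<Rightarrow> real ^ ('d::finite)" where "Zv p = snd (snd p)"

definition E0 :: "('d::finite) pt measure set" where
  "E0 = {P. prob_space P \<and> sets P = sets borel \<and> absolutely_continuous lborel P}"

definition Zalg :: "('d::finite) pt measure \<Rightarrow> ('d::finite) pt measure" where
  "Zalg P = vimage_algebra (space P) Zv borel"

definition cond_fun :: "('d::finite) pt measure \<Rightarrow> (('d::finite) pt \<Rightarrow> real) \<Rightarrow> (real ^ ('d::finite) \<Rightarrow> real)" where
  "cond_fun P h = (SOME \<phi>. \<phi> \<in> borel_measurable borel \<and>
       (AE p in P. \<phi> (Zv p) = real_cond_exp P (Zalg P) h p))"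

definition cond_indep :: "('d::finite) pt measure \<Rightarrow> bool" where
  "cond_indep P \<longleftrightarrow> (\<forall>A \<in> sets (borel :: real measure). \<forall>B \<in> sets (borel :: real measure).
     AE p in P. real_cond_exp P (Zalg P) (\<lambda>q. indicator A (Xv q) * indicator B (Yv q)) p
       = real_cond_exp P (Zalg P) (\<lambda>q. indicator A (Xv q)) p
         * real_cond_exp P (Zalg P) (\<lambda>q. indicator B (Yv q)) p)"

definition P0 :: "('d::finite) pt measure set" where
  "P0 = {P \<in> E0. cond_indep P}"

definition fP :: "('d::finite) pt measure \<Rightarrow> real ^ ('d::finite) \<Rightarrow> real" where "fP P = cond_fun P Xv"
definition gP :: "('d::finite) pt measure \<Rightarrow> real ^ ('d::finite) \<Rightarrow> real" where "gP P = cond_fun P Yv"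
definition epsP :: "('d::finite) pt measure \<Rightarrow> ('d::finite) pt \<Rightarrow> real" where "epsP P p = Xv p - fP P (Zv p)"
definition xiP :: "('d::finite) pt measure \<Rightarrow> ('d::finite) pt \<Rightarrow> real" where "xiP P p = Yv p - gP P (Zv p)"
definition uP :: "('d::finite) pt measure \<Rightarrow> real ^ ('d::finite) \<Rightarrow> real" where "uP P = cond_fun P (\<lambda>p. (epsP P p)\<^sup>2)"
definition vP :: "('d::finite) pt measure \<Rightarrow> real ^ ('d::finite) \<Rightarrow> real" where "vP P = cond_fun P (\<lambda>p. (xiP P p)\<^sup>2)"

definition sigma2 :: "(real ^ ('d::finite) \<Rightarrow> real) \<Rightarrow> ('d::finite) pt measure \<Rightarrow> real" where
  "sigma2 w P = (\<integral>p. (epsP P p)\<^sup>2 * (xiP P p)\<^sup>2 * (w (Zv p))\<^sup>2 \<partial>P)"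

definition sample :: "('d::finite) pt measure \<Rightarrow> nat \<Rightarrow> (nat \<Rightarrow> ('d::finite) pt) measure" where
  "sample P n = PiM {..<n} (\<lambda>_. P)"

definition xdat :: "nat \<Rightarrow> (nat \<Rightarrow> ('d::finite) pt) \<Rightarrow> nat \<Rightarrow> real" where
  "xdat n \<omega> = (\<lambda>i\<in>{..<n}. Xv (\<omega> i))"
definition ydat :: "nat \<Rightarrow> (nat \<Rightarrow> ('d::finite) pt) \<Rightarrow> nat \<Rightarrow> real" where
  "ydat n \<omega> = (\<lambda>i\<in>{..<n}. Yv (\<omega> i))"
definition zdat :: "nat \<Rightarrow> (nat \<Rightarrow> ('d::finite) pt) \<Rightarrow> nat \<Rightarrow> real ^ ('d::finite)" where
  "zdat n \<omega> = (\<lambda>i\<in>{..<n}. Zv (\<omega> i))"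

text \<open>A regression method: for each n, maps (response data, covariate data) to a fitted function.\<close>
type_synonym 'd regr = "nat \<Rightarrow> (nat \<Rightarrow> real) \<Rightarrow> (nat \<Rightarrow> real ^ 'd) \<Rightarrow> real ^ 'd \<Rightarrow> real"

definition measurable_regr :: "('d::finite) regr \<Rightarrow> bool" where
  "measurable_regr r \<longleftrightarrow> (\<forall>n. (\<lambda>(a, b, z). r n a b z) \<in> borel_measurable
      (PiM {..<n} (\<lambda>_. (borel :: real measure)) \<Otimes>\<^sub>M
        (PiM {..<n} (\<lambda>_. (borel :: (real ^ ('d::finite)) measure)) \<Otimes>\<^sub>M (borel :: (real ^ ('d::finite)) measure))))"

definition Af :: "('d::finite) regr \<Rightarrow> ('d::finite) pt measure \<Rightarrow> nat \<Rightarrow> (nat \<Rightarrow> ('d::finite) pt) \<Rightarrow> real" where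
  "Af fh P n \<omega> = (1 / real n) * (\<Sum>i<n. (fP P (Zv (\<omega> i)) - fh n (xdat n \<omega>) (zdat n \<omega>) (Zv (\<omega> i)))\<^sup>2)"
definition Ag :: "('d::finite) regr \<Rightarrow> ('d::finite) pt measure \<Rightarrow> nat \<Rightarrow> (nat \<Rightarrow> ('d::finite) pt) \<Rightarrow> real" where
  "Ag gh P n \<omega> = (1 / real n) * (\<Sum>i<n. (gP P (Zv (\<omega> i)) - gh n (ydat n \<omega>) (zdat n \<omega>) (Zv (\<omega> i)))\<^sup>2)"
definition Bf :: "('d::finite) regr \<Rightarrow> ('d::finite) pt measure \<Rightarrow> nat \<Rightarrow> (nat \<Rightarrow> ('d::finite) pt) \<Rightarrow> real" where
  "Bf fh P n \<omega> = (1 / real n) * (\<Sum>i<n. (fP P (Zv (\<omega> i)) - fh n (xdat n \<omega>) (zdat n \<omega>) (Zv (\<omega> i)))\<^sup>2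
                                          * vP P (Zv (\<omega> i)))"
definition Bg :: "('d::finite) regr \<Rightarrow> ('d::finite) pt measure \<Rightarrow> nat \<Rightarrow> (nat \<Rightarrow> ('d::finite) pt) \<Rightarrow> real" where
  "Bg gh P n \<omega> = (1 / real n) * (\<Sum>i<n. (gP P (Zv (\<omega> i)) - gh n (ydat n \<omega>) (zdat n \<omega>) (Zv (\<omega> i)))\<^sup>2
                                          * uP P (Zv (\<omega> i)))"

definition Rres :: "(real ^ ('d::finite) \<Rightarrow> real) \<Rightarrow> ('d::finite) regr \<Rightarrow> ('d::finite) regr \<Rightarrow> nat \<Rightarrow> (nat \<Rightarrow> ('d::finite) pt) \<Rightarrow> nat \<Rightarrow> real" where
  "Rres w fh gh n \<omega> i = (Xv (\<omega> i) - fh n (xdat n \<omega>) (zdat n \<omega>) (Zv (\<omega> i)))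
                        * (Yv (\<omega> i) - gh n (ydat n \<omega>) (zdat n \<omega>) (Zv (\<omega> i))) * w (Zv (\<omega> i))"

definition tauN :: "(real ^ ('d::finite) \<Rightarrow> real) \<Rightarrow> ('d::finite) regr \<Rightarrow> ('d::finite) regr \<Rightarrow> nat \<Rightarrow> (nat \<Rightarrow> ('d::finite) pt) \<Rightarrow> real" where
  "tauN w fh gh n \<omega> = (1 / sqrt (real n)) * (\<Sum>i<n. Rres w fh gh n \<omega> i)"
definition tauD :: "(real ^ ('d::finite) \<Rightarrow> real) \<Rightarrow> ('d::finite) regr \<Rightarrow> ('d::finite) regr \<Rightarrow> nat \<Rightarrow> (nat \<Rightarrow> ('d::finite) pt) \<Rightarrow> real" where
  "tauD w fh gh n \<omega> = sqrt ((1 / real n) * (\<Sum>i<n. (Rres w fh gh n \<omega> i)\<^sup>2)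
                            - ((1 / real n) * (\<Sum>r<n. Rres w fh gh n \<omega> r))\<^sup>2)"
definition Tstat :: "(real ^ ('d::finite) \<Rightarrow> real) \<Rightarrow> ('d::finite) regr \<Rightarrow> ('d::finite) regr \<Rightarrow> nat \<Rightarrow> (nat \<Rightarrow> ('d::finite) pt) \<Rightarrow> real" where
  "Tstat w fh gh n \<omega> = tauN w fh gh n \<omega> / tauD w fh gh n \<omega>"

definition Phi :: "real \<Rightarrow> real" where
  "Phi t = measure (density lborel std_normal_density) {..t}"

definition o_unif :: "('d::finite) pt measure set \<Rightarrow> (('d::finite) pt measure \<Rightarrow> nat \<Rightarrow> (nat \<Rightarrow> ('d::finite) pt) \<Rightarrow> real)
                      \<Rightarrow> (nat \<Rightarrow> real) \<Rightarrow> bool" where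
  "o_unif Q V W \<longleftrightarrow> (\<forall>\<delta>>0. (\<lambda>n. \<Squnion>P\<in>Q. ennreal (measure (sample P n)
        {\<omega> \<in> space (sample P n). \<bar>V P n \<omega> / W n\<bar> > \<delta>})) \<longlonglongrightarrow> 0)"

definition cdf_dist :: "(real ^ ('d::finite) \<Rightarrow> real) \<Rightarrow> ('d::finite) regr \<Rightarrow> ('d::finite) regr \<Rightarrow> ('d::finite) pt measure \<Rightarrow> nat \<Rightarrow> real \<Rightarrow> real" where
  "cdf_dist w fh gh P n t = \<bar>measure (sample P n) {\<omega> \<in> space (sample P n). Tstat w fh gh n \<omega> \<le> t} - Phi t\<bar>"

end

(*
The residual product satisfies R_i / sigma = zeta_i + b_i, where zeta_i = eps_i xi_i w(z_i) / sigma is centred with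
unit variance and b_i collects the terms containing a regression error. Given all covariates and all responses y_j, the
estimate of g is fixed while the eps_i are independent and centred with variances u(z_i), so the cross term
n^(-1/2) sum eps_i (g - ghat)(z_i) w(z_i) has conditional variance at most C^2 B_g; symmetrically for f and B_f. The
doubly erroneous term is at most C (n A_f A_g)^(1/2) by Cauchy-Schwarz. Hence the b_i are negligible both in the sum and in
the sum of squares, and T is asymptotically the normalised sum of the zeta_i. Since the zeta_i^2 are uniformly integrable
over the class of distributions, a central limit theorem and a weak law hold along every sequence (P_n) in the class.
Uniformity over the class follows by applying this to a sequence of almost worst distributions.

A conditional variance u or v could be infinite on a set of covariates, where real_cond_exp returns the junk value 0.
This has probability zero: E[eps^2 xi^2] = E[E[eps^2 | Z] xi^2] is finite and xi is almost surely nonzero because P has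
a density.
*)

theory Submission
  imports Defs
begin

section \<open>Conditionally centred noise in product spaces\<close>

text \<open>Conditioning on all covariates and one set of responses would call for conditional laws
  on the product space. Instead a map \<open>\<rho>\<close> on single points overwrites the other
  response by 0, and a quantity counts as determined by the conditioning information if applying
  \<open>\<rho>\<close> to any coordinate leaves it unchanged (\<open>invariant_at\<close>). Fubini
  in one coordinate then replaces conditional expectation, and the facts needed about one factor are
  E[eps | Y, Z] = 0 and E[eps^2 | Y, Z] = u(Z). By definition they hold relative to Z; conditional
  independence extends them to (Y, Z). Two obstacles shape the rest. B_f and B_g are small in
  probability but may have no mean, so Chebyshev's inequality is applied after multiplying by the
  indicator of the event that the conditional variance is at most \<open>\<kappa>\<close>, which is
  itself invariant. And eps and xi are not assumed to be square integrable separately, so identities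
  are stated for extended nonnegative integrals, with \<open>ennreal (e x)\<close> and
  \<open>ennreal (- e x)\<close> as the positive and negative parts of the noise.\<close>

lemma (in prob_space) nn_integral_PiM_resample:
  assumes I: "finite I" "i \<in> I"
    and F[measurable]: "F \<in> borel_measurable (PiM I (\<lambda>_. M))"
  shows "(\<integral>\<^sup>+\<omega>. F \<omega> \<partial>PiM I (\<lambda>_. M)) = (\<integral>\<^sup>+\<omega>. (\<integral>\<^sup>+p. F (\<omega> (i := p)) \<partial>M) \<partial>PiM I (\<lambda>_. M))"
proof -
  interpret product_sigma_finite "\<lambda>_. M" by standard
  define J where "J = I - {i}"
  have J: "finite J" "i \<notin> J" and IJ: "I = insert i J" using I by (auto simp: J_def)
  have upd[measurable]: "(\<lambda>x. (fst x)(i := snd x)) \<in> PiM I (\<lambda>_. M) \<Otimes>\<^sub>M M \<rightarrow>\<^sub>M PiM I (\<lambda>_. M)"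
    by (rule measurable_fun_upd[where J=I]) (use I in auto)
  have G[measurable]: "(\<lambda>\<omega>. \<integral>\<^sup>+p. F (\<omega> (i := p)) \<partial>M) \<in> borel_measurable (PiM I (\<lambda>_. M))"
    using measurable_compose[OF upd F] by (intro borel_measurable_nn_integral) (simp add: split_beta')
  have "(\<integral>\<^sup>+\<omega>. (\<integral>\<^sup>+p. F (\<omega> (i := p)) \<partial>M) \<partial>PiM I (\<lambda>_. M))
      = (\<integral>\<^sup>+ x. (\<integral>\<^sup>+ y. (\<integral>\<^sup>+p. F ((x(i := y))(i := p)) \<partial>M) \<partial>M) \<partial>PiM J (\<lambda>_. M))"
    using product_nn_integral_insert[OF J, of "\<lambda>\<omega>. \<integral>\<^sup>+p. F (\<omega> (i := p)) \<partial>M"] G by (simp add: IJ)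
  \<comment> \<open>The first draw of coordinate \<open>i\<close> is overwritten, so the integrand
    no longer depends on \<open>y\<close>, whose law has total mass 1.\<close>
  also have "\<dots> = (\<integral>\<^sup>+ x. (\<integral>\<^sup>+p. F (x(i := p)) \<partial>M) \<partial>PiM J (\<lambda>_. M))"
    by (simp add: emeasure_space_1)
  also have "\<dots> = (\<integral>\<^sup>+\<omega>. F \<omega> \<partial>PiM I (\<lambda>_. M))"
    using product_nn_integral_insert[OF J, of F] F by (simp add: IJ)
  finally show ?thesis by simp
qed

text \<open>\<open>ennreal\<close> cuts negative reals off at 0, so \<open>pos_eq\<close> and
  \<open>neg_eq\<close> say that the positive and negative parts of \<open>a\<close> have equal
  integrals against each part of \<open>G\<close>. Together they balance the positive and negative
  parts of the product. If the product is not integrable, the Bochner integral is 0 by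
  convention.\<close>

lemma integral_mult_zeroI:
  fixes a G :: "'b \<Rightarrow> real"
  assumes [measurable]: "a \<in> borel_measurable N" "G \<in> borel_measurable N"
    and pos_eq: "(\<integral>\<^sup>+x. ennreal (a x) * ennreal (G x) \<partial>N) = (\<integral>\<^sup>+x. ennreal (- a x) * ennreal (G x) \<partial>N)"
    and neg_eq: "(\<integral>\<^sup>+x. ennreal (a x) * ennreal (- G x) \<partial>N) = (\<integral>\<^sup>+x. ennreal (- a x) * ennreal (- G x) \<partial>N)"
  shows "(\<integral>x. a x * G x \<partial>N) = 0"
proof (cases "integrable N (\<lambda>x. a x * G x)")
  case True
  have pos: "ennreal (s * t) = ennreal s * ennreal t + ennreal (- s) * ennreal (- t)" for s t :: real
    by (cases "0 \<le> s"; cases "0 \<le> t")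
       (auto simp: ennreal_mult[symmetric] ennreal_neg mult_nonneg_nonpos mult_nonneg_nonpos2 mult_nonpos_nonpos)
  have neg: "ennreal (- (s * t)) = ennreal s * ennreal (- t) + ennreal (- s) * ennreal t" for s t :: real
    using pos[of s "- t"] by simp
  have "(\<integral>\<^sup>+x. ennreal (a x * G x) \<partial>N)
      = (\<integral>\<^sup>+x. ennreal (a x) * ennreal (G x) \<partial>N) + (\<integral>\<^sup>+x. ennreal (- a x) * ennreal (- G x) \<partial>N)"
    by (simp only: pos) (rule nn_integral_add; measurable)
  also have "\<dots> = (\<integral>\<^sup>+x. ennreal (- a x) * ennreal (G x) \<partial>N) + (\<integral>\<^sup>+x. ennreal (a x) * ennreal (- G x) \<partial>N)"
    using pos_eq neg_eq by simp
  also have "\<dots> = (\<integral>\<^sup>+x. ennreal (- (a x * G x)) \<partial>N)"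
    by (simp only: neg, subst nn_integral_add) (auto simp: add.commute)
  finally show ?thesis
    using real_lebesgue_integral_def[OF True] by simp
qed (simp add: not_integrable_integral_eq)

text \<open>The map \<open>\<rho>\<close> erases the part of a point that carries the noise \<open>e\<close>: functions of the form \<open>h \<circ> \<rho>\<close> are those
  determined by the conditioning information, and \<open>U\<close> is the conditional variance of \<open>e\<close>.\<close>

locale cond_noise = prob_space M for M :: "'a measure" +
  fixes e :: "'a \<Rightarrow> real" and \<rho> :: "'a \<Rightarrow> 'a" and U :: "'a \<Rightarrow> real"
  assumes e_meas[measurable]: "e \<in> borel_measurable M"
    and rho_meas[measurable]: "\<rho> \<in> M \<rightarrow>\<^sub>M M"
    and U_meas[measurable]: "U \<in> borel_measurable M"
    and U_nonneg: "AE x in M. 0 \<le> U x"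
    and U_rho: "x \<in> space M \<Longrightarrow> U (\<rho> x) = U x"
    and mean_zero: "h \<in> borel_measurable M \<Longrightarrow>
      (\<integral>\<^sup>+x. ennreal (e x) * h (\<rho> x) \<partial>M) = (\<integral>\<^sup>+x. ennreal (- e x) * h (\<rho> x) \<partial>M)"
    and second_moment: "h \<in> borel_measurable M \<Longrightarrow>
      (\<integral>\<^sup>+x. ennreal ((e x)\<^sup>2) * h (\<rho> x) \<partial>M) = (\<integral>\<^sup>+x. ennreal (U x) * h (\<rho> x) \<partial>M)"
begin

text \<open>A pointwise substitute for measurability with respect to the information left once the
  noise of coordinate \<open>i\<close> is erased. The result type is free, so that it serves real
  and extended nonnegative functions alike.\<close>

definition invariant_at :: "'i set \<Rightarrow> 'i \<Rightarrow> (('i \<Rightarrow> 'a) \<Rightarrow> 'b) \<Rightarrow> bool" where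
  "invariant_at I i H \<longleftrightarrow> (\<forall>\<omega>\<in>space (PiM I (\<lambda>_. M)). H (\<omega> (i := \<rho> (\<omega> i))) = H \<omega>)"

lemma invariant_at_upd:
  assumes "invariant_at I i H" "\<omega> \<in> space (PiM I (\<lambda>_. M))" "i \<in> I" "p \<in> space M"
  shows "H (\<omega> (i := \<rho> p)) = H (\<omega> (i := p))"
proof -
  have "\<omega> (i := p) \<in> space (PiM I (\<lambda>_. M))"
    using assms(2-4) by (auto simp: space_PiM PiE_def extensional_def)
  with assms(1) show ?thesis unfolding invariant_at_def by force
qed

text \<open>With the other coordinates frozen and coordinate \<open>i\<close> resampled, an
  invariant \<open>H\<close> becomes a function of \<open>\<rho> p\<close>, and the assumptions of
  the locale on a single factor apply.\<close>

lemma nn_integral_coordinate: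
  assumes I: "finite I" "i \<in> I" and H[measurable]: "H \<in> borel_measurable (PiM I (\<lambda>_. M))"
    and inv: "invariant_at I i H"
  shows "(\<integral>\<^sup>+\<omega>. ennreal (e (\<omega> i)) * H \<omega> \<partial>PiM I (\<lambda>_. M)) = (\<integral>\<^sup>+\<omega>. ennreal (- e (\<omega> i)) * H \<omega> \<partial>PiM I (\<lambda>_. M))"
    and "(\<integral>\<^sup>+\<omega>. ennreal ((e (\<omega> i))\<^sup>2) * H \<omega> \<partial>PiM I (\<lambda>_. M)) = (\<integral>\<^sup>+\<omega>. ennreal (U (\<omega> i)) * H \<omega> \<partial>PiM I (\<lambda>_. M))"
proof -
  have comp[measurable]: "(\<lambda>\<omega>. \<omega> i) \<in> PiM I (\<lambda>_. M) \<rightarrow>\<^sub>M M"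
    using I by simp
  have h: "(\<lambda>p. H (\<omega> (i := p))) \<in> borel_measurable M" if "\<omega> \<in> space (PiM I (\<lambda>_. M))" for \<omega>
  proof -
    have "(\<lambda>p. \<omega> (i := p)) \<in> M \<rightarrow>\<^sub>M PiM I (\<lambda>_. M)"
      by (rule measurable_fun_upd[where J=I]) (use I that in auto)
    then show ?thesis by measurable
  qed
  \<comment> \<open>The pair \<open>f\<close>, \<open>g\<close> stands for the positive and negative
    parts of \<open>e\<close> in one claim and for its square and \<open>U\<close> in the
    other.\<close>
  have key: "(\<integral>\<^sup>+\<omega>. f (\<omega> i) * H \<omega> \<partial>PiM I (\<lambda>_. M)) = (\<integral>\<^sup>+\<omega>. g (\<omega> i) * H \<omega> \<partial>PiM I (\<lambda>_. M))"
    if [measurable]: "f \<in> borel_measurable M" "g \<in> borel_measurable M"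
      and *: "\<And>h. h \<in> borel_measurable M \<Longrightarrow> (\<integral>\<^sup>+x. f x * h (\<rho> x) \<partial>M) = (\<integral>\<^sup>+x. g x * h (\<rho> x) \<partial>M)"
    for f g :: "'a \<Rightarrow> ennreal"
  proof -
    have 1: "(\<integral>\<^sup>+p. f ((\<omega> (i := p)) i) * H (\<omega> (i := p)) \<partial>M) = (\<integral>\<^sup>+p. g ((\<omega> (i := p)) i) * H (\<omega> (i := p)) \<partial>M)"
      if \<omega>: "\<omega> \<in> space (PiM I (\<lambda>_. M))" for \<omega>
    proof -
      have "(\<integral>\<^sup>+p. f p * H (\<omega> (i := p)) \<partial>M) = (\<integral>\<^sup>+p. f p * H (\<omega> (i := \<rho> p)) \<partial>M)"
        by (intro nn_integral_cong) (simp add: invariant_at_upd[OF inv \<omega> I(2)])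
      also have "\<dots> = (\<integral>\<^sup>+p. g p * H (\<omega> (i := \<rho> p)) \<partial>M)"
        by (rule *[OF h[OF \<omega>]])
      also have "\<dots> = (\<integral>\<^sup>+p. g p * H (\<omega> (i := p)) \<partial>M)"
        by (intro nn_integral_cong) (simp add: invariant_at_upd[OF inv \<omega> I(2)])
      finally show ?thesis by simp
    qed
    show ?thesis
      by (subst (1 2) nn_integral_PiM_resample[OF I]) (auto intro!: nn_integral_cong 1[simplified])
  qed
  show "(\<integral>\<^sup>+\<omega>. ennreal (e (\<omega> i)) * H \<omega> \<partial>PiM I (\<lambda>_. M)) = (\<integral>\<^sup>+\<omega>. ennreal (- e (\<omega> i)) * H \<omega> \<partial>PiM I (\<lambda>_. M))"
    by (rule key[of "\<lambda>x. ennreal (e x)" "\<lambda>x. ennreal (- e x)"]) (auto intro: mean_zero)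
  show "(\<integral>\<^sup>+\<omega>. ennreal ((e (\<omega> i))\<^sup>2) * H \<omega> \<partial>PiM I (\<lambda>_. M)) = (\<integral>\<^sup>+\<omega>. ennreal (U (\<omega> i)) * H \<omega> \<partial>PiM I (\<lambda>_. M))"
    by (rule key[of "\<lambda>x. ennreal ((e x)\<^sup>2)" "\<lambda>x. ennreal (U x)"]) (auto intro: second_moment)
qed

text \<open>Invariance is asked at \<open>i\<close> only, so \<open>G\<close> may carry the noise of
  other coordinates. This is what makes mixed products of two noises integrate to zero.\<close>

lemma integral_coordinate_zero:
  fixes G :: "('i \<Rightarrow> 'a) \<Rightarrow> real"
  assumes I: "finite I" "i \<in> I" and G[measurable]: "G \<in> borel_measurable (PiM I (\<lambda>_. M))"
    and inv: "invariant_at I i G"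
  shows "(\<integral>\<omega>. e (\<omega> i) * G \<omega> \<partial>PiM I (\<lambda>_. M)) = 0"
proof -
  have "invariant_at I i (\<lambda>\<omega>. ennreal (G \<omega>))" "invariant_at I i (\<lambda>\<omega>. ennreal (- G \<omega>))"
    using inv by (auto simp: invariant_at_def)
  then show ?thesis
    by (intro integral_mult_zeroI nn_integral_coordinate(1)[OF I]) (use I in measurable)
qed

text \<open>The one-point version, from which the product of both residuals and the weight gets its
  mean zero.\<close>

lemma integral_invariant_zero:
  fixes G :: "'a \<Rightarrow> real"
  assumes [measurable]: "G \<in> borel_measurable M" and inv: "\<And>x. G (\<rho> x) = G x"
  shows "(\<integral>x. e x * G x \<partial>M) = 0"
  using mean_zero[of "\<lambda>x. ennreal (G x)"] mean_zero[of "\<lambda>x. ennreal (- G x)"]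
  by (intro integral_mult_zeroI) (simp_all add: inv)

lemma AE_PiM_U_nonneg:
  assumes "finite I"
  shows "AE \<omega> in PiM I (\<lambda>_. M). \<forall>i\<in>I. 0 \<le> U (\<omega> i)"
proof -
  have "AE \<omega> in PiM I (\<lambda>_. M). 0 \<le> U (\<omega> i)" if "i \<in> I" for i
    by (rule AE_PiM_component[OF _ that U_nonneg]) (rule prob_space_axioms)
  then show ?thesis by (simp add: AE_finite_all[OF assms])
qed

text \<open>The event \<open>G\<close> is determined by the conditioning information, so truncation to \<open>G\<close> keeps the noise centred, and it
  makes the second moments finite.\<close>

lemma truncated_second_moments:
  fixes d :: "'i \<Rightarrow> ('i \<Rightarrow> 'a) \<Rightarrow> real"
  assumes I: "finite I"
    and d_meas: "\<And>i. i \<in> I \<Longrightarrow> d i \<in> borel_measurable (PiM I (\<lambda>_. M))"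
    and d_inv: "\<And>i j. i \<in> I \<Longrightarrow> j \<in> I \<Longrightarrow> invariant_at I j (d i)"
    and \<kappa>: "0 \<le> \<kappa>"
  defines "N \<equiv> PiM I (\<lambda>_. M)"
  defines "G \<equiv> {\<omega> \<in> space N. (\<Sum>i\<in>I. U (\<omega> i) * (d i \<omega>)\<^sup>2) \<le> \<kappa>}"
  defines "D \<equiv> \<lambda>i \<omega>. d i \<omega> * indicator G \<omega>"
  shows "G \<in> sets N"
    and "integrable N (\<lambda>\<omega>. \<Sum>i\<in>I. (e (\<omega> i) * D i \<omega>)\<^sup>2)"
    and "(\<integral>\<omega>. (\<Sum>i\<in>I. (e (\<omega> i) * D i \<omega>)\<^sup>2) \<partial>N) \<le> \<kappa>"
    and "integrable N (\<lambda>\<omega>. (\<Sum>i\<in>I. e (\<omega> i) * D i \<omega>)\<^sup>2)"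
    and "(\<integral>\<omega>. (\<Sum>i\<in>I. e (\<omega> i) * D i \<omega>)\<^sup>2 \<partial>N) \<le> \<kappa>"
proof -
  interpret N: prob_space N
    unfolding N_def by (rule prob_space_PiM) (rule prob_space_axioms)
  have comp[measurable]: "(\<lambda>\<omega>. \<omega> i) \<in> N \<rightarrow>\<^sub>M M" if "i \<in> I" for i
    unfolding N_def using that by simp
  have [measurable]: "d i \<in> borel_measurable N" if "i \<in> I" for i
    unfolding N_def by (rule d_meas[OF that])
  have eU[measurable]: "(\<lambda>\<omega>. e (\<omega> i)) \<in> borel_measurable N" "(\<lambda>\<omega>. U (\<omega> i)) \<in> borel_measurable N" if "i \<in> I" for i
    using that by measurable
  show G[measurable]: "G \<in> sets N"
    unfolding G_def by measurable
  have D_meas[measurable]: "D i \<in> borel_measurable N" if "i \<in> I" for i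
    unfolding D_def using that by measurable
  have upd: "\<omega> (j := \<rho> (\<omega> j)) \<in> space N" if "\<omega> \<in> space N" "j \<in> I" for \<omega> j
    using that measurable_space[OF rho_meas] by (auto simp: N_def space_PiM PiE_def extensional_def Pi_def)
  have d_inv': "d i (\<omega> (j := \<rho> (\<omega> j))) = d i \<omega>" if "\<omega> \<in> space N" "j \<in> I" "i \<in> I" for \<omega> i j
    using d_inv[OF that(3,2)] that(1) by (simp add: invariant_at_def N_def)
  have U_inv': "U ((\<omega> (j := \<rho> (\<omega> j))) i) = U (\<omega> i)" if "\<omega> \<in> space N" "j \<in> I" "i \<in> I" for \<omega> i j
    using that U_rho[of "\<omega> j"] by (auto simp: N_def space_PiM PiE_def)
  \<comment> \<open>The sum defining \<open>G\<close> involves only \<open>U\<close> and the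
    \<open>d k\<close>, none of which sees the erased part, so \<open>G\<close> and the truncated
    \<open>D i\<close> inherit the invariance.\<close>
  have D_inv: "invariant_at I j (D i)" if "i \<in> I" "j \<in> I" for i j
  proof -
    have "(\<Sum>k\<in>I. U ((\<omega> (j := \<rho> (\<omega> j))) k) * (d k (\<omega> (j := \<rho> (\<omega> j))))\<^sup>2) = (\<Sum>k\<in>I. U (\<omega> k) * (d k \<omega>)\<^sup>2)"
      if "\<omega> \<in> space N" for \<omega>
      by (rule sum.cong[OF refl]) (simp only: d_inv'[OF that \<open>j \<in> I\<close>] U_inv'[OF that \<open>j \<in> I\<close>])
    then have "(\<omega> (j := \<rho> (\<omega> j)) \<in> G) = (\<omega> \<in> G)" if "\<omega> \<in> space N" for \<omega>
      using upd[OF that \<open>j \<in> I\<close>] that by (simp add: G_def)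
    then show ?thesis
      using d_inv'[OF _ \<open>j \<in> I\<close> \<open>i \<in> I\<close>] by (auto simp: invariant_at_def D_def N_def[symmetric] indicator_def)
  qed

  have U_ae: "AE \<omega> in N. \<forall>i\<in>I. 0 \<le> U (\<omega> i)"
    unfolding N_def by (rule AE_PiM_U_nonneg[OF I])
  have "(\<integral>\<^sup>+\<omega>. ennreal (\<Sum>i\<in>I. (e (\<omega> i) * D i \<omega>)\<^sup>2) \<partial>N)
      = (\<integral>\<^sup>+\<omega>. (\<Sum>i\<in>I. ennreal ((e (\<omega> i))\<^sup>2) * ennreal ((D i \<omega>)\<^sup>2)) \<partial>N)"
    by (intro nn_integral_cong) (simp add: sum_ennreal[symmetric] power_mult_distrib ennreal_mult)
  also have "\<dots> = (\<Sum>i\<in>I. \<integral>\<^sup>+\<omega>. ennreal ((e (\<omega> i))\<^sup>2) * ennreal ((D i \<omega>)\<^sup>2) \<partial>N)"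
    by (rule nn_integral_sum) measurable
  \<comment> \<open>Each squared noise is traded for its conditional variance; this rests on the
    invariance of \<open>D i\<close> at its own coordinate.\<close>
  also have "\<dots> = (\<Sum>i\<in>I. \<integral>\<^sup>+\<omega>. ennreal (U (\<omega> i)) * ennreal ((D i \<omega>)\<^sup>2) \<partial>N)"
  proof (rule sum.cong[OF refl])
    fix i assume i: "i \<in> I"
    have "invariant_at I i (\<lambda>\<omega>. ennreal ((D i \<omega>)\<^sup>2))"
      using D_inv[OF i i] by (simp add: invariant_at_def)
    moreover have "(\<lambda>\<omega>. ennreal ((D i \<omega>)\<^sup>2)) \<in> borel_measurable N"
      using i by measurable
    ultimately show "(\<integral>\<^sup>+\<omega>. ennreal ((e (\<omega> i))\<^sup>2) * ennreal ((D i \<omega>)\<^sup>2) \<partial>N)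
      = (\<integral>\<^sup>+\<omega>. ennreal (U (\<omega> i)) * ennreal ((D i \<omega>)\<^sup>2) \<partial>N)"
      unfolding N_def using nn_integral_coordinate(2)[OF I i] by blast
  qed
  also have "\<dots> = (\<integral>\<^sup>+\<omega>. (\<Sum>i\<in>I. ennreal (U (\<omega> i)) * ennreal ((D i \<omega>)\<^sup>2)) \<partial>N)"
    by (rule nn_integral_sum[symmetric]) measurable
  \<comment> \<open>A pointwise bound: on \<open>G\<close> the weighted sum is at most
    \<open>\<kappa>\<close> by the choice of \<open>G\<close>, off \<open>G\<close> it is
    zero.\<close>
  also have "\<dots> \<le> (\<integral>\<^sup>+\<omega>. ennreal \<kappa> \<partial>N)"
  proof (rule nn_integral_mono_AE, use U_ae in eventually_elim)
    fix \<omega> assume U: "\<forall>i\<in>I. 0 \<le> U (\<omega> i)"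
    then have "(\<Sum>i\<in>I. ennreal (U (\<omega> i)) * ennreal ((D i \<omega>)\<^sup>2)) = ennreal (\<Sum>i\<in>I. U (\<omega> i) * (D i \<omega>)\<^sup>2)"
      by (simp add: sum_ennreal[symmetric] ennreal_mult)
    also have "\<dots> \<le> ennreal \<kappa>"
      using \<kappa> by (intro ennreal_leI) (auto simp: D_def G_def indicator_def)
    finally show "(\<Sum>i\<in>I. ennreal (U (\<omega> i)) * ennreal ((D i \<omega>)\<^sup>2)) \<le> ennreal \<kappa>" .
  qed
  also have "\<dots> = ennreal \<kappa>" by (simp add: N.emeasure_space_1)
  finally have nn: "(\<integral>\<^sup>+\<omega>. ennreal (\<Sum>i\<in>I. (e (\<omega> i) * D i \<omega>)\<^sup>2) \<partial>N) \<le> ennreal \<kappa>" .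
  show int: "integrable N (\<lambda>\<omega>. \<Sum>i\<in>I. (e (\<omega> i) * D i \<omega>)\<^sup>2)"
    by (rule integrableI_bounded) (use nn in \<open>auto simp: sum_nonneg top_unique less_top[symmetric]\<close>)
  show le: "(\<integral>\<omega>. (\<Sum>i\<in>I. (e (\<omega> i) * D i \<omega>)\<^sup>2) \<partial>N) \<le> \<kappa>"
    using nn \<kappa> by (subst (asm) nn_integral_eq_integral[OF int]) (auto simp: sum_nonneg)
  have int1: "integrable N (\<lambda>\<omega>. (e (\<omega> i) * D i \<omega>)\<^sup>2)" if "i \<in> I" for i
  proof (rule Bochner_Integration.integrable_bound[OF int])
    have "(e (\<omega> i) * D i \<omega>)\<^sup>2 \<le> (\<Sum>i\<in>I. (e (\<omega> i) * D i \<omega>)\<^sup>2)" for \<omega>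
      by (rule member_le_sum[of i I "\<lambda>i. (e (\<omega> i) * D i \<omega>)\<^sup>2"]) (use that I in auto)
    then show "AE \<omega> in N. norm ((e (\<omega> i) * D i \<omega>)\<^sup>2) \<le> norm (\<Sum>i\<in>I. (e (\<omega> i) * D i \<omega>)\<^sup>2)"
      by (simp add: sum_nonneg)
  qed (use that in measurable)
  have int2: "integrable N (\<lambda>\<omega>. (e (\<omega> i) * D i \<omega>) * (e (\<omega> j) * D j \<omega>))" if "i \<in> I" "j \<in> I" for i j
  proof (rule Bochner_Integration.integrable_bound[OF Bochner_Integration.integrable_add[OF int1[OF that(1)] int1[OF that(2)]]])
    have "\<bar>a * b\<bar> \<le> a\<^sup>2 + b\<^sup>2" for a b :: real
    proof -
      have "2 * \<bar>a * b\<bar> \<le> a\<^sup>2 + b\<^sup>2"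
        using sum_squares_bound[of "\<bar>a\<bar>" "\<bar>b\<bar>"] by (simp add: abs_mult mult.assoc)
      then show ?thesis using abs_ge_zero[of "a * b"] by linarith
    qed
    then show "AE \<omega> in N. norm ((e (\<omega> i) * D i \<omega>) * (e (\<omega> j) * D j \<omega>))
        \<le> norm ((e (\<omega> i) * D i \<omega>)\<^sup>2 + (e (\<omega> j) * D j \<omega>)\<^sup>2)"
      by (intro AE_I2) (simp only: real_norm_def abs_of_nonneg[OF sum_power2_ge_zero])
  qed (use that in measurable)
  \<comment> \<open>Erasing coordinate \<open>i\<close> does not touch \<open>e (\<omega> j)\<close>
    for \<open>j \<noteq> i\<close>, so everything except the factor \<open>e (\<omega> i)\<close>
    is invariant at \<open>i\<close>.\<close>
  have cross: "(\<integral>\<omega>. (e (\<omega> i) * D i \<omega>) * (e (\<omega> j) * D j \<omega>) \<partial>N) = 0" if "i \<in> I" "j \<in> I" "i \<noteq> j" for i j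
  proof -
    let ?G = "\<lambda>\<omega>. D i \<omega> * (e (\<omega> j) * D j \<omega>)"
    have "invariant_at I i ?G"
      using D_inv[OF that(1) that(1)] D_inv[OF that(2) that(1)] that(3) by (simp add: invariant_at_def)
    moreover have "?G \<in> borel_measurable N" using that by measurable
    ultimately have "(\<integral>\<omega>. e (\<omega> i) * ?G \<omega> \<partial>N) = 0"
      unfolding N_def by (intro integral_coordinate_zero[OF I that(1)])
    then show ?thesis by (simp add: mult.assoc)
  qed
  have sq: "(\<Sum>i\<in>I. e (\<omega> i) * D i \<omega>)\<^sup>2 = (\<Sum>i\<in>I. \<Sum>j\<in>I. (e (\<omega> i) * D i \<omega>) * (e (\<omega> j) * D j \<omega>))" for \<omega>
    by (simp add: power2_eq_square sum_product)
  show "integrable N (\<lambda>\<omega>. (\<Sum>i\<in>I. e (\<omega> i) * D i \<omega>)\<^sup>2)"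
    unfolding sq by (intro Bochner_Integration.integrable_sum int2)
  have "(\<integral>\<omega>. (\<Sum>i\<in>I. e (\<omega> i) * D i \<omega>)\<^sup>2 \<partial>N)
      = (\<Sum>i\<in>I. \<Sum>j\<in>I. (\<integral>\<omega>. (e (\<omega> i) * D i \<omega>) * (e (\<omega> j) * D j \<omega>) \<partial>N))"
    unfolding sq by (simp add: Bochner_Integration.integral_sum Bochner_Integration.integrable_sum int2)
  also have "\<dots> = (\<Sum>i\<in>I. \<Sum>j\<in>I. if i = j then (\<integral>\<omega>. (e (\<omega> i) * D i \<omega>)\<^sup>2 \<partial>N) else 0)"
    by (intro sum.cong refl) (auto simp: cross power2_eq_square)
  also have "\<dots> = (\<integral>\<omega>. (\<Sum>i\<in>I. (e (\<omega> i) * D i \<omega>)\<^sup>2) \<partial>N)"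
    using I by (simp add: Bochner_Integration.integral_sum int1)
  finally show "(\<integral>\<omega>. (\<Sum>i\<in>I. e (\<omega> i) * D i \<omega>)\<^sup>2 \<partial>N) \<le> \<kappa>" using le by simp
qed

text \<open>A conditional Chebyshev and a conditional Markov inequality. The event that the
  conditional variance exceeds \<open>\<kappa>\<close> is paid for by its probability; off it
  \<open>d\<close> agrees with its truncation, whose second moments are at most
  \<open>\<kappa>\<close>. The free level \<open>\<kappa>\<close> makes smallness in probability of
  the conditional variance sufficient.\<close>

theorem conditional_tail_bounds:
  fixes d :: "'i \<Rightarrow> ('i \<Rightarrow> 'a) \<Rightarrow> real"
  assumes I: "finite I"
    and d_meas: "\<And>i. i \<in> I \<Longrightarrow> d i \<in> borel_measurable (PiM I (\<lambda>_. M))"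
    and d_inv: "\<And>i j. i \<in> I \<Longrightarrow> j \<in> I \<Longrightarrow> invariant_at I j (d i)"
    and \<kappa>: "0 \<le> \<kappa>" and \<delta>: "0 < \<delta>"
  defines "N \<equiv> PiM I (\<lambda>_. M)"
  shows "measure N {\<omega> \<in> space N. \<bar>\<Sum>i\<in>I. e (\<omega> i) * d i \<omega>\<bar> > \<delta>}
      \<le> measure N {\<omega> \<in> space N. (\<Sum>i\<in>I. U (\<omega> i) * (d i \<omega>)\<^sup>2) > \<kappa>} + \<kappa> / \<delta>\<^sup>2"
    and "measure N {\<omega> \<in> space N. (\<Sum>i\<in>I. (e (\<omega> i) * d i \<omega>)\<^sup>2) > \<delta>}
      \<le> measure N {\<omega> \<in> space N. (\<Sum>i\<in>I. U (\<omega> i) * (d i \<omega>)\<^sup>2) > \<kappa>} + \<kappa> / \<delta>"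
proof -
  interpret N: prob_space N
    unfolding N_def by (rule prob_space_PiM) (rule prob_space_axioms)
  have comp[measurable]: "(\<lambda>\<omega>. \<omega> i) \<in> N \<rightarrow>\<^sub>M M" if "i \<in> I" for i
    unfolding N_def using that by simp
  have dm[measurable]: "d i \<in> borel_measurable N" if "i \<in> I" for i
    unfolding N_def by (rule d_meas[OF that])
  have eU[measurable]: "(\<lambda>\<omega>. e (\<omega> i)) \<in> borel_measurable N" "(\<lambda>\<omega>. U (\<omega> i)) \<in> borel_measurable N" if "i \<in> I" for i
    using that by measurable
  define G where "G = {\<omega> \<in> space N. (\<Sum>i\<in>I. U (\<omega> i) * (d i \<omega>)\<^sup>2) \<le> \<kappa>}"
  define D where "D = (\<lambda>i \<omega>. d i \<omega> * indicator G \<omega>)"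
  let ?B = "{\<omega> \<in> space N. (\<Sum>i\<in>I. U (\<omega> i) * (d i \<omega>)\<^sup>2) > \<kappa>}"
  note tr = truncated_second_moments[of I d, OF I d_meas d_inv \<kappa>, folded N_def, folded G_def]
  have G[measurable]: "G \<in> sets N" unfolding G_def by measurable
  have D_meas[measurable]: "D i \<in> borel_measurable N" if "i \<in> I" for i
    unfolding D_def using that by measurable
  have B[measurable]: "?B \<in> sets N" by measurable
  have eq: "D i \<omega> = d i \<omega>" if "\<omega> \<in> space N" "\<omega> \<notin> ?B" for i \<omega>
    using that by (auto simp: D_def G_def)
  have S1[measurable]: "{\<omega> \<in> space N. (\<Sum>i\<in>I. e (\<omega> i) * D i \<omega>)\<^sup>2 \<ge> \<delta>\<^sup>2} \<in> sets N"
    and S2[measurable]: "{\<omega> \<in> space N. (\<Sum>i\<in>I. (e (\<omega> i) * D i \<omega>)\<^sup>2) \<ge> \<delta>} \<in> sets N"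
    by measurable
  have m1: "measure N {\<omega> \<in> space N. (\<Sum>i\<in>I. e (\<omega> i) * D i \<omega>)\<^sup>2 \<ge> \<delta>\<^sup>2} \<le> \<kappa> / \<delta>\<^sup>2"
  proof -
    have "measure N {\<omega> \<in> space N. (\<Sum>i\<in>I. e (\<omega> i) * D i \<omega>)\<^sup>2 \<ge> \<delta>\<^sup>2} \<le> (\<integral>\<omega>. (\<Sum>i\<in>I. e (\<omega> i) * D i \<omega>)\<^sup>2 \<partial>N) / \<delta>\<^sup>2"
      by (rule integral_Markov_inequality_measure[where A="space N"]) (use tr(4) \<delta> in \<open>auto simp: D_def\<close>)
    also have "\<dots> \<le> \<kappa> / \<delta>\<^sup>2"
      using tr(5) by (intro divide_right_mono) (auto simp: D_def)
    finally show ?thesis .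
  qed
  have m2: "measure N {\<omega> \<in> space N. (\<Sum>i\<in>I. (e (\<omega> i) * D i \<omega>)\<^sup>2) \<ge> \<delta>} \<le> \<kappa> / \<delta>"
  proof -
    have "measure N {\<omega> \<in> space N. (\<Sum>i\<in>I. (e (\<omega> i) * D i \<omega>)\<^sup>2) \<ge> \<delta>} \<le> (\<integral>\<omega>. (\<Sum>i\<in>I. (e (\<omega> i) * D i \<omega>)\<^sup>2) \<partial>N) / \<delta>"
      by (rule integral_Markov_inequality_measure[where A="space N"]) (use tr(2) \<delta> in \<open>auto simp: D_def sum_nonneg\<close>)
    also have "\<dots> \<le> \<kappa> / \<delta>"
      using tr(3) \<delta> by (intro divide_right_mono) (auto simp: D_def)
    finally show ?thesis .
  qed
  have sub1: "{\<omega> \<in> space N. \<bar>\<Sum>i\<in>I. e (\<omega> i) * d i \<omega>\<bar> > \<delta>} \<subseteq> ?B \<union> {\<omega> \<in> space N. (\<Sum>i\<in>I. e (\<omega> i) * D i \<omega>)\<^sup>2 \<ge> \<delta>\<^sup>2}"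
  proof safe
    fix \<omega> assume *: "\<delta> < \<bar>\<Sum>i\<in>I. e (\<omega> i) * d i \<omega>\<bar>" "\<omega> \<in> space N" "\<not> \<delta>\<^sup>2 \<le> (\<Sum>i\<in>I. e (\<omega> i) * D i \<omega>)\<^sup>2"
    show "\<kappa> < (\<Sum>i\<in>I. U (\<omega> i) * (d i \<omega>)\<^sup>2)"
    proof (rule ccontr)
      assume "\<not> ?thesis"
      then have "D i \<omega> = d i \<omega>" for i using eq[of \<omega>] * by auto
      then show False using * \<delta> abs_le_square_iff[of \<delta> "\<Sum>i\<in>I. e (\<omega> i) * d i \<omega>"] by simp
    qed
  qed
  have sub2: "{\<omega> \<in> space N. (\<Sum>i\<in>I. (e (\<omega> i) * d i \<omega>)\<^sup>2) > \<delta>} \<subseteq> ?B \<union> {\<omega> \<in> space N. (\<Sum>i\<in>I. (e (\<omega> i) * D i \<omega>)\<^sup>2) \<ge> \<delta>}"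
  proof safe
    fix \<omega> assume *: "\<delta> < (\<Sum>i\<in>I. (e (\<omega> i) * d i \<omega>)\<^sup>2)" "\<omega> \<in> space N" "\<not> \<delta> \<le> (\<Sum>i\<in>I. (e (\<omega> i) * D i \<omega>)\<^sup>2)"
    show "\<kappa> < (\<Sum>i\<in>I. U (\<omega> i) * (d i \<omega>)\<^sup>2)"
    proof (rule ccontr)
      assume "\<not> ?thesis"
      then have "D i \<omega> = d i \<omega>" for i using eq[of \<omega>] * by auto
      then show False using * by simp
    qed
  qed
  show "measure N {\<omega> \<in> space N. \<bar>\<Sum>i\<in>I. e (\<omega> i) * d i \<omega>\<bar> > \<delta>} \<le> measure N ?B + \<kappa> / \<delta>\<^sup>2"
    using N.finite_measure_mono[OF sub1] measure_Un_le[OF B S1] m1 B S1 by fastforce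
  show "measure N {\<omega> \<in> space N. (\<Sum>i\<in>I. (e (\<omega> i) * d i \<omega>)\<^sup>2) > \<delta>} \<le> measure N ?B + \<kappa> / \<delta>"
    using N.finite_measure_mono[OF sub2] measure_Un_le[OF B S2] m2 B S2 by fastforce
qed

text \<open>A bounded factor leaves the conditional variance at the price of
  \<open>C\<^sup>2\<close>, so that the right-hand side involves the unweighted sum, which will be
  B_f or B_g.\<close>

corollary weighted_tail_bounds:
  fixes d v :: "'i \<Rightarrow> ('i \<Rightarrow> 'a) \<Rightarrow> real"
  assumes I: "finite I"
    and d_meas: "\<And>i. i \<in> I \<Longrightarrow> d i \<in> borel_measurable (PiM I (\<lambda>_. M))"
    and v_meas: "\<And>i. i \<in> I \<Longrightarrow> v i \<in> borel_measurable (PiM I (\<lambda>_. M))"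
    and d_inv: "\<And>i j. i \<in> I \<Longrightarrow> j \<in> I \<Longrightarrow> invariant_at I j (d i)"
    and v_inv: "\<And>i j. i \<in> I \<Longrightarrow> j \<in> I \<Longrightarrow> invariant_at I j (v i)"
    and v_le: "\<And>i \<omega>. \<bar>v i \<omega>\<bar> \<le> C"
    and \<kappa>: "0 \<le> \<kappa>" and \<delta>: "0 < \<delta>"
  defines "N \<equiv> PiM I (\<lambda>_. M)"
  shows "measure N {\<omega> \<in> space N. \<bar>\<Sum>i\<in>I. e (\<omega> i) * (d i \<omega> * v i \<omega>)\<bar> > \<delta>}
      \<le> measure N {\<omega> \<in> space N. \<bar>\<Sum>i\<in>I. U (\<omega> i) * (d i \<omega>)\<^sup>2\<bar> > \<kappa>} + C\<^sup>2 * \<kappa> / \<delta>\<^sup>2"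
    and "measure N {\<omega> \<in> space N. (\<Sum>i\<in>I. (e (\<omega> i) * (d i \<omega> * v i \<omega>))\<^sup>2) > \<delta>}
      \<le> measure N {\<omega> \<in> space N. \<bar>\<Sum>i\<in>I. U (\<omega> i) * (d i \<omega>)\<^sup>2\<bar> > \<kappa>} + C\<^sup>2 * \<kappa> / \<delta>"
proof -
  interpret N: prob_space N
    unfolding N_def by (rule prob_space_PiM) (rule prob_space_axioms)
  have comp[measurable]: "(\<lambda>\<omega>. \<omega> i) \<in> N \<rightarrow>\<^sub>M M" if "i \<in> I" for i
    unfolding N_def using that by simp
  have dv[measurable]: "d i \<in> borel_measurable N" "v i \<in> borel_measurable N" if "i \<in> I" for i
    unfolding N_def by (rule d_meas[OF that], rule v_meas[OF that])
  have eU[measurable]: "(\<lambda>\<omega>. U (\<omega> i)) \<in> borel_measurable N" if "i \<in> I" for i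
    using that by measurable
  let ?dv = "\<lambda>i \<omega>. d i \<omega> * v i \<omega>"
  have C2: "(v i \<omega>)\<^sup>2 \<le> C\<^sup>2" for i \<omega>
    using power_mono[OF v_le[of i \<omega>], of 2] by simp
  have mono: "measure N {\<omega> \<in> space N. (\<Sum>i\<in>I. U (\<omega> i) * (?dv i \<omega>)\<^sup>2) > C\<^sup>2 * \<kappa>}
      \<le> measure N {\<omega> \<in> space N. \<bar>\<Sum>i\<in>I. U (\<omega> i) * (d i \<omega>)\<^sup>2\<bar> > \<kappa>}"
  \<comment> \<open>The inclusion of events holds almost surely, because \<open>U\<close> is
    nonnegative almost surely.\<close>
  proof (rule N.finite_measure_mono_AE)
    show "AE \<omega> in N. \<omega> \<in> {\<omega> \<in> space N. (\<Sum>i\<in>I. U (\<omega> i) * (?dv i \<omega>)\<^sup>2) > C\<^sup>2 * \<kappa>} \<longrightarrow>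
        \<omega> \<in> {\<omega> \<in> space N. \<bar>\<Sum>i\<in>I. U (\<omega> i) * (d i \<omega>)\<^sup>2\<bar> > \<kappa>}"
      using AE_PiM_U_nonneg[OF I, folded N_def]
    proof eventually_elim
      case (elim \<omega>)
      have "(\<Sum>i\<in>I. U (\<omega> i) * (?dv i \<omega>)\<^sup>2) \<le> (\<Sum>i\<in>I. C\<^sup>2 * (U (\<omega> i) * (d i \<omega>)\<^sup>2))"
      proof (rule sum_mono)
        fix i assume "i \<in> I"
        then have "(U (\<omega> i) * (d i \<omega>)\<^sup>2) * (v i \<omega>)\<^sup>2 \<le> (U (\<omega> i) * (d i \<omega>)\<^sup>2) * C\<^sup>2"
          using elim by (intro mult_left_mono C2) auto
        then show "U (\<omega> i) * (?dv i \<omega>)\<^sup>2 \<le> C\<^sup>2 * (U (\<omega> i) * (d i \<omega>)\<^sup>2)"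
          by (simp add: power_mult_distrib mult_ac)
      qed
      also have "\<dots> = C\<^sup>2 * (\<Sum>i\<in>I. U (\<omega> i) * (d i \<omega>)\<^sup>2)" by (simp add: sum_distrib_left)
      also have "\<dots> \<le> C\<^sup>2 * \<bar>\<Sum>i\<in>I. U (\<omega> i) * (d i \<omega>)\<^sup>2\<bar>" by (intro mult_left_mono) auto
      finally have le: "(\<Sum>i\<in>I. U (\<omega> i) * (?dv i \<omega>)\<^sup>2) \<le> C\<^sup>2 * \<bar>\<Sum>i\<in>I. U (\<omega> i) * (d i \<omega>)\<^sup>2\<bar>" .
      show ?case
      proof safe
        assume "C\<^sup>2 * \<kappa> < (\<Sum>i\<in>I. U (\<omega> i) * (?dv i \<omega>)\<^sup>2)"
        then have "C\<^sup>2 * \<kappa> < C\<^sup>2 * \<bar>\<Sum>i\<in>I. U (\<omega> i) * (d i \<omega>)\<^sup>2\<bar>" using le by linarith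
        then show "\<kappa> < \<bar>\<Sum>i\<in>I. U (\<omega> i) * (d i \<omega>)\<^sup>2\<bar>"
          by (rule mult_left_less_imp_less) simp
      qed
    qed
  qed measurable
  have m: "?dv i \<in> borel_measurable (PiM I (\<lambda>_. M))" if "i \<in> I" for i
    using d_meas[OF that] v_meas[OF that] by measurable
  have inv: "invariant_at I j (?dv i)" if "i \<in> I" "j \<in> I" for i j
    using d_inv[OF that] v_inv[OF that] by (simp add: invariant_at_def)
  note b = conditional_tail_bounds[of I ?dv "C\<^sup>2 * \<kappa>", OF I m inv _ \<delta>, folded N_def]
  show "measure N {\<omega> \<in> space N. \<bar>\<Sum>i\<in>I. e (\<omega> i) * (d i \<omega> * v i \<omega>)\<bar> > \<delta>}
      \<le> measure N {\<omega> \<in> space N. \<bar>\<Sum>i\<in>I. U (\<omega> i) * (d i \<omega>)\<^sup>2\<bar> > \<kappa>} + C\<^sup>2 * \<kappa> / \<delta>\<^sup>2"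
    using b(1) mono \<kappa> by fastforce
  show "measure N {\<omega> \<in> space N. (\<Sum>i\<in>I. (e (\<omega> i) * (d i \<omega> * v i \<omega>))\<^sup>2) > \<delta>}
      \<le> measure N {\<omega> \<in> space N. \<bar>\<Sum>i\<in>I. U (\<omega> i) * (d i \<omega>)\<^sup>2\<bar> > \<kappa>} + C\<^sup>2 * \<kappa> / \<delta>"
    using b(2) mono \<kappa> by fastforce
qed

end

section \<open>A central limit theorem for row-wise i.i.d. arrays\<close>

lemma char_PiM_sum:
  fixes g :: "'a \<Rightarrow> real"
  assumes P: "prob_space P" and I: "finite I" and g[measurable]: "g \<in> borel_measurable P"
  shows "char (distr (PiM I (\<lambda>_. P)) borel (\<lambda>\<omega>. \<Sum>i\<in>I. g (\<omega> i))) t = (char (distr P borel g) t) ^ card I"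
proof -
  interpret P: prob_space P by fact
  interpret product_sigma_finite "\<lambda>_. P" by standard
  have [measurable]: "(\<lambda>\<omega>. g (\<omega> i)) \<in> borel_measurable (PiM I (\<lambda>_. P))" if "i \<in> I" for i
    using that by measurable
  have [measurable]: "(\<lambda>\<omega>. \<Sum>i\<in>I. g (\<omega> i)) \<in> borel_measurable (PiM I (\<lambda>_. P))"
    by measurable
  have "char (distr (PiM I (\<lambda>_. P)) borel (\<lambda>\<omega>. \<Sum>i\<in>I. g (\<omega> i))) t
      = (\<integral>\<omega>. iexp (t * (\<Sum>i\<in>I. g (\<omega> i))) \<partial>PiM I (\<lambda>_. P))"
    by (simp add: char_def integral_distr)
  also have "\<dots> = (\<integral>\<omega>. (\<Prod>i\<in>I. iexp (t * g (\<omega> i))) \<partial>PiM I (\<lambda>_. P))"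
    by (simp add: sum_distrib_left exp_sum I)
  also have "\<dots> = (\<Prod>i\<in>I. \<integral>x. iexp (t * g x) \<partial>P)"
    by (rule product_integral_prod[OF I]) (intro P.integrable_const_bound[where B=1], auto)
  also have "\<dots> = (char (distr P borel g) t) ^ card I"
    by (simp add: char_def integral_distr)
  finally show ?thesis .
qed

text \<open>Each index has its own measure. Integrability is demanded separately because the Bochner
  integral of a non-integrable function is 0, which would satisfy the tail condition
  vacuously.\<close>

definition uniformly_integrable :: "('i \<Rightarrow> 'a measure) \<Rightarrow> ('i \<Rightarrow> 'a \<Rightarrow> real) \<Rightarrow> bool" where
  "uniformly_integrable P W \<longleftrightarrow>
     (\<forall>n. integrable (P n) (W n)) \<and>
     (\<forall>\<epsilon>>0. \<exists>K>0. \<forall>n. (\<integral>x. \<bar>W n x\<bar> * indicator {x. \<bar>W n x\<bar> > K} x \<partial>P n) \<le> \<epsilon>)"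

text \<open>For a fixed law, dominated convergence removes the remainder of the second-order
  expansion of the characteristic function. Here the law changes with the row, and uniform
  integrability of the squares takes over: truncation bounds the remainder uniformly over the
  rows.\<close>

theorem row_iid_clt:
  fixes \<zeta> :: "nat \<Rightarrow> 'a \<Rightarrow> real"
  assumes P: "\<And>n. prob_space (P n)"
    and \<zeta>[measurable]: "\<And>n. \<zeta> n \<in> borel_measurable (P n)"
    and mean: "\<And>n. (\<integral>x. \<zeta> n x \<partial>P n) = 0"
    and var: "\<And>n. (\<integral>x. (\<zeta> n x)\<^sup>2 \<partial>P n) = 1"
    and ui: "uniformly_integrable P (\<lambda>n x. (\<zeta> n x)\<^sup>2)"
  shows "weak_conv_m (\<lambda>n. distr (PiM {..<n} (\<lambda>_. P n)) borel (\<lambda>\<omega>. \<Sum>i<n. \<zeta> n (\<omega> i) / sqrt n))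
           std_normal_distribution"
proof (rule levy_continuity)
  show "real_distribution std_normal_distribution" by (rule real_dist_normal_dist)
  show "real_distribution (distr (PiM {..<n} (\<lambda>_. P n)) borel (\<lambda>\<omega>. \<Sum>i<n. \<zeta> n (\<omega> i) / sqrt n))" for n
  proof -
    interpret N: prob_space "PiM {..<n} (\<lambda>_. P n)" by (rule prob_space_PiM) (rule P)
    show ?thesis by (rule N.real_distribution_distr) measurable
  qed
  fix t :: real
  define s where "s n = t / sqrt (real n)" for n
  \<comment> \<open>Times \<open>(s n)\<^sup>2 / 6\<close>, this bounds the error of the
    second-order expansion of the characteristic function of \<open>\<zeta> n\<close> at
    \<open>s n\<close>, in the form of \<open>char_approx3'\<close>.\<close>
  define L where "L n = (\<integral>x. min (6 * (\<zeta> n x)\<^sup>2) (\<bar>s n\<bar> * \<bar>\<zeta> n x\<bar> ^ 3) \<partial>P n)" for n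
  have sq_int[simp]: "integrable (P n) (\<lambda>x. (\<zeta> n x)\<^sup>2)" for n
    using ui by (simp add: uniformly_integrable_def)
  have int1[simp]: "integrable (P n) (\<zeta> n)" for n
  proof -
    interpret prob_space "P n" by (rule P)
    show ?thesis by (rule square_integrable_imp_integrable) auto
  qed
  have L_lim: "L \<longlonglongrightarrow> 0"
  proof (rule tendstoI)
    fix \<epsilon> :: real assume "0 < \<epsilon>"
    \<comment> \<open>The 24 leaves \<epsilon>/4 after the factor 6 in \<open>L\<close>; another
      \<epsilon>/4 goes to \<open>\<bar>s n\<bar> * sqrt K\<close>.\<close>
    then obtain K where K: "K > 0"
      "\<And>n. (\<integral>x. \<bar>(\<zeta> n x)\<^sup>2\<bar> * indicator {x. \<bar>(\<zeta> n x)\<^sup>2\<bar> > K} x \<partial>P n) \<le> \<epsilon> / 24"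
      using ui unfolding uniformly_integrable_def by (meson divide_pos_pos zero_less_numeral)
    have bound: "L n \<le> \<epsilon> / 4 + \<bar>s n\<bar> * sqrt K" and nn: "L n \<ge> 0" for n
    proof -
      interpret prob_space "P n" by (rule P)
      show "L n \<ge> 0" unfolding L_def by (rule integral_nonneg_AE) auto
      \<comment> \<open>Above the level the quadratic entry of the minimum is used; below it one of
        the three factors \<open>\<bar>x\<bar>\<close> is at most \<open>sqrt K\<close>, and the
        remaining square will integrate to 1.\<close>
      have pw: "min (6 * x\<^sup>2) (\<bar>s n\<bar> * \<bar>x\<bar> ^ 3) \<le> 6 * (\<bar>x\<^sup>2\<bar> * indicator {y. \<bar>y\<^sup>2\<bar> > K} x) + \<bar>s n\<bar> * sqrt K * x\<^sup>2" for x :: real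
      proof (cases "\<bar>x\<^sup>2\<bar> > K")
        case True
        have "0 \<le> \<bar>s n\<bar> * sqrt K * x\<^sup>2" using K by simp
        then show ?thesis using True by (simp add: min_def)
      next
        case False
        then have "\<bar>x\<bar> \<le> sqrt K" using real_le_rsqrt[of "\<bar>x\<bar>" K] by simp
        then have "\<bar>x\<bar> * x\<^sup>2 \<le> sqrt K * x\<^sup>2" by (intro mult_right_mono) auto
        then have "\<bar>s n\<bar> * (\<bar>x\<bar> * x\<^sup>2) \<le> \<bar>s n\<bar> * (sqrt K * x\<^sup>2)" by (intro mult_left_mono) auto
        moreover have "\<bar>x\<bar> ^ 3 = \<bar>x\<bar> * x\<^sup>2" by (simp add: power3_eq_cube power2_eq_square)
        ultimately show ?thesis using False by (simp add: mult.assoc)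
      qed
      have i1: "integrable (P n) (\<lambda>x. \<bar>(\<zeta> n x)\<^sup>2\<bar> * indicator {x. \<bar>(\<zeta> n x)\<^sup>2\<bar> > K} x)"
        by (rule Bochner_Integration.integrable_bound[OF sq_int]) (auto simp: indicator_def)
      have i0: "integrable (P n) (\<lambda>x. min (6 * (\<zeta> n x)\<^sup>2) (\<bar>s n\<bar> * \<bar>\<zeta> n x\<bar> ^ 3))"
        by (rule Bochner_Integration.integrable_bound[of _ "\<lambda>x. 6 * (\<zeta> n x)\<^sup>2"]) auto
      have "L n \<le> (\<integral>x. 6 * (\<bar>(\<zeta> n x)\<^sup>2\<bar> * indicator {x. \<bar>(\<zeta> n x)\<^sup>2\<bar> > K} x) + \<bar>s n\<bar> * sqrt K * (\<zeta> n x)\<^sup>2 \<partial>P n)"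
        unfolding L_def using pw i0 i1
        by (intro integral_mono) (auto simp: indicator_def)
      also have "\<dots> = 6 * (\<integral>x. \<bar>(\<zeta> n x)\<^sup>2\<bar> * indicator {x. \<bar>(\<zeta> n x)\<^sup>2\<bar> > K} x \<partial>P n) + \<bar>s n\<bar> * sqrt K * (\<integral>x. (\<zeta> n x)\<^sup>2 \<partial>P n)"
        by (subst Bochner_Integration.integral_add) (use i1 in auto)
      also have "\<dots> \<le> \<epsilon> / 4 + \<bar>s n\<bar> * sqrt K"
        using K(2)[of n] by (simp add: var)
      finally show "L n \<le> \<epsilon> / 4 + \<bar>s n\<bar> * sqrt K" .
    qed
    have "(\<lambda>n. \<bar>s n\<bar> * sqrt K) \<longlonglongrightarrow> 0"
      unfolding s_def
      by (intro tendsto_mult_left_zero tendsto_rabs_zero real_tendsto_divide_at_top[OF tendsto_const]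
          filterlim_compose[OF sqrt_at_top filterlim_real_sequentially])
    then have "eventually (\<lambda>n. \<bar>s n\<bar> * sqrt K < \<epsilon> / 4) sequentially"
      using \<open>0 < \<epsilon>\<close> by (intro order_tendstoD) auto
    then show "eventually (\<lambda>n. dist (L n) 0 < \<epsilon>) sequentially"
    proof eventually_elim
      case (elim n)
      then show ?case using bound[of n] nn[of n] \<open>0 < \<epsilon>\<close> by (simp add: dist_real_def)
    qed
  qed
  define \<phi> where "\<phi> n = char (distr (PiM {..<n} (\<lambda>_. P n)) borel (\<lambda>\<omega>. \<Sum>i<n. \<zeta> n (\<omega> i) / sqrt n)) t" for n
  define \<psi> where "\<psi> n = char (distr (P n) borel (\<zeta> n)) (s n)" for n
  have \<phi>_eq: "\<phi> n = \<psi> n ^ n" for n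
  proof -
    have "char (distr (P n) borel (\<lambda>x. \<zeta> n x / sqrt n)) t = \<psi> n"
      unfolding \<psi>_def char_def s_def by (simp add: integral_distr mult.commute)
    then show ?thesis
      unfolding \<phi>_def by (subst char_PiM_sum[OF P]) auto
  qed
  have main: "eventually (\<lambda>n. norm (\<phi> n - (1 + (-(t^2) / 2) / n) ^ n) \<le> t\<^sup>2 / 6 * L n) sequentially"
  proof (rule eventually_sequentiallyI)
    fix n :: nat
    assume "n \<ge> nat (ceiling (t^2 / 4)) + 1"
    \<comment> \<open>The bound on \<open>n\<close> makes 1 - t^2/(2n) at least -1, so both bases
      have modulus at most 1, as \<open>norm_power_diff\<close> requires.\<close>
    hence n: "n \<ge> t^2 / 4" "n > 0" by linarith+
    interpret prob_space "P n" by (rule P)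
    interpret \<mu>: real_distribution "distr (P n) borel (\<zeta> n)" by (rule real_distribution_distr) measurable
    have "norm (\<psi> n - (1 - (s n)\<^sup>2 * 1 / 2)) \<le> (s n)\<^sup>2 / 6 * L n"
      unfolding \<psi>_def L_def
      by (rule char_approx3') (auto simp: mean var)
    also have "(s n)\<^sup>2 = t\<^sup>2 / n" by (simp add: s_def power_divide)
    finally have **: "norm (\<psi> n - (1 + (-(t^2) / 2) / n)) \<le> t\<^sup>2 / n / 6 * L n"
      by (simp add: mult_ac)
    have "norm (\<phi> n - (complex_of_real (1 + (-(t^2) / 2) / n))^n) \<le>
         n * norm (\<psi> n - (complex_of_real (1 + (-(t^2) / 2) / n)))"
      using n
      by (auto intro!: norm_power_diff \<mu>.cmod_char_le_1 abs_leI
               simp del: of_real_diff simp: of_real_diff[symmetric] divide_le_eq \<phi>_eq \<psi>_def)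
    also have "\<dots> \<le> n * (t\<^sup>2 / n / 6 * L n)"
      by (rule mult_left_mono) (use ** in auto)
    also have "\<dots> = t\<^sup>2 / 6 * L n"
      using n by simp
    finally show "norm (\<phi> n - (1 + (-(t^2) / 2) / n) ^ n) \<le> t\<^sup>2 / 6 * L n" by simp
  qed
  have "(\<lambda>n. complex_of_real ((1 + (-(t^2) / 2) / n)^n)) \<longlonglongrightarrow> complex_of_real (exp (-(t^2) / 2))"
    by (rule isCont_tendsto_compose [OF _ tendsto_exp_limit_sequentially]) auto
  then have "\<phi> \<longlonglongrightarrow> complex_of_real (exp (-(t^2) / 2))"
    by (rule Lim_transform)
       (rule Lim_null_comparison [OF _ tendsto_mult_right_zero[OF L_lim, of "t\<^sup>2 / 6"]], use main in simp)
  then show "(\<lambda>n. char (distr (PiM {..<n} (\<lambda>_. P n)) borel (\<lambda>\<omega>. \<Sum>i<n. \<zeta> n (\<omega> i) / sqrt n)) t)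
      \<longlonglongrightarrow> char std_normal_distribution t"
    by (simp add: \<phi>_def[abs_def] char_std_normal_distribution)
qed

text \<open>Polya's theorem, with the \<open>k\<close>-quantiles of \<open>F\<close> as a grid.\<close>

lemma continuous_cdf_uniform_convergence:
  fixes F :: "real \<Rightarrow> real" and G :: "nat \<Rightarrow> real \<Rightarrow> real"
  assumes cont: "continuous_on UNIV F" and mono: "mono F"
    and top: "(F \<longlongrightarrow> 1) at_top" and bot: "(F \<longlongrightarrow> 0) at_bot"
    and G_mono: "\<And>n. mono (G n)" and G_bds: "\<And>n t. 0 \<le> G n t" "\<And>n t. G n t \<le> 1"
    and lim: "\<And>t. (\<lambda>n. G n t) \<longlonglongrightarrow> F t" and "0 < \<epsilon>"
  shows "eventually (\<lambda>n. \<forall>t. \<bar>G n t - F t\<bar> \<le> \<epsilon>) sequentially"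
proof -
  obtain k :: nat where k: "k > 0" "1 / k < \<epsilon> / 3"
    using reals_Archimedean[of "\<epsilon> / 3"] \<open>0 < \<epsilon>\<close> by (metis inverse_eq_divide zero_less_divide_iff zero_less_numeral zero_less_Suc)
  have F_le1: "F t \<le> 1" for t
    by (rule tendsto_lowerbound[OF top]) (auto simp: eventually_at_top_linorder intro!: exI[of _ t] monoD[OF mono])
  have F_ge0: "F t \<ge> 0" for t
    by (rule tendsto_upperbound[OF bot]) (auto simp: eventually_at_bot_linorder intro!: exI[of _ t] monoD[OF mono])
  have ex: "\<exists>x. F x = real j / k" if "0 < j" "j < k" for j
  proof -
    have j: "0 < real j / k" "real j / k < 1" using that k by auto
    obtain a where a: "F a < real j / k"
      using eventually_happens[OF order_tendstoD(2)[OF bot j(1)]] by auto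
    obtain b where b: "real j / k < F b"
      using eventually_happens[OF order_tendstoD(1)[OF top j(2)]] by auto
    have "a \<le> b" using a b monoD[OF mono, of b a] by (meson le_cases less_le_trans not_le order_trans)
    then show ?thesis
      using IVT'[of F a "real j / k" b] a b continuous_on_subset[OF cont] by auto
  qed
  then obtain x where x: "\<And>j. 0 < j \<Longrightarrow> j < k \<Longrightarrow> F (x j) = real j / k" by metis
  have "eventually (\<lambda>n. \<forall>j\<in>{..<k}. \<bar>G n (x j) - F (x j)\<bar> < \<epsilon> / 3) sequentially"
  proof (rule eventually_ball_finite, simp, rule ballI)
    fix j
    show "eventually (\<lambda>n. \<bar>G n (x j) - F (x j)\<bar> < \<epsilon> / 3) sequentially"
      using tendstoD[OF lim[of "x j"], of "\<epsilon> / 3"] \<open>0 < \<epsilon>\<close> by (simp add: dist_real_def)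
  qed
  then show ?thesis
  proof eventually_elim
    fix n assume n: "\<forall>j\<in>{..<k}. \<bar>G n (x j) - F (x j)\<bar> < \<epsilon> / 3"
    show "\<forall>t. \<bar>G n t - F t\<bar> \<le> \<epsilon>"
    proof
      fix t
      \<comment> \<open>Index of the quantile cell:
        \<open>j / k \<le> F t < (j + 1) / k\<close>.\<close>
      define j where "j = nat \<lfloor>F t * k\<rfloor>"
      have jl: "real j \<le> F t * k" and ju: "F t * k < real j + 1"
        unfolding j_def using F_ge0[of t] k by (auto simp: of_nat_nat)
      then have jl': "real j / k \<le> F t" and ju': "F t < (real j + 1) / k"
        using k by (auto simp: field_simps)
      have up: "G n t \<le> F t + \<epsilon>"
      proof (cases "j + 1 < k")
        case True
        have xj: "F (x (j + 1)) = (real j + 1) / k" using x[of "j + 1"] True by simp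
        then have "t \<le> x (j + 1)" using ju' monoD[OF mono, of "x (j+1)" t] by force
        then have "G n t \<le> G n (x (j + 1))" by (rule monoD[OF G_mono])
        also have "\<dots> \<le> (real j + 1) / k + \<epsilon> / 3"
        proof -
          have "\<bar>G n (x (j + 1)) - (real j + 1) / k\<bar> < \<epsilon> / 3"
            using bspec[OF n, of "j + 1"] True unfolding xj lessThan_iff by blast
          then show ?thesis by linarith
        qed
        also have "\<dots> \<le> F t + 1 / k + \<epsilon> / 3" using jl' by (simp add: add_divide_distrib)
        finally show ?thesis using k \<open>0 < \<epsilon>\<close> by simp
      next
        case False
        then have "real k \<le> real j + 1" by simp
        then have "1 \<le> (real j + 1) / k" using k by simp
        then have "1 \<le> F t + 1 / k" using jl' by (simp add: add_divide_distrib)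
        then show ?thesis using G_bds(2)[of n t] k \<open>0 < \<epsilon>\<close> by simp
      qed
      \<comment> \<open>Quantile \<open>j - 1\<close> is used instead of \<open>j\<close>: if
        \<open>F\<close> is flat and \<open>F t = j / k\<close>, then \<open>x j\<close> may lie to
        the right of \<open>t\<close>. A strict gap in \<open>F\<close> forces
        \<open>x (j - 1) \<le> t\<close>, at the cost of \<open>2 / k\<close>; the index must be
        positive, hence the case \<open>j \<ge> 2\<close>.\<close>
      have lo: "G n t \<ge> F t - \<epsilon>"
      proof (cases "j \<ge> 2")
        case True
        have "real j / k \<le> 1" using jl' F_le1[of t] by simp
        then have jk: "j - 1 < k" "0 < j - 1" using k True by auto
        have xj: "F (x (j - 1)) = (real j - 1) / k" using x[OF jk(2) jk(1)] True by (simp add: of_nat_diff)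
        have "(real j - 1) / k < real j / k" using k by (simp add: divide_strict_right_mono)
        then have "x (j - 1) \<le> t" using xj jl' monoD[OF mono, of t "x (j-1)"] by force
        then have "G n (x (j - 1)) \<le> G n t" by (rule monoD[OF G_mono])
        moreover have "G n (x (j - 1)) \<ge> (real j - 1) / k - \<epsilon> / 3"
        proof -
          have "\<bar>G n (x (j - 1)) - (real j - 1) / k\<bar> < \<epsilon> / 3"
            using bspec[OF n, of "j - 1"] jk unfolding xj lessThan_iff by blast
          then show ?thesis by linarith
        qed
        moreover have "(real j - 1) / k \<ge> F t - 2 / k" using ju' by (simp add: add_divide_distrib diff_divide_distrib)
        ultimately show ?thesis using k by simp
      next
        case False
        then have "(real j + 1) / k \<le> 2 / k" using k by (intro divide_right_mono) auto
        moreover have "2 / real k \<le> 3 / real k" by (intro divide_right_mono) auto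
        moreover have "3 / real k < \<epsilon>" using k by (simp add: field_simps)
        ultimately show ?thesis using G_bds(1)[of n t] ju' by linarith
      qed
      show "\<bar>G n t - F t\<bar> \<le> \<epsilon>" using up lo by simp
    qed
  qed
qed

section \<open>Convergence to zero in probability, weak law and studentization\<close>

text \<open>Chebyshev's inequality as the degenerate case of \<open>cond_noise\<close>:
  \<open>\<rho>\<close> is constant, so nothing is conditioned on, and \<open>U\<close> is the
  variance.\<close>

lemma (in prob_space) measure_PiM_sum_le:
  fixes g :: "'a \<Rightarrow> real"
  assumes I: "finite I" and g[measurable]: "g \<in> borel_measurable M" and sq: "integrable M (\<lambda>x. (g x)\<^sup>2)"
    and mean: "(\<integral>x. g x \<partial>M) = 0" and \<delta>: "0 < \<delta>"
  shows "measure (PiM I (\<lambda>_. M)) {\<omega> \<in> space (PiM I (\<lambda>_. M)). \<bar>\<Sum>i\<in>I. g (\<omega> i)\<bar> > \<delta>}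
      \<le> card I * (\<integral>x. (g x)\<^sup>2 \<partial>M) / \<delta>\<^sup>2"
proof -
  obtain x0 where x0: "x0 \<in> space M" using not_empty by auto
  define v where "v = (\<integral>x. (g x)\<^sup>2 \<partial>M)"
  have v: "0 \<le> v" by (simp add: v_def)
  have int: "integrable M g" by (rule square_integrable_imp_integrable[OF g sq])
  have pm: "(\<integral>\<^sup>+x. ennreal (g x) \<partial>M) = (\<integral>\<^sup>+x. ennreal (- g x) \<partial>M)"
  proof -
    have f: "(\<integral>\<^sup>+x. ennreal (g x) \<partial>M) < \<infinity>" "(\<integral>\<^sup>+x. ennreal (- g x) \<partial>M) < \<infinity>"
      using int by (auto simp: real_integrable_def less_top[symmetric])
    have "enn2real (\<integral>\<^sup>+x. ennreal (g x) \<partial>M) = enn2real (\<integral>\<^sup>+x. ennreal (- g x) \<partial>M)"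
      using real_lebesgue_integral_def[OF int] mean by simp
    then show ?thesis using f by (metis ennreal_enn2real infinity_ennreal_def)
  qed
  interpret cond_noise M g "\<lambda>_. x0" "\<lambda>_. v"
  proof
    fix h :: "'a \<Rightarrow> ennreal"
    show "(\<integral>\<^sup>+x. ennreal (g x) * h x0 \<partial>M) = (\<integral>\<^sup>+x. ennreal (- g x) * h x0 \<partial>M)"
      by (simp add: nn_integral_multc pm)
    show "(\<integral>\<^sup>+x. ennreal ((g x)\<^sup>2) * h x0 \<partial>M) = (\<integral>\<^sup>+x. ennreal v * h x0 \<partial>M)"
      by (simp add: nn_integral_multc nn_integral_eq_integral[OF sq] v_def emeasure_space_1)
  qed (use x0 v in auto)
  \<comment> \<open>With \<open>d\<close> constantly 1 and \<open>\<kappa>\<close> equal to the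
    total variance, the exceptional event is empty.\<close>
  have "measure (PiM I (\<lambda>_. M)) {\<omega> \<in> space (PiM I (\<lambda>_. M)). \<bar>\<Sum>i\<in>I. g (\<omega> i) * 1\<bar> > \<delta>}
      \<le> measure (PiM I (\<lambda>_. M)) {\<omega> \<in> space (PiM I (\<lambda>_. M)). (\<Sum>i\<in>I. v * 1\<^sup>2) > card I * v} + card I * v / \<delta>\<^sup>2"
    by (rule conditional_tail_bounds(1)[OF I, where d="\<lambda>_ _. 1"]) (use v \<delta> in \<open>auto simp: invariant_at_def\<close>)
  then show ?thesis by (simp add: v_def)
qed

text \<open>A first-moment bound for the large part of a truncated variable, which has no second
  moment in general.\<close>

lemma (in prob_space) measure_PiM_sum_abs_le:
  fixes g :: "'a \<Rightarrow> real"
  assumes I: "finite I" and g: "integrable M g" and \<delta>: "0 < \<delta>"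
  shows "measure (PiM I (\<lambda>_. M)) {\<omega> \<in> space (PiM I (\<lambda>_. M)). \<bar>\<Sum>i\<in>I. g (\<omega> i)\<bar> > \<delta>}
      \<le> card I * (\<integral>x. \<bar>g x\<bar> \<partial>M) / \<delta>"
proof -
  let ?N = "PiM I (\<lambda>_. M)"
  interpret N: prob_space ?N by (rule prob_space_PiM) (rule prob_space_axioms)
  have [measurable]: "g \<in> borel_measurable M" using g by simp
  have [measurable]: "(\<lambda>\<omega>. g (\<omega> i)) \<in> borel_measurable ?N" if "i \<in> I" for i
    using that by measurable
  have c: "integrable ?N (\<lambda>\<omega>. \<bar>g (\<omega> i)\<bar>)" "(\<integral>\<omega>. \<bar>g (\<omega> i)\<bar> \<partial>?N) = (\<integral>x. \<bar>g x\<bar> \<partial>M)" if "i \<in> I" for i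
  proof -
    have d: "distr ?N M (\<lambda>\<omega>. \<omega> i) = M"
      by (rule distr_PiM_component[of I "\<lambda>_. M"]) (use that prob_space_axioms in auto)
    have "integrable (distr ?N M (\<lambda>\<omega>. \<omega> i)) (\<lambda>x. \<bar>g x\<bar>)" using g d by simp
    then show "integrable ?N (\<lambda>\<omega>. \<bar>g (\<omega> i)\<bar>)"
      using that by (subst (asm) integrable_distr_eq) auto
    show "(\<integral>\<omega>. \<bar>g (\<omega> i)\<bar> \<partial>?N) = (\<integral>x. \<bar>g x\<bar> \<partial>M)"
      using that by (subst (2) d[symmetric], subst integral_distr) auto
  qed
  have "measure ?N {\<omega> \<in> space ?N. \<bar>\<Sum>i\<in>I. g (\<omega> i)\<bar> > \<delta>} \<le> measure ?N {\<omega> \<in> space ?N. (\<Sum>i\<in>I. \<bar>g (\<omega> i)\<bar>) \<ge> \<delta>}"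
  proof (rule N.finite_measure_mono)
    show "{\<omega> \<in> space ?N. (\<Sum>i\<in>I. \<bar>g (\<omega> i)\<bar>) \<ge> \<delta>} \<in> sets ?N" by measurable
    show "{\<omega> \<in> space ?N. \<bar>\<Sum>i\<in>I. g (\<omega> i)\<bar> > \<delta>} \<subseteq> {\<omega> \<in> space ?N. (\<Sum>i\<in>I. \<bar>g (\<omega> i)\<bar>) \<ge> \<delta>}"
      using sum_abs[of "\<lambda>i. g (_ i)" I] by (auto intro: order_trans[OF less_imp_le])
  qed
  also have "\<dots> \<le> (\<integral>\<omega>. (\<Sum>i\<in>I. \<bar>g (\<omega> i)\<bar>) \<partial>?N) / \<delta>"
    by (rule integral_Markov_inequality_measure[where A="space ?N"]) (use c \<delta> in \<open>auto simp: sum_nonneg\<close>)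
  also have "(\<integral>\<omega>. (\<Sum>i\<in>I. \<bar>g (\<omega> i)\<bar>) \<partial>?N) = card I * (\<integral>x. \<bar>g x\<bar> \<partial>M)"
    using c by (simp add: Bochner_Integration.integral_sum)
  finally show ?thesis .
qed

text \<open>Every \<open>n\<close> has its own probability space. Measurability is included because
  \<open>measure\<close> assigns 0 to non-measurable sets.\<close>

definition null_in_prob :: "(nat \<Rightarrow> 'a measure) \<Rightarrow> (nat \<Rightarrow> 'a \<Rightarrow> real) \<Rightarrow> bool" where
  "null_in_prob N V \<longleftrightarrow> (\<forall>n. V n \<in> borel_measurable (N n)) \<and>
     (\<forall>\<delta>>0. (\<lambda>n. measure (N n) {\<omega> \<in> space (N n). \<bar>V n \<omega>\<bar> > \<delta>}) \<longlonglongrightarrow> 0)"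

lemma null_in_probD:
  assumes "null_in_prob N V" "0 < \<delta>"
  shows "(\<lambda>n. measure (N n) {\<omega> \<in> space (N n). \<bar>V n \<omega>\<bar> > \<delta>}) \<longlonglongrightarrow> 0"
  using assms by (simp add: null_in_prob_def)

lemma null_in_prob_eventually:
  assumes "null_in_prob N V" "0 < \<delta>" "0 < \<epsilon>"
  shows "eventually (\<lambda>n. measure (N n) {\<omega> \<in> space (N n). \<bar>V n \<omega>\<bar> > \<delta>} < \<epsilon>) sequentially"
  using order_tendstoD(2)[OF null_in_probD[OF assms(1,2)] assms(3)] .

text \<open>Separates probability from analysis: \<open>bound\<close> is a deterministic estimate
  where \<open>S\<close> is at most \<open>K\<close> and \<open>V\<close> is small, and the
  complement has small probability by tightness of \<open>S\<close> and by \<open>V\<close> tending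
  to zero. \<open>\<kappa>\<close> may depend on \<open>K\<close>.\<close>

lemma null_in_prob_tight:
  fixes S W :: "nat \<Rightarrow> 'a \<Rightarrow> real"
  assumes N: "\<And>n. prob_space (N n)"
    and S[measurable]: "\<And>n. S n \<in> borel_measurable (N n)"
    and tight: "\<And>\<epsilon>. 0 < \<epsilon> \<Longrightarrow> \<exists>K>0. eventually (\<lambda>n. measure (N n) {\<omega> \<in> space (N n). \<bar>S n \<omega>\<bar> > K} \<le> \<epsilon>) sequentially"
    and V: "null_in_prob N V" and W[measurable]: "\<And>n. W n \<in> borel_measurable (N n)"
    and bound: "\<And>K \<delta>. 0 < K \<Longrightarrow> 0 < \<delta> \<Longrightarrow> \<exists>\<kappa>>0. eventually (\<lambda>n. \<forall>\<omega>\<in>space (N n).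
        \<bar>S n \<omega>\<bar> \<le> K \<longrightarrow> \<bar>V n \<omega>\<bar> \<le> \<kappa> \<longrightarrow> \<bar>W n \<omega>\<bar> \<le> \<delta>) sequentially"
  shows "null_in_prob N W"
  unfolding null_in_prob_def
proof (intro conjI allI impI)
  fix \<delta> :: real assume \<delta>: "0 < \<delta>"
  have [measurable]: "V n \<in> borel_measurable (N n)" for n using V by (simp add: null_in_prob_def)
  show "(\<lambda>n. measure (N n) {\<omega> \<in> space (N n). \<bar>W n \<omega>\<bar> > \<delta>}) \<longlonglongrightarrow> 0"
  proof (rule tendstoI)
    fix \<epsilon> :: real assume \<epsilon>: "0 < \<epsilon>"
    obtain K where K: "K > 0" "eventually (\<lambda>n. measure (N n) {\<omega> \<in> space (N n). \<bar>S n \<omega>\<bar> > K} \<le> \<epsilon> / 2) sequentially"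
      using tight[of "\<epsilon> / 2"] \<epsilon> by auto
    obtain \<kappa> where \<kappa>: "\<kappa> > 0" "eventually (\<lambda>n. \<forall>\<omega>\<in>space (N n).
        \<bar>S n \<omega>\<bar> \<le> K \<longrightarrow> \<bar>V n \<omega>\<bar> \<le> \<kappa> \<longrightarrow> \<bar>W n \<omega>\<bar> \<le> \<delta>) sequentially"
      using bound[OF K(1) \<delta>] by auto
    have "eventually (\<lambda>n. measure (N n) {\<omega> \<in> space (N n). \<bar>V n \<omega>\<bar> > \<kappa>} < \<epsilon> / 2) sequentially"
      using \<epsilon> by (intro null_in_prob_eventually[OF V \<kappa>(1)]) simp
    then show "eventually (\<lambda>n. dist (measure (N n) {\<omega> \<in> space (N n). \<bar>W n \<omega>\<bar> > \<delta>}) 0 < \<epsilon>) sequentially"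
      using K(2) \<kappa>(2)
    proof eventually_elim
      case (elim n)
      interpret prob_space "N n" by (rule N)
      have A: "{\<omega> \<in> space (N n). \<bar>S n \<omega>\<bar> > K} \<in> sets (N n)" "{\<omega> \<in> space (N n). \<bar>V n \<omega>\<bar> > \<kappa>} \<in> sets (N n)"
        by measurable
      have "measure (N n) {\<omega> \<in> space (N n). \<bar>W n \<omega>\<bar> > \<delta>}
        \<le> measure (N n) ({\<omega> \<in> space (N n). \<bar>S n \<omega>\<bar> > K} \<union> {\<omega> \<in> space (N n). \<bar>V n \<omega>\<bar> > \<kappa>})"
      proof (rule finite_measure_mono)
        show "{\<omega> \<in> space (N n). \<bar>W n \<omega>\<bar> > \<delta>} \<subseteq> {\<omega> \<in> space (N n). \<bar>S n \<omega>\<bar> > K} \<union> {\<omega> \<in> space (N n). \<bar>V n \<omega>\<bar> > \<kappa>}"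
          using elim(3) by (auto simp: not_less[symmetric])
      qed (rule sets.Un[OF A])
      also have "\<dots> \<le> measure (N n) {\<omega> \<in> space (N n). \<bar>S n \<omega>\<bar> > K} + measure (N n) {\<omega> \<in> space (N n). \<bar>V n \<omega>\<bar> > \<kappa>}"
        by (rule measure_Un_le[OF A])
      finally show ?case using elim(1,2) by simp
    qed
  qed
qed (rule W)

lemma null_in_prob_dominated:
  assumes N: "\<And>n. prob_space (N n)" and V: "null_in_prob N V" and W: "\<And>n. W n \<in> borel_measurable (N n)"
    and bound: "\<And>\<delta>. 0 < \<delta> \<Longrightarrow> \<exists>\<kappa>>0. eventually (\<lambda>n. \<forall>\<omega>\<in>space (N n).
        \<bar>V n \<omega>\<bar> \<le> \<kappa> \<longrightarrow> \<bar>W n \<omega>\<bar> \<le> \<delta>) sequentially"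
  shows "null_in_prob N W"
proof (rule null_in_prob_tight[OF N, where S="\<lambda>_ _. 0" and V=V])
  fix \<epsilon> :: real assume "0 < \<epsilon>"
  then show "\<exists>K>0. eventually (\<lambda>n. measure (N n) {\<omega> \<in> space (N n). \<bar>0::real\<bar> > K} \<le> \<epsilon>) sequentially"
    by (intro exI[of _ "1::real"]) simp
qed (use V W bound in auto)

lemma null_in_prob_add:
  assumes N: "\<And>n. prob_space (N n)" and V: "null_in_prob N V" and W: "null_in_prob N W"
  shows "null_in_prob N (\<lambda>n \<omega>. V n \<omega> + W n \<omega>)"
  unfolding null_in_prob_def
proof (intro conjI allI impI)
  have [measurable]: "V n \<in> borel_measurable (N n)" "W n \<in> borel_measurable (N n)" for n
    using V W by (auto simp: null_in_prob_def)
  show "(\<lambda>\<omega>. V n \<omega> + W n \<omega>) \<in> borel_measurable (N n)" for n by measurable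
  fix \<delta> :: real assume \<delta>: "0 < \<delta>"
  show "(\<lambda>n. measure (N n) {\<omega> \<in> space (N n). \<bar>V n \<omega> + W n \<omega>\<bar> > \<delta>}) \<longlonglongrightarrow> 0"
  proof (rule tendsto_sandwich[OF _ _ tendsto_const])
    show "(\<lambda>n. measure (N n) {\<omega> \<in> space (N n). \<bar>V n \<omega>\<bar> > \<delta> / 2} + measure (N n) {\<omega> \<in> space (N n). \<bar>W n \<omega>\<bar> > \<delta> / 2}) \<longlonglongrightarrow> 0"
      using \<delta> by (intro tendsto_add_zero null_in_probD[OF V] null_in_probD[OF W]) auto
    show "eventually (\<lambda>n. measure (N n) {\<omega> \<in> space (N n). \<bar>V n \<omega> + W n \<omega>\<bar> > \<delta>}
      \<le> measure (N n) {\<omega> \<in> space (N n). \<bar>V n \<omega>\<bar> > \<delta> / 2} + measure (N n) {\<omega> \<in> space (N n). \<bar>W n \<omega>\<bar> > \<delta> / 2}) sequentially"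
    proof (intro always_eventually allI)
      fix n
      interpret prob_space "N n" by (rule N)
      have A: "{\<omega> \<in> space (N n). \<bar>V n \<omega>\<bar> > \<delta> / 2} \<in> sets (N n)" "{\<omega> \<in> space (N n). \<bar>W n \<omega>\<bar> > \<delta> / 2} \<in> sets (N n)"
        by measurable
      have "measure (N n) {\<omega> \<in> space (N n). \<bar>V n \<omega> + W n \<omega>\<bar> > \<delta>}
        \<le> measure (N n) ({\<omega> \<in> space (N n). \<bar>V n \<omega>\<bar> > \<delta> / 2} \<union> {\<omega> \<in> space (N n). \<bar>W n \<omega>\<bar> > \<delta> / 2})"
        by (rule finite_measure_mono) (use A in auto)
      then show "measure (N n) {\<omega> \<in> space (N n). \<bar>V n \<omega> + W n \<omega>\<bar> > \<delta>}
      \<le> measure (N n) {\<omega> \<in> space (N n). \<bar>V n \<omega>\<bar> > \<delta> / 2} + measure (N n) {\<omega> \<in> space (N n). \<bar>W n \<omega>\<bar> > \<delta> / 2}"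
        using measure_Un_le[OF A] by simp
    qed
  qed auto
qed

text \<open>Truncation at a level common to all rows: Chebyshev's inequality handles the bounded
  part, a first-moment bound the tail. \<open>W\<close> will be the square of
  \<open>\<zeta>\<close>, for which only first moments are available.\<close>

theorem row_iid_weak_law:
  fixes W :: "nat \<Rightarrow> 'a \<Rightarrow> real"
  assumes P: "\<And>n. prob_space (P n)" and ui: "uniformly_integrable P W"
  shows "null_in_prob (\<lambda>n. PiM {..<n} (\<lambda>_. P n)) (\<lambda>n \<omega>. (\<Sum>i<n. W n (\<omega> i)) / n - (\<integral>x. W n x \<partial>P n))"
  unfolding null_in_prob_def
proof (intro conjI allI impI)
  have int[simp]: "integrable (P n) (W n)" for n using ui by (simp add: uniformly_integrable_def)
  have Wm[measurable]: "W n \<in> borel_measurable (P n)" for n using int[of n] by (rule borel_measurable_integrable)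
  show "(\<lambda>\<omega>. (\<Sum>i<n. W n (\<omega> i)) / n - (\<integral>x. W n x \<partial>P n)) \<in> borel_measurable (PiM {..<n} (\<lambda>_. P n))" for n
    by measurable
  fix \<delta> :: real assume \<delta>: "0 < \<delta>"
  let ?N = "\<lambda>n. PiM {..<n} (\<lambda>_. P n)"
  let ?A = "\<lambda>n. {\<omega> \<in> space (?N n). \<bar>(\<Sum>i<n. W n (\<omega> i)) / n - (\<integral>x. W n x \<partial>P n)\<bar> > \<delta>}"
  show "(\<lambda>n. measure (?N n) (?A n)) \<longlonglongrightarrow> 0"
  proof (rule tendstoI)
    fix \<epsilon> :: real assume \<epsilon>: "0 < \<epsilon>"
    \<comment> \<open>The deviation \<open>\<delta>\<close> is shared out as a half for the centred
      bounded part and a quarter each for the tail sum and the tail mean.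
      \<open>\<delta> / 4\<close> serves the tail mean; \<open>\<epsilon> * \<delta> / 16\<close>
      turns the bound \<open>4 * \<eta> / \<delta>\<close> for the tail sum into
      \<open>\<epsilon> / 4\<close>.\<close>
    define \<eta> where "\<eta> = min (\<delta> / 4) (\<epsilon> * \<delta> / 16)"
    have "\<eta> > 0" using \<delta> \<epsilon> by (simp add: \<eta>_def)
    then obtain K where K: "K > 0" "\<And>n. (\<integral>x. \<bar>W n x\<bar> * indicator {x. \<bar>W n x\<bar> > K} x \<partial>P n) \<le> \<eta>"
      using ui unfolding uniformly_integrable_def by meson
    \<comment> \<open>Chebyshev bound for the bounded part: \<open>n\<close> variances of at most
      \<open>4 * K\<^sup>2\<close> against the squared threshold
      \<open>(n * \<delta> / 2)\<^sup>2\<close>.\<close>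
    have "(\<lambda>n. 16 * K\<^sup>2 / \<delta>\<^sup>2 / real n) \<longlonglongrightarrow> 0"
      by (rule lim_const_over_n)
    then have "eventually (\<lambda>n. 16 * K\<^sup>2 / \<delta>\<^sup>2 / real n < \<epsilon> / 2) sequentially"
      using \<epsilon> by (intro order_tendstoD) auto
    then show "eventually (\<lambda>n. dist (measure (?N n) (?A n)) 0 < \<epsilon>) sequentially"
      using eventually_gt_at_top[of 0]
    proof eventually_elim
      case (elim n)
      interpret prob_space "P n" by (rule P)
      interpret N: prob_space "?N n" by (rule prob_space_PiM) (rule P)
      define V where "V x = W n x * indicator {x. \<bar>W n x\<bar> > K} x" for x
      define B where "B x = W n x * indicator {x. \<bar>W n x\<bar> \<le> K} x" for x
      define m where "m = (\<integral>x. B x \<partial>P n)"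
      have WVB: "W n x = V x + B x" for x by (auto simp: V_def B_def indicator_def)
      have [measurable]: "V \<in> borel_measurable (P n)" "B \<in> borel_measurable (P n)"
        unfolding V_def B_def by measurable
      have Vi: "integrable (P n) V"
        unfolding V_def by (rule Bochner_Integration.integrable_bound[OF int]) (auto simp: indicator_def)
      have Bb: "\<bar>B x\<bar> \<le> K" for x using K by (auto simp: B_def indicator_def)
      have Bi: "integrable (P n) B" by (rule integrable_const_bound[where B=K]) (use Bb in auto)
      have mb: "\<bar>m\<bar> \<le> K"
      proof -
        have "\<bar>m\<bar> \<le> (\<integral>x. \<bar>B x\<bar> \<partial>P n)" unfolding m_def by (rule integral_abs_bound)
        also have "\<dots> \<le> (\<integral>x. K \<partial>P n)" by (rule integral_mono) (use Bi Bb in auto)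
        finally show ?thesis by (simp add: prob_space)
      qed
      have EV: "(\<integral>x. \<bar>V x\<bar> \<partial>P n) \<le> \<eta>"
        using K(2)[of n] by (simp add: V_def abs_mult)
      have EV': "\<bar>\<integral>x. V x \<partial>P n\<bar> \<le> \<delta> / 4"
      proof -
        have "\<eta> \<le> \<delta> / 4" by (simp add: \<eta>_def)
        then show ?thesis using integral_abs_bound[of "P n" V] EV by linarith
      qed
      have EW: "(\<integral>x. W n x \<partial>P n) = (\<integral>x. V x \<partial>P n) + m"
        unfolding m_def WVB by (rule Bochner_Integration.integral_add[OF Vi Bi])
      have sqb: "(B x - m)\<^sup>2 \<le> 4 * K\<^sup>2" for x
      proof -
        have "\<bar>B x - m\<bar> \<le> 2 * K" using Bb[of x] mb by linarith
        then have "\<bar>B x - m\<bar>\<^sup>2 \<le> (2 * K)\<^sup>2" by (rule power_mono) simp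
        then show ?thesis by (simp add: power_mult_distrib)
      qed
      have sqi: "integrable (P n) (\<lambda>x. (B x - m)\<^sup>2)"
        by (rule integrable_const_bound[where B="4 * K\<^sup>2"]) (use sqb in auto)
      have sqe: "(\<integral>x. (B x - m)\<^sup>2 \<partial>P n) \<le> 4 * K\<^sup>2"
      proof -
        have "(\<integral>x. (B x - m)\<^sup>2 \<partial>P n) \<le> (\<integral>x. 4 * K\<^sup>2 \<partial>P n)" by (rule integral_mono) (use sqi sqb in auto)
        then show ?thesis by (simp add: prob_space)
      qed
      let ?A1 = "{\<omega> \<in> space (?N n). \<bar>\<Sum>i<n. B (\<omega> i) - m\<bar> > real n * \<delta> / 2}"
      let ?A2 = "{\<omega> \<in> space (?N n). \<bar>\<Sum>i<n. V (\<omega> i)\<bar> > real n * \<delta> / 4}"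
      have [measurable]: "?A1 \<in> sets (?N n)" "?A2 \<in> sets (?N n)" by measurable
      have "measure (?N n) ?A1 \<le> card {..<n} * (\<integral>x. (B x - m)\<^sup>2 \<partial>P n) / (real n * \<delta> / 2)\<^sup>2"
        by (rule measure_PiM_sum_le) (use sqi elim \<delta> Bi in \<open>auto simp: m_def prob_space\<close>)
      also have "\<dots> \<le> card {..<n} * (4 * K\<^sup>2) / (real n * \<delta> / 2)\<^sup>2"
        by (intro divide_right_mono mult_left_mono sqe) auto
      also have "\<dots> = 16 * K\<^sup>2 / \<delta>\<^sup>2 / real n"
        using elim by (simp add: power2_eq_square field_simps)
      finally have 1: "measure (?N n) ?A1 < \<epsilon> / 2" using elim by simp
      have "measure (?N n) ?A2 \<le> card {..<n} * (\<integral>x. \<bar>V x\<bar> \<partial>P n) / (real n * \<delta> / 4)"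
        by (rule measure_PiM_sum_abs_le) (use Vi elim \<delta> in auto)
      also have "\<dots> = (\<integral>x. \<bar>V x\<bar> \<partial>P n) * 4 / \<delta>"
        using elim by simp
      also have "\<dots> \<le> \<eta> * 4 / \<delta>"
        by (intro divide_right_mono mult_right_mono EV) (use \<delta> in auto)
      also have "\<dots> \<le> (\<epsilon> * \<delta> / 16) * 4 / \<delta>"
        by (intro divide_right_mono mult_right_mono) (use \<delta> in \<open>auto simp: \<eta>_def\<close>)
      also have "\<dots> = \<epsilon> / 4" using \<delta> by simp
      finally have 2: "measure (?N n) ?A2 \<le> \<epsilon> / 4" .
      have "?A n \<subseteq> ?A1 \<union> ?A2"
      proof safe
        fix \<omega> assume a: "\<delta> < \<bar>(\<Sum>i<n. W n (\<omega> i)) / n - (\<integral>x. W n x \<partial>P n)\<bar>"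
          and b: "\<not> real n * \<delta> / 4 < \<bar>\<Sum>i<n. V (\<omega> i)\<bar>"
        show "real n * \<delta> / 2 < \<bar>\<Sum>i<n. B (\<omega> i) - m\<bar>"
        proof -
          have "(\<Sum>i<n. W n (\<omega> i)) / n - (\<integral>x. W n x \<partial>P n)
              = (\<Sum>i<n. V (\<omega> i)) / n + (\<Sum>i<n. B (\<omega> i) - m) / n - (\<integral>x. V x \<partial>P n)"
            using elim by (simp add: WVB[of "_ _"] EW sum.distrib sum_subtractf field_simps)
          moreover have "\<bar>(\<Sum>i<n. V (\<omega> i)) / n\<bar> \<le> \<delta> / 4"
            using b elim by (simp add: abs_divide field_simps)
          ultimately have "\<bar>(\<Sum>i<n. B (\<omega> i) - m) / n\<bar> > \<delta> / 2" using a EV' by linarith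
          then show ?thesis using elim by (simp add: abs_divide field_simps)
        qed
      qed
      then have "measure (?N n) (?A n) \<le> measure (?N n) (?A1 \<union> ?A2)"
        by (rule N.finite_measure_mono) measurable
      also have "\<dots> \<le> measure (?N n) ?A1 + measure (?N n) ?A2"
        by (rule measure_Un_le) measurable
      finally show ?case using 1 2 \<epsilon> by simp
    qed
  qed
qed

text \<open>Here \<open>s\<close> is the normalised sum of the leading terms, \<open>r\<close> that of the remainders, \<open>1 + q\<close> and \<open>E\<close> are the respective
  means of squares, \<open>X\<close> is the mean of the products, and \<open>m = 1 / n\<close>.\<close>

lemma studentization_bound:
  fixes K \<delta> :: real
  assumes "0 < K" "0 < \<delta>"
  obtains \<kappa> where "0 < \<kappa>"
    and "\<And>s r q E X m. \<lbrakk>\<bar>s\<bar> \<le> K; \<bar>r\<bar> + \<bar>q\<bar> + E \<le> \<kappa>; 0 \<le> E; X\<^sup>2 \<le> (1 + q) * E; 0 \<le> m; m \<le> \<kappa>\<rbrakk>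
      \<Longrightarrow> \<bar>(s + r) / sqrt (1 + q + 2 * X + E - m * (s + r)\<^sup>2) - s\<bar> \<le> \<delta>"
proof -
  \<comment> \<open>Allowed deviation of the denominator \<open>D\<close> from 1: at most 1/2 keeps
    \<open>D \<ge> 1 / 2\<close>, and the other entry bounds the final error
    \<open>2 * \<theta> * (K + 1)\<close> by \<open>\<delta>\<close>.\<close>
  define \<theta> where "\<theta> = min (1 / 2) (\<delta> / (2 * (K + 1)))"
  \<comment> \<open>The mean of products \<open>X\<close> is only of the order of the square root of
    \<open>E\<close>. So smallness is demanded at level \<open>h\<^sup>2\<close> and spent at level
    \<open>h\<close>: \<open>q\<close> and \<open>E\<close> contribute \<open>h\<close>,
    \<open>2 * X\<close> contributes \<open>4 * h\<close>, and the squared mean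
    \<open>h * (K + 1)\<^sup>2\<close>.\<close>
  define h where "h = min 1 (\<theta> / ((K + 1)\<^sup>2 + 5))"
  have "\<theta> \<le> \<delta> / (2 * (K + 1))" by (simp add: \<theta>_def)
  then have "\<theta> * (2 * (K + 1)) \<le> \<delta>"
    using assms(1) by (simp add: pos_le_divide_eq)
  moreover have "0 < \<theta>" using assms by (simp add: \<theta>_def)
  moreover have "\<theta> \<le> 1 / 2" unfolding \<theta>_def by (rule min.cobounded1)
  ultimately have \<theta>: "0 < \<theta>" "\<theta> \<le> 1 / 2" "\<theta> * (2 * (K + 1)) \<le> \<delta>" by auto
  have pos: "(K + 1)\<^sup>2 + 5 > 0" by (simp add: add_nonneg_pos)
  have h: "0 < h" "h \<le> 1" and h\<theta>: "h * ((K + 1)\<^sup>2 + 5) \<le> \<theta>"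
    using \<theta> pos by (auto simp: h_def min_def pos_divide_le_eq pos_le_divide_eq)
  have hh: "h\<^sup>2 \<le> h" using h by (simp add: power2_eq_square mult_left_le)
  have "h * 1 \<le> h * ((K + 1)\<^sup>2 + 5)" using h by (intro mult_left_mono) auto
  then have h_le: "h \<le> \<theta>" using h\<theta> by simp
  show thesis
  proof (rule that[of "h\<^sup>2"])
    show "0 < h\<^sup>2" using h by simp
    fix s r q E X m :: real
    assume a: "\<bar>s\<bar> \<le> K" "\<bar>r\<bar> + \<bar>q\<bar> + E \<le> h\<^sup>2" "0 \<le> E" "X\<^sup>2 \<le> (1 + q) * E" "0 \<le> m" "m \<le> h\<^sup>2"
    define D2 where "D2 = 1 + q + 2 * X + E - m * (s + r)\<^sup>2"
    have small: "\<bar>r\<bar> \<le> h\<^sup>2" "\<bar>q\<bar> \<le> 1" "E \<le> h\<^sup>2" using a hh h by linarith+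
    have "X\<^sup>2 \<le> 2 * h\<^sup>2"
      using a(4) mult_mono[of "1 + q" 2 E "h\<^sup>2"] small a by linarith
    also have "\<dots> \<le> (2 * h)\<^sup>2" by (simp add: power_mult_distrib)
    finally have X: "\<bar>X\<bar> \<le> 2 * h" using h abs_le_square_iff[of X "2 * h"] by simp
    have "\<bar>s + r\<bar> \<le> K + 1" using a small hh h by linarith
    then have "\<bar>s + r\<bar>\<^sup>2 \<le> (K + 1)\<^sup>2" by (rule power_mono) simp
    then have "m * (s + r)\<^sup>2 \<le> h * (K + 1)\<^sup>2"
      using a hh h by (intro mult_mono) auto
    moreover have "0 \<le> m * (s + r)\<^sup>2" using a by simp
    ultimately have "\<bar>D2 - 1\<bar> \<le> h + 4 * h + h * (K + 1)\<^sup>2"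
      unfolding D2_def using a X hh by linarith
    then have D2: "\<bar>D2 - 1\<bar> \<le> \<theta>" using h\<theta> by (simp add: algebra_simps)
    define D where "D = sqrt D2"
    have D2pos: "D2 \<ge> 1 / 2" using D2 \<theta> by linarith
    have D0: "0 \<le> D" and DD: "D * D = D2" using D2pos by (auto simp: D_def)
    \<comment> \<open>For \<open>D \<ge> 0\<close> the distance of \<open>D\<close> from 1 is at
      most that of its square.\<close>
    have "\<bar>D - 1\<bar> * 1 \<le> \<bar>D - 1\<bar> * \<bar>D + 1\<bar>" using D0 by (intro mult_left_mono) auto
    also have "\<dots> = \<bar>D2 - 1\<bar>" by (simp add: abs_mult[symmetric] algebra_simps DD)
    finally have D1: "\<bar>D - 1\<bar> \<le> \<theta>" using D2 by simp
    then have Dh: "D \<ge> 1 / 2" using \<theta> by linarith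
    have "(s + r) / D - s = (s * (1 - D) + r) / D" using Dh by (simp add: field_simps)
    then have "\<bar>(s + r) / D - s\<bar> = \<bar>s * (1 - D) + r\<bar> / D" using Dh by simp
    also have "\<dots> \<le> \<bar>s * (1 - D) + r\<bar> / (1 / 2)" using Dh by (intro divide_left_mono) auto
    also have "\<dots> \<le> 2 * (K * \<theta> + \<theta>)"
    proof -
      have "\<bar>s * (1 - D)\<bar> \<le> K * \<theta>"
        unfolding abs_mult using a(1) D1 assms(1) by (intro mult_mono) auto
      moreover have "\<bar>r\<bar> \<le> \<theta>" using small hh h_le by linarith
      ultimately have "\<bar>s * (1 - D) + r\<bar> \<le> K * \<theta> + \<theta>" by linarith
      then show ?thesis by simp
    qed
    also have "\<dots> \<le> \<delta>" using \<theta>(3) by (simp add: algebra_simps)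
    finally show "\<bar>(s + r) / sqrt (1 + q + 2 * X + E - m * (s + r)\<^sup>2) - s\<bar> \<le> \<delta>"
      by (simp add: D_def D2_def)
  qed
qed

text \<open>Slutsky's argument: up to the event that \<open>T\<close> and \<open>S\<close> differ by
  more than \<open>\<delta>\<close>, the event \<open>T \<le> t\<close> lies between
  \<open>S \<le> t - \<delta>\<close> and \<open>S \<le> t + \<delta>\<close>, and \<open>F\<close>
  is continuous.\<close>

lemma cdf_convergence_perturb:
  assumes N: "\<And>n. prob_space (N n)"
    and S[measurable]: "\<And>n. S n \<in> borel_measurable (N n)" and T[measurable]: "\<And>n. T n \<in> borel_measurable (N n)"
    and lim: "\<And>t. (\<lambda>n. measure (N n) {\<omega> \<in> space (N n). S n \<omega> \<le> t}) \<longlonglongrightarrow> F t"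
    and cont: "continuous_on UNIV F"
    and diff: "null_in_prob N (\<lambda>n \<omega>. T n \<omega> - S n \<omega>)"
  shows "(\<lambda>n. measure (N n) {\<omega> \<in> space (N n). T n \<omega> \<le> t}) \<longlonglongrightarrow> F t"
proof (rule tendstoI)
  fix \<epsilon> :: real assume \<epsilon>: "0 < \<epsilon>"
  have "isCont F t" using cont by (simp add: continuous_on_eq_continuous_at)
  then obtain d where d: "d > 0" "\<And>x. \<bar>x - t\<bar> < d \<Longrightarrow> \<bar>F x - F t\<bar> < \<epsilon> / 3"
    using \<epsilon> unfolding continuous_at_eps_delta dist_real_def by (meson divide_pos_pos zero_less_numeral)
  define \<delta> where "\<delta> = d / 2"
  have \<delta>: "\<delta> > 0" "\<bar>F (t + \<delta>) - F t\<bar> < \<epsilon> / 3" "\<bar>F (t - \<delta>) - F t\<bar> < \<epsilon> / 3"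
    using d(1) d(2)[of "t + \<delta>"] d(2)[of "t - \<delta>"] by (auto simp: \<delta>_def)
  have e1: "eventually (\<lambda>n. \<bar>measure (N n) {\<omega> \<in> space (N n). S n \<omega> \<le> s} - F s\<bar> < \<epsilon> / 3) sequentially" for s
    using tendstoD[OF lim[of s], of "\<epsilon> / 3"] \<epsilon> by (simp add: dist_real_def)
  have "eventually (\<lambda>n. measure (N n) {\<omega> \<in> space (N n). \<bar>T n \<omega> - S n \<omega>\<bar> > \<delta>} < \<epsilon> / 3) sequentially"
    using \<epsilon> by (intro null_in_prob_eventually[OF diff \<delta>(1)]) simp
  then show "eventually (\<lambda>n. dist (measure (N n) {\<omega> \<in> space (N n). T n \<omega> \<le> t}) (F t) < \<epsilon>) sequentially"
    using e1[of "t + \<delta>"] e1[of "t - \<delta>"]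
  proof eventually_elim
    case (elim n)
    interpret prob_space "N n" by (rule N)
    let ?D = "{\<omega> \<in> space (N n). \<bar>T n \<omega> - S n \<omega>\<bar> > \<delta>}"
    have [measurable]: "?D \<in> sets (N n)" "{\<omega> \<in> space (N n). S n \<omega> \<le> s} \<in> sets (N n)" "{\<omega> \<in> space (N n). T n \<omega> \<le> s} \<in> sets (N n)" for s
      by measurable
    have "measure (N n) {\<omega> \<in> space (N n). T n \<omega> \<le> t} \<le> measure (N n) ({\<omega> \<in> space (N n). S n \<omega> \<le> t + \<delta>} \<union> ?D)"
      by (rule finite_measure_mono) auto
    also have "\<dots> \<le> measure (N n) {\<omega> \<in> space (N n). S n \<omega> \<le> t + \<delta>} + measure (N n) ?D"
      by (rule measure_Un_le) auto
    finally have 1: "measure (N n) {\<omega> \<in> space (N n). T n \<omega> \<le> t} \<le> measure (N n) {\<omega> \<in> space (N n). S n \<omega> \<le> t + \<delta>} + measure (N n) ?D" .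
    have "measure (N n) {\<omega> \<in> space (N n). S n \<omega> \<le> t - \<delta>} \<le> measure (N n) ({\<omega> \<in> space (N n). T n \<omega> \<le> t} \<union> ?D)"
      by (rule finite_measure_mono) auto
    also have "\<dots> \<le> measure (N n) {\<omega> \<in> space (N n). T n \<omega> \<le> t} + measure (N n) ?D"
      by (rule measure_Un_le) auto
    finally have 2: "measure (N n) {\<omega> \<in> space (N n). S n \<omega> \<le> t - \<delta>} \<le> measure (N n) {\<omega> \<in> space (N n). T n \<omega> \<le> t} + measure (N n) ?D" .
    show ?case unfolding dist_real_def using 1 2 elim \<delta> by linarith
  qed
qed

section \<open>Conditional independence and conditional moments\<close>

text \<open>The measures with densities \<open>u\<close> and \<open>v\<close>, pushed forward along
  \<open>(S, T)\<close>, agree on rectangles, which form a generator closed under intersection.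
  Finite mass makes them agree everywhere, so every \<open>h\<close> may be tested.\<close>

lemma nn_integral_pair_eqI:
  fixes u v :: "'a \<Rightarrow> ennreal"
  assumes [measurable]: "u \<in> borel_measurable M" "v \<in> borel_measurable M"
    and T[measurable]: "S \<in> M \<rightarrow>\<^sub>M N1" "T \<in> M \<rightarrow>\<^sub>M N2"
    and fin: "(\<integral>\<^sup>+x. u x \<partial>M) < \<infinity>"
    and eq: "\<And>A B. A \<in> sets N1 \<Longrightarrow> B \<in> sets N2 \<Longrightarrow>
      (\<integral>\<^sup>+x. u x * (indicator A (S x) * indicator B (T x)) \<partial>M) = (\<integral>\<^sup>+x. v x * (indicator A (S x) * indicator B (T x)) \<partial>M)"
    and h[measurable]: "h \<in> borel_measurable (N1 \<Otimes>\<^sub>M N2)"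
  shows "(\<integral>\<^sup>+x. u x * h (S x, T x) \<partial>M) = (\<integral>\<^sup>+x. v x * h (S x, T x) \<partial>M)"
proof -
  let ?ST = "\<lambda>x. (S x, T x)"
  let ?D = "\<lambda>u. distr (density M u) (N1 \<Otimes>\<^sub>M N2) ?ST"
  have em: "emeasure (?D w) (A \<times> B) = (\<integral>\<^sup>+x. w x * (indicator A (S x) * indicator B (T x)) \<partial>M)"
    if [measurable]: "w \<in> borel_measurable M" "A \<in> sets N1" "B \<in> sets N2" for w :: "'a \<Rightarrow> ennreal" and A B
    by (subst emeasure_distr) (auto simp: emeasure_density intro!: nn_integral_cong split: split_indicator)
  have "?D u = ?D v"
  proof (rule measure_eqI_generator_eq[OF Int_stable_pair_measure_generator[of N1 N2], where A="\<lambda>_. space N1 \<times> space N2"])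
    show "{a \<times> b |a b. a \<in> sets N1 \<and> b \<in> sets N2} \<subseteq> Pow (space N1 \<times> space N2)"
      by (rule pair_measure_closed)
    show "emeasure (?D u) X = emeasure (?D v) X" if "X \<in> {a \<times> b |a b. a \<in> sets N1 \<and> b \<in> sets N2}" for X
      using that em[of u] em[of v] eq by auto
    show "emeasure (?D u) (space N1 \<times> space N2) \<noteq> \<infinity>"
    proof -
      have "emeasure (?D u) (space N1 \<times> space N2) \<le> (\<integral>\<^sup>+x. u x \<partial>M)"
        by (subst em) (auto intro!: nn_integral_mono split: split_indicator)
      then show ?thesis using fin by (auto simp: top_unique)
    qed
  qed (auto simp: sets_pair_measure)
  then have "(\<integral>\<^sup>+y. h y \<partial>?D u) = (\<integral>\<^sup>+y. h y \<partial>?D v)" by simp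
  then show ?thesis
    by (simp add: nn_integral_distr nn_integral_density)
qed

lemma (in sigma_finite_subalgebra) nn_cond_exp_nn_integral:
  assumes [measurable]: "g \<in> borel_measurable M"
  shows "(\<integral>\<^sup>+x. nn_cond_exp M F g x \<partial>M) = (\<integral>\<^sup>+x. g x \<partial>M)"
  using nn_cond_exp_intg[of "\<lambda>_. 1" g] by simp

lemma (in sigma_finite_subalgebra) nn_cond_exp_finite:
  assumes "g \<in> borel_measurable M" "(\<integral>\<^sup>+x. g x \<partial>M) < \<infinity>"
  shows "AE x in M. nn_cond_exp M F g x < \<infinity>"
proof -
  have "AE x in M. nn_cond_exp M F g x \<noteq> \<infinity>"
    by (rule nn_integral_PInf_AE) (use assms nn_cond_exp_nn_integral[of g] in auto)
  then show ?thesis by (simp add: less_top)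
qed

lemma (in sigma_finite_subalgebra) real_cond_exp_nonneg:
  assumes [measurable]: "g \<in> borel_measurable M" and nn: "\<And>x. 0 \<le> g x"
  shows "AE x in M. real_cond_exp M F g x = enn2real (nn_cond_exp M F (\<lambda>x. ennreal (g x)) x)"
proof -
  have "AE x in M. nn_cond_exp M F (\<lambda>x. ennreal (- g x)) x = 0"
    using nn_cond_exp_F_meas[of "\<lambda>x. 0"] nn by (auto simp: ennreal_neg)
  then show ?thesis by eventually_elim (simp add: real_cond_exp_def)
qed

text \<open>\<open>X\<close> and \<open>Y\<close> are left abstract so that the results can be used
  a second time with the roles exchanged.\<close>

locale cond_indep_given = prob_space P for P :: "'a measure" +
  fixes X Y :: "'a \<Rightarrow> real" and Z :: "'a \<Rightarrow> 'z :: second_countable_topology" and F :: "'a measure"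
  assumes X_meas[measurable]: "X \<in> borel_measurable P"
    and Y_meas[measurable]: "Y \<in> borel_measurable P"
    and Z_meas[measurable]: "Z \<in> borel_measurable P"
    and F_eq: "F = vimage_algebra (space P) Z borel"
    and indep: "\<And>A B. A \<in> sets borel \<Longrightarrow> B \<in> sets borel \<Longrightarrow>
      AE p in P. real_cond_exp P F (\<lambda>q. indicator A (X q) * indicator B (Y q)) p
        = real_cond_exp P F (\<lambda>q. indicator A (X q)) p * real_cond_exp P F (\<lambda>q. indicator B (Y q)) p"
begin

lemma subalgebra_F: "subalgebra P F"
  using measurable_sets[OF Z_meas] by (auto simp: subalgebra_def F_eq sets_vimage_algebra2)

sublocale F: finite_measure_subalgebra P F
  by unfold_locales (rule subalgebra_F)

lemma Z_meas_F[measurable]: "Z \<in> F \<rightarrow>\<^sub>M borel"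
  unfolding F_eq by (rule measurable_vimage_algebra1) simp

abbreviation "ce \<equiv> nn_cond_exp P F"

text \<open>Carries the factorisation over to extended nonnegative conditional expectations. Those
  of indicators are finite, so nothing is lost between the two versions.\<close>

lemma ce_indicator_mult:
  assumes [measurable]: "A \<in> sets borel" "B \<in> sets borel"
  shows "AE p in P. ce (\<lambda>q. indicator A (X q) * indicator B (Y q)) p
    = ce (\<lambda>q. indicator A (X q)) p * ce (\<lambda>q. indicator B (Y q)) p"
proof -
  have rc: "AE p in P. ennreal (real_cond_exp P F g p) = ce (\<lambda>q. ennreal (g q)) p \<and> 0 \<le> real_cond_exp P F g p"
    if [measurable]: "g \<in> borel_measurable P" and g: "\<And>x. 0 \<le> g x" "\<And>x. g x \<le> 1" for g
  proof -
    have "(\<integral>\<^sup>+x. ennreal (g x) \<partial>P) \<le> (\<integral>\<^sup>+x. 1 \<partial>P)"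
      using g by (intro nn_integral_mono) (simp add: ennreal_le_1)
    then have "(\<integral>\<^sup>+x. ennreal (g x) \<partial>P) < \<infinity>" by (simp add: emeasure_space_1 le_less_trans)
    then have "AE p in P. ce (\<lambda>q. ennreal (g q)) p < \<infinity>" by (intro F.nn_cond_exp_finite) auto
    then show ?thesis using F.real_cond_exp_nonneg[OF that(1) g(1)]
      by eventually_elim (simp add: less_top)
  qed
  have 1: "AE p in P. ennreal (real_cond_exp P F (\<lambda>q. indicator A (X q)) p) = ce (\<lambda>q. indicator A (X q)) p \<and>
      0 \<le> real_cond_exp P F (\<lambda>q. indicator A (X q)) p"
    using rc[of "\<lambda>q. indicator A (X q)"] by (simp add: ennreal_indicator)
  have 2: "AE p in P. ennreal (real_cond_exp P F (\<lambda>q. indicator B (Y q)) p) = ce (\<lambda>q. indicator B (Y q)) p \<and>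
      0 \<le> real_cond_exp P F (\<lambda>q. indicator B (Y q)) p"
    using rc[of "\<lambda>q. indicator B (Y q)"] by (simp add: ennreal_indicator)
  have 3: "AE p in P. ennreal (real_cond_exp P F (\<lambda>q. indicator A (X q) * indicator B (Y q)) p)
      = ce (\<lambda>q. indicator A (X q) * indicator B (Y q)) p"
    using rc[of "\<lambda>q. indicator A (X q) * indicator B (Y q)"]
    by (simp add: ennreal_indicator ennreal_mult indicator_le_1 mult_le_one)
  show ?thesis using 1 2 3 indep[OF assms]
    by eventually_elim (metis ennreal_mult)
qed

text \<open>The integrated form of E[k(X, Z) | Y, Z] = E[k(X, Z) | Z], which admits Y as
  conditioning information. Extension from rectangles needs a density of finite mass, so
  \<open>h\<close> is made general while the other factor is an indicator, and then
  \<open>k\<close>, with an indicator in \<open>(Y, Z)\<close> as density. General \<open>k\<close>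
  and \<open>h\<close> together follow by comparing two measures on every set \<open>D\<close>,
  which also covers infinite mass.\<close>

theorem nn_integral_indep:
  assumes k: "k \<in> borel_measurable (borel \<Otimes>\<^sub>M borel)" and h: "h \<in> borel_measurable (borel \<Otimes>\<^sub>M borel)"
  shows "(\<integral>\<^sup>+p. k (X p, Z p) * h (Y p, Z p) \<partial>P) = (\<integral>\<^sup>+p. ce (\<lambda>q. k (X q, Z q)) p * h (Y p, Z p) \<partial>P)"
proof -
  have step1: "(\<integral>\<^sup>+p. indicator A (X p) * h (Y p, Z p) \<partial>P) = (\<integral>\<^sup>+p. ce (\<lambda>q. indicator A (X q)) p * h (Y p, Z p) \<partial>P)"
    if A[measurable]: "A \<in> sets borel" and h: "h \<in> borel_measurable (borel \<Otimes>\<^sub>M borel)" for A and h :: "real \<times> 'z \<Rightarrow> ennreal"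
  proof (rule nn_integral_pair_eqI[where ?N1.0=borel and ?N2.0=borel, OF _ _ _ _ _ _ h])
    have "(\<integral>\<^sup>+p. indicator A (X p) \<partial>P) \<le> (\<integral>\<^sup>+p. 1 \<partial>P)" by (intro nn_integral_mono) (auto split: split_indicator)
    then show "(\<integral>\<^sup>+p. indicator A (X p) \<partial>P) < \<infinity>" by (simp add: emeasure_space_1 le_less_trans)
    fix B :: "real set" and C :: "'z set" assume [measurable]: "B \<in> sets borel" "C \<in> sets borel"
    have "(\<integral>\<^sup>+p. indicator A (X p) * (indicator B (Y p) * indicator C (Z p)) \<partial>P)
        = (\<integral>\<^sup>+p. indicator C (Z p) * (indicator A (X p) * indicator B (Y p)) \<partial>P)"
      by (intro nn_integral_cong) (simp add: mult_ac)
    also have "\<dots> = (\<integral>\<^sup>+p. indicator C (Z p) * ce (\<lambda>q. indicator A (X q) * indicator B (Y q)) p \<partial>P)"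
      by (rule F.nn_cond_exp_intg[symmetric]) measurable
    also have "\<dots> = (\<integral>\<^sup>+p. (indicator C (Z p) * ce (\<lambda>q. indicator A (X q)) p) * ce (\<lambda>q. indicator B (Y q)) p \<partial>P)"
      by (rule nn_integral_cong_AE) (use ce_indicator_mult[of A B] in \<open>auto simp: mult.assoc\<close>)
    also have "\<dots> = (\<integral>\<^sup>+p. (indicator C (Z p) * ce (\<lambda>q. indicator A (X q)) p) * indicator B (Y p) \<partial>P)"
      by (rule F.nn_cond_exp_intg) measurable
    also have "\<dots> = (\<integral>\<^sup>+p. ce (\<lambda>q. indicator A (X q)) p * (indicator B (Y p) * indicator C (Z p)) \<partial>P)"
      by (intro nn_integral_cong) (simp add: mult_ac)
    finally show "(\<integral>\<^sup>+p. indicator A (X p) * (indicator B (Y p) * indicator C (Z p)) \<partial>P)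
      = (\<integral>\<^sup>+p. ce (\<lambda>q. indicator A (X q)) p * (indicator B (Y p) * indicator C (Z p)) \<partial>P)" .
  qed measurable
  have step2: "(\<integral>\<^sup>+p. indicator D (Y p, Z p) * k (X p, Z p) \<partial>P) = (\<integral>\<^sup>+p. ce (\<lambda>q. indicator D (Y q, Z q)) p * k (X p, Z p) \<partial>P)"
    if D[measurable]: "D \<in> sets (borel \<Otimes>\<^sub>M borel)" for D
  proof (rule nn_integral_pair_eqI[where ?N1.0=borel and ?N2.0=borel, OF _ _ _ _ _ _ k])
    have "(\<integral>\<^sup>+p. indicator D (Y p, Z p) \<partial>P) \<le> (\<integral>\<^sup>+p. 1 \<partial>P)" by (intro nn_integral_mono) (auto split: split_indicator)
    then show "(\<integral>\<^sup>+p. indicator D (Y p, Z p) \<partial>P) < \<infinity>" by (simp add: emeasure_space_1 le_less_trans)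
    fix A :: "real set" and C :: "'z set" assume [measurable]: "A \<in> sets borel" "C \<in> sets borel"
    have "(\<integral>\<^sup>+p. indicator D (Y p, Z p) * (indicator A (X p) * indicator C (Z p)) \<partial>P)
        = (\<integral>\<^sup>+p. indicator A (X p) * (indicator C (snd (Y p, Z p)) * indicator D (Y p, Z p)) \<partial>P)"
      by (intro nn_integral_cong) (simp add: mult_ac)
    also have "\<dots> = (\<integral>\<^sup>+p. ce (\<lambda>q. indicator A (X q)) p * (indicator C (snd (Y p, Z p)) * indicator D (Y p, Z p)) \<partial>P)"
      by (rule step1[of A "\<lambda>yz. indicator C (snd yz) * indicator D yz"]) measurable
    also have "\<dots> = (\<integral>\<^sup>+p. (ce (\<lambda>q. indicator A (X q)) p * indicator C (Z p)) * indicator D (Y p, Z p) \<partial>P)"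
      by (intro nn_integral_cong) (simp add: mult_ac)
    \<comment> \<open>The conditional expectation moves from the indicator in X to the one in
      \<open>(Y, Z)\<close>: the weight next to either indicator is measurable with respect to
      \<open>F\<close>, so \<open>nn_cond_exp_intg\<close> is applied once in each
      direction.\<close>
    also have "\<dots> = (\<integral>\<^sup>+p. (ce (\<lambda>q. indicator A (X q)) p * indicator C (Z p)) * ce (\<lambda>q. indicator D (Y q, Z q)) p \<partial>P)"
      by (rule F.nn_cond_exp_intg[symmetric]) measurable
    also have "\<dots> = (\<integral>\<^sup>+p. (indicator C (Z p) * ce (\<lambda>q. indicator D (Y q, Z q)) p) * ce (\<lambda>q. indicator A (X q)) p \<partial>P)"
      by (intro nn_integral_cong) (simp add: mult_ac)
    also have "\<dots> = (\<integral>\<^sup>+p. (indicator C (Z p) * ce (\<lambda>q. indicator D (Y q, Z q)) p) * indicator A (X p) \<partial>P)"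
      by (rule F.nn_cond_exp_intg) measurable
    also have "\<dots> = (\<integral>\<^sup>+p. ce (\<lambda>q. indicator D (Y q, Z q)) p * (indicator A (X p) * indicator C (Z p)) \<partial>P)"
      by (intro nn_integral_cong) (simp add: mult_ac)
    finally show "(\<integral>\<^sup>+p. indicator D (Y p, Z p) * (indicator A (X p) * indicator C (Z p)) \<partial>P)
        = (\<integral>\<^sup>+p. ce (\<lambda>q. indicator D (Y q, Z q)) p * (indicator A (X p) * indicator C (Z p)) \<partial>P)" .
  qed measurable
  note [measurable] = k h
  let ?YZ = "\<lambda>p. (Y p, Z p)"
  let ?D = "\<lambda>u. distr (density P u) (borel \<Otimes>\<^sub>M borel) ?YZ"
  have em: "emeasure (?D u) D = (\<integral>\<^sup>+p. u p * indicator D (Y p, Z p) \<partial>P)"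
    if [measurable]: "u \<in> borel_measurable P" "D \<in> sets (borel \<Otimes>\<^sub>M borel)" for u D
    by (subst emeasure_distr) (auto simp: emeasure_density intro!: nn_integral_cong split: split_indicator)
  have "?D (\<lambda>p. k (X p, Z p)) = ?D (ce (\<lambda>p. k (X p, Z p)))"
  proof (rule measure_eqI)
    fix D assume "D \<in> sets (?D (\<lambda>p. k (X p, Z p)))"
    then have [measurable]: "D \<in> sets (borel \<Otimes>\<^sub>M borel)" by simp
    have "(\<integral>\<^sup>+p. k (X p, Z p) * indicator D (Y p, Z p) \<partial>P) = (\<integral>\<^sup>+p. ce (\<lambda>q. indicator D (Y q, Z q)) p * k (X p, Z p) \<partial>P)"
      using step2[of D] by (simp add: mult.commute)
    also have "\<dots> = (\<integral>\<^sup>+p. ce (\<lambda>q. indicator D (Y q, Z q)) p * ce (\<lambda>q. k (X q, Z q)) p \<partial>P)"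
      by (rule F.nn_cond_exp_intg[symmetric]) measurable
    also have "\<dots> = (\<integral>\<^sup>+p. ce (\<lambda>q. k (X q, Z q)) p * ce (\<lambda>q. indicator D (Y q, Z q)) p \<partial>P)"
      by (simp add: mult.commute)
    also have "\<dots> = (\<integral>\<^sup>+p. ce (\<lambda>q. k (X q, Z q)) p * indicator D (Y p, Z p) \<partial>P)"
      by (rule F.nn_cond_exp_intg) measurable
    finally show "emeasure (?D (\<lambda>p. k (X p, Z p))) D = emeasure (?D (ce (\<lambda>p. k (X p, Z p)))) D"
      by (simp add: em)
  qed simp
  then have "(\<integral>\<^sup>+y. h y \<partial>?D (\<lambda>p. k (X p, Z p))) = (\<integral>\<^sup>+y. h y \<partial>?D (ce (\<lambda>p. k (X p, Z p))))" by simp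
  then show ?thesis
    by (simp add: nn_integral_distr nn_integral_density)
qed

text \<open>Given Z, the conditional expectations of the positive and negative parts of the residual
  are finite with difference 0, hence equal; \<open>nn_integral_indep\<close> then tests this
  equality against functions of Y as well.\<close>

lemma residual_mean_zero:
  assumes [measurable]: "f \<in> borel_measurable borel" and int: "integrable P X"
    and f: "AE p in P. f (Z p) = real_cond_exp P F X p"
    and h: "h \<in> borel_measurable (borel \<Otimes>\<^sub>M borel)"
  shows "(\<integral>\<^sup>+p. ennreal (X p - f (Z p)) * h (Y p, Z p) \<partial>P) = (\<integral>\<^sup>+p. ennreal (- (X p - f (Z p))) * h (Y p, Z p) \<partial>P)"
proof -
  let ?e = "\<lambda>p. X p - f (Z p)"
  have fF: "(\<lambda>p. f (Z p)) \<in> borel_measurable F" by measurable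
  have fint: "integrable P (\<lambda>p. f (Z p))"
    using F.real_cond_exp_int(1)[OF int] f by (subst integrable_cong_AE) auto
  have eint: "integrable P ?e" using int fint by simp
  have "AE p in P. real_cond_exp P F ?e p = 0"
    using F.real_cond_exp_diff[OF int fint] F.real_cond_exp_F_meas[OF fint fF] f by eventually_elim simp
  moreover have "AE p in P. ce (\<lambda>p. ennreal (?e p)) p < \<infinity>" "AE p in P. ce (\<lambda>p. ennreal (- ?e p)) p < \<infinity>"
    using eint by (intro F.nn_cond_exp_finite; simp add: real_integrable_def less_top[symmetric])+
  ultimately have ce_eq: "AE p in P. ce (\<lambda>p. ennreal (?e p)) p = ce (\<lambda>p. ennreal (- ?e p)) p"
  proof eventually_elim
    case (elim p)
    then have "enn2real (ce (\<lambda>p. ennreal (?e p)) p) = enn2real (ce (\<lambda>p. ennreal (- ?e p)) p)"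
      by (simp add: real_cond_exp_def)
    then show ?case using elim by (metis ennreal_enn2real infinity_ennreal_def)
  qed
  have "(\<integral>\<^sup>+p. ennreal (?e p) * h (Y p, Z p) \<partial>P) = (\<integral>\<^sup>+p. ce (\<lambda>p. ennreal (?e p)) p * h (Y p, Z p) \<partial>P)"
    using nn_integral_indep[of "\<lambda>(x, z). ennreal (x - f z)" h] h by simp
  also have "\<dots> = (\<integral>\<^sup>+p. ce (\<lambda>p. ennreal (- ?e p)) p * h (Y p, Z p) \<partial>P)"
    by (rule nn_integral_cong_AE) (use ce_eq in auto)
  also have "\<dots> = (\<integral>\<^sup>+p. ennreal (- ?e p) * h (Y p, Z p) \<partial>P)"
    using nn_integral_indep[of "\<lambda>(x, z). ennreal (- (x - f z))" h] h by simp
  finally show ?thesis .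
qed

lemma residual_second_moment:
  assumes [measurable]: "f \<in> borel_measurable borel" "g \<in> borel_measurable borel" "U \<in> borel_measurable borel"
    and U: "AE p in P. U (Z p) = real_cond_exp P F (\<lambda>p. (X p - f (Z p))\<^sup>2) p"
    and fin: "(\<integral>\<^sup>+p. ennreal ((X p - f (Z p))\<^sup>2 * (Y p - g (Z p))\<^sup>2) \<partial>P) < \<infinity>"
    and ne: "AE p in P. Y p \<noteq> g (Z p)"
  shows "AE p in P. 0 \<le> U (Z p)"
    and "h \<in> borel_measurable (borel \<Otimes>\<^sub>M borel) \<Longrightarrow>
      (\<integral>\<^sup>+p. ennreal ((X p - f (Z p))\<^sup>2) * h (Y p, Z p) \<partial>P) = (\<integral>\<^sup>+p. ennreal (U (Z p)) * h (Y p, Z p) \<partial>P)"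
proof -
  let ?k = "\<lambda>p. ennreal ((X p - f (Z p))\<^sup>2)"
  have ind: "(\<integral>\<^sup>+p. ?k p * h (Y p, Z p) \<partial>P) = (\<integral>\<^sup>+p. ce ?k p * h (Y p, Z p) \<partial>P)"
    if "h \<in> borel_measurable (borel \<Otimes>\<^sub>M borel)" for h
    using nn_integral_indep[of "\<lambda>(x, z). ennreal ((x - f z)\<^sup>2)" h] that by simp
  have "(\<integral>\<^sup>+p. ce ?k p * ennreal ((Y p - g (Z p))\<^sup>2) \<partial>P) < \<infinity>"
    using ind[of "\<lambda>(y, z). ennreal ((y - g z)\<^sup>2)"] fin by (simp add: ennreal_mult)
  then have "AE p in P. ce ?k p * ennreal ((Y p - g (Z p))\<^sup>2) \<noteq> \<infinity>"
    by (intro nn_integral_PInf_AE) auto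
  then have ce_fin: "AE p in P. ce ?k p < \<infinity>"
    using ne by eventually_elim (auto simp: less_top[symmetric] ennreal_top_mult)
  \<comment> \<open>On finite values \<open>enn2real\<close> loses nothing, so the real
    \<open>U\<close> represents the extended conditional expectation exactly.\<close>
  have UZ: "AE p in P. ennreal (U (Z p)) = ce ?k p \<and> 0 \<le> U (Z p)"
    using ce_fin U F.real_cond_exp_nonneg[of "\<lambda>p. (X p - f (Z p))\<^sup>2", simplified]
    by eventually_elim (simp add: less_top)
  then show "AE p in P. 0 \<le> U (Z p)" by auto
  show "(\<integral>\<^sup>+p. ?k p * h (Y p, Z p) \<partial>P) = (\<integral>\<^sup>+p. ennreal (U (Z p)) * h (Y p, Z p) \<partial>P)"
    if "h \<in> borel_measurable (borel \<Otimes>\<^sub>M borel)"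
    unfolding ind[OF that] by (rule nn_integral_cong_AE) (use UZ in auto)
qed

end

section \<open>Residuals under the null hypothesis\<close>

lemma pt_borel_eq: "(borel :: ('d::finite) pt measure) = borel \<Otimes>\<^sub>M (borel \<Otimes>\<^sub>M borel)"
  by (simp add: borel_prod)

lemma Xv_measurable[measurable]: "Xv \<in> borel_measurable borel"
  unfolding Xv_def[abs_def] pt_borel_eq by measurable

lemma Yv_measurable[measurable]: "Yv \<in> borel_measurable borel"
  unfolding Yv_def[abs_def] pt_borel_eq by measurable

lemma Zv_measurable[measurable]: "Zv \<in> borel_measurable borel"
  unfolding Zv_def[abs_def] pt_borel_eq by measurable

lemma pt_measurable[measurable (raw)]:
  fixes x y :: "'a \<Rightarrow> real" and z :: "'a \<Rightarrow> real ^ ('d::finite)"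
  assumes "x \<in> borel_measurable M" "y \<in> borel_measurable M" "z \<in> borel_measurable M"
  shows "(\<lambda>a. (x a, y a, z a) :: 'd pt) \<in> borel_measurable M"
  unfolding pt_borel_eq using assms by measurable

text \<open>Every value of \<^const>\<open>Zv\<close> is attained at a point \<^term>\<open>(0, 0, z)\<close>, so a function measurable with respect to
  \<^const>\<open>Zalg\<close> factors through \<^const>\<open>Zv\<close> by restriction to these points.\<close>

lemma cond_fun_spec:
  fixes P :: "('d::finite) pt measure"
  assumes "sets P = sets borel"
  shows "cond_fun P h \<in> borel_measurable borel"
    and "AE p in P. cond_fun P h (Zv p) = real_cond_exp P (Zalg P) h p"
proof -
  have sp: "space P = UNIV" using sets_eq_imp_space_eq[OF assms] by simp
  let ?r = "real_cond_exp P (Zalg P) h"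
  have r: "?r \<in> borel_measurable (Zalg P)" by simp
  have \<iota>: "(\<lambda>z. (0, 0, z)) \<in> borel \<rightarrow>\<^sub>M Zalg P"
    unfolding Zalg_def by (rule measurable_vimage_algebra2) (auto simp: sp Zv_def)
  have eq: "?r (0, 0, Zv p) = ?r p" for p
  proof -
    \<comment> \<open>Measurable sets of \<open>Zalg\<close> are preimages under \<open>Zv\<close>,
      so the level set of \<open>?r\<close> through \<open>p\<close> contains every point with the
      same value of \<open>Zv\<close>.\<close>
    have "?r -` {?r p} \<inter> space (Zalg P) \<in> sets (Zalg P)"
      by (rule measurable_sets[OF r]) simp
    then obtain B where "?r -` {?r p} = Zv -` B"
      by (auto simp: Zalg_def sp sets_vimage_algebra2)
    moreover have "p \<in> ?r -` {?r p}" by simp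
    ultimately have "(0, 0, Zv p) \<in> ?r -` {?r p}" by (simp add: Zv_def)
    then show ?thesis by simp
  qed
  have "\<exists>\<phi>. \<phi> \<in> borel_measurable borel \<and> (AE p in P. \<phi> (Zv p) = ?r p)"
    using measurable_compose[OF \<iota> r] by (intro exI[of _ "\<lambda>z. ?r (0, 0, z)"] conjI) (auto simp: eq)
  from someI_ex[OF this] show "cond_fun P h \<in> borel_measurable borel"
    and "AE p in P. cond_fun P h (Zv p) = ?r p"
    by (simp_all add: cond_fun_def)
qed

text \<open>Fubini's theorem with the second coordinate fixed first: each slice of the graph is a
  single point.\<close>

lemma AE_lborel_graph:
  fixes k :: "'b::euclidean_space \<Rightarrow> real"
  assumes [measurable]: "k \<in> borel_measurable borel"
  shows "AE p in lborel. fst p \<noteq> k (snd p)"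
proof -
  have "Measurable.pred (lborel \<Otimes>\<^sub>M lborel) (\<lambda>p. fst p \<noteq> k (snd p))" by measurable
  then have m: "{p \<in> space (lborel \<Otimes>\<^sub>M lborel). fst p \<noteq> k (snd p)} \<in> sets (lborel \<Otimes>\<^sub>M lborel)"
    by (simp only: pred_def)
  have "AE x in lborel. AE y in lborel. x \<noteq> k y"
    unfolding lborel_pair.AE_commute[where P="\<lambda>x y. x \<noteq> k y", OF m]
    by (auto simp: AE_lborel_singleton)
  then have "AE p in lborel \<Otimes>\<^sub>M lborel. fst p \<noteq> k (snd p)"
    by (intro lborel_pair.AE_pair_measure[OF m]) simp
  then show ?thesis unfolding lborel_prod .
qed

lemma AE_lborel_pt_graph:
  fixes f :: "real ^ ('d::finite) \<Rightarrow> real"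
  assumes [measurable]: "f \<in> borel_measurable borel"
  shows "AE p in lborel. Xv p \<noteq> f (Zv p)" and "AE p in lborel. Yv p \<noteq> f (Zv p)"
proof -
  have k: "(\<lambda>yz :: real \<times> (real ^ 'd). f (snd yz)) \<in> borel_measurable borel"
    unfolding borel_prod[symmetric] by measurable
  show "AE p in lborel. Xv p \<noteq> f (Zv p)"
    using AE_lborel_graph[OF k] by (simp add: Xv_def Zv_def)
  have "Measurable.pred borel (\<lambda>p :: 'd pt. Yv p \<noteq> f (Zv p))" by measurable
  then have m: "{p \<in> space (lborel \<Otimes>\<^sub>M lborel). Yv p \<noteq> f (Zv p)} \<in> sets (lborel \<Otimes>\<^sub>M lborel)"
    unfolding lborel_prod by (simp add: pred_def)
  have "AE x in lborel. AE yz in lborel. Yv (x :: real, yz) \<noteq> f (Zv (x, yz))"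
    using AE_lborel_graph[OF assms] by (simp add: Yv_def Zv_def)
  then have "AE p in lborel \<Otimes>\<^sub>M lborel. Yv p \<noteq> f (Zv p)"
    by (rule lborel_pair.AE_pair_measure[OF m])
  then show "AE p in lborel. Yv p \<noteq> f (Zv p)"
    unfolding lborel_prod .
qed

locale null_model =
  fixes P :: "('d::finite) pt measure"
  assumes P0: "P \<in> P0" and int_X: "integrable P Xv" and int_Y: "integrable P Yv"
    and fin: "(\<integral>\<^sup>+ p. ennreal ((epsP P p)\<^sup>2 * (xiP P p)\<^sup>2) \<partial>P) < \<infinity>"
begin

lemma sets_P[measurable_cong]: "sets P = sets borel"
  using P0 by (simp add: P0_def E0_def)

lemma space_P[simp]: "space P = UNIV"
  using sets_eq_imp_space_eq[OF sets_P] by simp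

sublocale prob_space P
  using P0 by (simp add: P0_def E0_def)

lemma cond_fun_measurable[measurable]:
  "fP P \<in> borel_measurable borel" "gP P \<in> borel_measurable borel"
  "uP P \<in> borel_measurable borel" "vP P \<in> borel_measurable borel"
  by (auto simp: fP_def gP_def uP_def vP_def intro: cond_fun_spec[OF sets_P])

lemma residual_measurable[measurable]: "epsP P \<in> borel_measurable borel" "xiP P \<in> borel_measurable borel"
  unfolding epsP_def[abs_def] xiP_def[abs_def] by measurable

lemma AE_graph:
  assumes "f \<in> borel_measurable borel"
  shows "AE p in P. Xv p \<noteq> f (Zv p)" and "AE p in P. Yv p \<noteq> f (Zv p)"
proof -
  have ac: "absolutely_continuous lborel P" "sets P = sets lborel"
    using P0 by (simp_all add: P0_def E0_def)
  show "AE p in P. Xv p \<noteq> f (Zv p)" "AE p in P. Yv p \<noteq> f (Zv p)"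
    using absolutely_continuous_AE[OF ac(2,1)] AE_lborel_pt_graph[OF assms] by blast+
qed

sublocale XY: cond_indep_given P Xv Yv Zv "Zalg P"
proof unfold_locales
  fix A B :: "real set" assume "A \<in> sets borel" "B \<in> sets borel"
  then show "AE p in P. real_cond_exp P (Zalg P) (\<lambda>q. indicator A (Xv q) * indicator B (Yv q)) p
        = real_cond_exp P (Zalg P) (\<lambda>q. indicator A (Xv q)) p * real_cond_exp P (Zalg P) (\<lambda>q. indicator B (Yv q)) p"
    using P0 by (auto simp: P0_def cond_indep_def)
qed (simp_all add: Zalg_def)

sublocale YX: cond_indep_given P Yv Xv Zv "Zalg P"
proof unfold_locales
  fix A B :: "real set" assume "A \<in> sets borel" "B \<in> sets borel"
  then show "AE p in P. real_cond_exp P (Zalg P) (\<lambda>q. indicator A (Yv q) * indicator B (Xv q)) p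
        = real_cond_exp P (Zalg P) (\<lambda>q. indicator A (Yv q)) p * real_cond_exp P (Zalg P) (\<lambda>q. indicator B (Xv q)) p"
    using XY.indep[of B A] by (simp add: mult.commute)
qed (simp_all add: Zalg_def)

text \<open>Overwriting X by 0 keeps exactly the data that determine the fitted g, so the errors of
  that regression are invariant. The centring demanded here is relative to (Y, Z) and comes from
  conditional independence.\<close>

sublocale eps: cond_noise P "epsP P" "\<lambda>p. (0, Yv p, Zv p)" "\<lambda>p. uP P (Zv p)"
proof
  have f: "AE p in P. fP P (Zv p) = real_cond_exp P (Zalg P) Xv p"
    unfolding fP_def by (rule cond_fun_spec[OF sets_P])
  have u: "AE p in P. uP P (Zv p) = real_cond_exp P (Zalg P) (\<lambda>p. (Xv p - fP P (Zv p))\<^sup>2) p"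
    unfolding uP_def epsP_def[symmetric] by (rule cond_fun_spec[OF sets_P])
  note m2 = XY.residual_second_moment[OF _ _ _ u, of "gP P"]
  have fin': "(\<integral>\<^sup>+p. ennreal ((Xv p - fP P (Zv p))\<^sup>2 * (Yv p - gP P (Zv p))\<^sup>2) \<partial>P) < \<infinity>"
    using fin by (simp add: epsP_def xiP_def)
  show "AE p in P. 0 \<le> uP P (Zv p)"
    by (rule m2(1)) (use fin' AE_graph(2)[of "gP P"] in auto)
  fix h :: "'d pt \<Rightarrow> ennreal" assume [measurable]: "h \<in> borel_measurable P"
  have h: "(\<lambda>(y, z). h (0, y, z)) \<in> borel_measurable (borel \<Otimes>\<^sub>M borel)" by measurable
  show "(\<integral>\<^sup>+p. ennreal (epsP P p) * h (0, Yv p, Zv p) \<partial>P) = (\<integral>\<^sup>+p. ennreal (- epsP P p) * h (0, Yv p, Zv p) \<partial>P)"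
    using XY.residual_mean_zero[OF _ int_X f h] by (simp add: epsP_def)
  show "(\<integral>\<^sup>+p. ennreal ((epsP P p)\<^sup>2) * h (0, Yv p, Zv p) \<partial>P) = (\<integral>\<^sup>+p. ennreal (uP P (Zv p)) * h (0, Yv p, Zv p) \<partial>P)"
    using m2(2)[OF _ _ _ fin' _ h] AE_graph(2)[of "gP P"] by (simp add: epsP_def)
qed (measurable, simp add: Zv_def)

sublocale xi: cond_noise P "xiP P" "\<lambda>p. (Xv p, 0, Zv p)" "\<lambda>p. vP P (Zv p)"
proof
  have g: "AE p in P. gP P (Zv p) = real_cond_exp P (Zalg P) Yv p"
    unfolding gP_def by (rule cond_fun_spec[OF sets_P])
  have v: "AE p in P. vP P (Zv p) = real_cond_exp P (Zalg P) (\<lambda>p. (Yv p - gP P (Zv p))\<^sup>2) p"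
    unfolding vP_def xiP_def[symmetric] by (rule cond_fun_spec[OF sets_P])
  note m2 = YX.residual_second_moment[OF _ _ _ v, of "fP P"]
  have fin': "(\<integral>\<^sup>+p. ennreal ((Yv p - gP P (Zv p))\<^sup>2 * (Xv p - fP P (Zv p))\<^sup>2) \<partial>P) < \<infinity>"
    using fin by (simp add: epsP_def xiP_def mult.commute)
  show "AE p in P. 0 \<le> vP P (Zv p)"
    by (rule m2(1)) (use fin' AE_graph(1)[of "fP P"] in auto)
  fix h :: "'d pt \<Rightarrow> ennreal" assume [measurable]: "h \<in> borel_measurable P"
  have h: "(\<lambda>(x, z). h (x, 0, z)) \<in> borel_measurable (borel \<Otimes>\<^sub>M borel)" by measurable
  show "(\<integral>\<^sup>+p. ennreal (xiP P p) * h (Xv p, 0, Zv p) \<partial>P) = (\<integral>\<^sup>+p. ennreal (- xiP P p) * h (Xv p, 0, Zv p) \<partial>P)"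
    using YX.residual_mean_zero[OF _ int_Y g h] by (simp add: xiP_def)
  show "(\<integral>\<^sup>+p. ennreal ((xiP P p)\<^sup>2) * h (Xv p, 0, Zv p) \<partial>P) = (\<integral>\<^sup>+p. ennreal (vP P (Zv p)) * h (Xv p, 0, Zv p) \<partial>P)"
    using m2(2)[OF _ _ _ fin' _ h] AE_graph(1)[of "fP P"] by (simp add: xiP_def)
qed (measurable, simp add: Zv_def)

lemma weighted_product_mean_zero:
  assumes [measurable]: "w \<in> borel_measurable borel"
  shows "(\<integral>p. epsP P p * xiP P p * w (Zv p) \<partial>P) = 0"
proof -
  have "(\<integral>p. epsP P p * (xiP P p * w (Zv p)) \<partial>P) = 0"
    by (rule eps.integral_invariant_zero) (measurable, simp add: xiP_def Yv_def Zv_def)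
  then show ?thesis by (simp add: mult.assoc)
qed

end

section \<open>Asymptotics along a sequence of distributions\<close>

lemma uniformly_integrable_scaled:
  assumes V: "uniformly_integrable P V" and W[measurable]: "\<And>n. W n \<in> borel_measurable (P n)"
    and L: "0 < L" and le: "\<And>n x. \<bar>W n x\<bar> \<le> L * \<bar>V n x\<bar>"
  shows "uniformly_integrable P W"
  unfolding uniformly_integrable_def
proof (intro conjI allI impI)
  have Vi: "integrable (P n) (V n)" for n using V by (simp add: uniformly_integrable_def)
  have [measurable]: "V n \<in> borel_measurable (P n)" for n using Vi[of n] by simp
  show Wi: "integrable (P n) (W n)" for n
    by (rule Bochner_Integration.integrable_bound[of _ "\<lambda>x. L * V n x"])
       (use Vi le L in \<open>auto simp: abs_mult\<close>)
  fix \<epsilon> :: real assume "0 < \<epsilon>"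
  then obtain K where K: "0 < K" "\<And>n. (\<integral>x. \<bar>V n x\<bar> * indicator {x. \<bar>V n x\<bar> > K} x \<partial>P n) \<le> \<epsilon> / L"
    using V L unfolding uniformly_integrable_def by (meson divide_pos_pos)
  have "(\<integral>x. \<bar>W n x\<bar> * indicator {x. \<bar>W n x\<bar> > L * K} x \<partial>P n) \<le> \<epsilon>" for n
  proof -
    have pw: "\<bar>W n x\<bar> * indicator {x. \<bar>W n x\<bar> > L * K} x \<le> L * (\<bar>V n x\<bar> * indicator {x. \<bar>V n x\<bar> > K} x)" for x
    proof (cases "\<bar>W n x\<bar> > L * K")
      case True
      then have "L * K < L * \<bar>V n x\<bar>" using le[of n x] by linarith
      then have "K < \<bar>V n x\<bar>" using L by simp
      then show ?thesis using True le[of n x] by simp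
    qed (use L in \<open>simp add: indicator_def\<close>)
    have "integrable (P n) (\<lambda>x. \<bar>W n x\<bar> * indicator {x. \<bar>W n x\<bar> > L * K} x)"
      by (rule Bochner_Integration.integrable_bound[OF Wi]) (auto simp: indicator_def)
    moreover have "integrable (P n) (\<lambda>x. \<bar>V n x\<bar> * indicator {x. \<bar>V n x\<bar> > K} x)"
      by (rule Bochner_Integration.integrable_bound[OF Vi]) (auto simp: indicator_def)
    ultimately have "(\<integral>x. \<bar>W n x\<bar> * indicator {x. \<bar>W n x\<bar> > L * K} x \<partial>P n)
        \<le> (\<integral>x. L * (\<bar>V n x\<bar> * indicator {x. \<bar>V n x\<bar> > K} x) \<partial>P n)"
      by (intro integral_mono pw) auto
    also have "\<dots> = L * (\<integral>x. \<bar>V n x\<bar> * indicator {x. \<bar>V n x\<bar> > K} x \<partial>P n)" by simp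
    also have "\<dots> \<le> L * (\<epsilon> / L)" using K(2)[of n] L by (intro mult_left_mono) auto
    finally show ?thesis using L by simp
  qed
  then show "\<exists>K>0. \<forall>n. (\<integral>x. \<bar>W n x\<bar> * indicator {x. \<bar>W n x\<bar> > K} x \<partial>P n) \<le> \<epsilon>"
    using K L by (intro exI[of _ "L * K"]) auto
qed

lemma null_in_prob_abs:
  assumes "null_in_prob N V" shows "null_in_prob N (\<lambda>n \<omega>. \<bar>V n \<omega>\<bar>)"
  using assms by (auto simp: null_in_prob_def intro: borel_measurable_abs)

text \<open>The free level \<open>\<kappa>\<close> is chosen after \<open>\<delta>\<close> and the
  target probability. \<open>L\<close> depends on \<open>\<delta>\<close> as the Chebyshev constants
  do.\<close>

lemma null_in_prob_tail_bound:
  assumes V: "\<And>n. V n \<in> borel_measurable (N n)" and B: "null_in_prob N B"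
    and bound: "\<And>n \<delta> \<kappa>. 0 < \<delta> \<Longrightarrow> 0 < \<kappa> \<Longrightarrow> measure (N n) {\<omega> \<in> space (N n). \<bar>V n \<omega>\<bar> > \<delta>}
      \<le> measure (N n) {\<omega> \<in> space (N n). \<bar>B n \<omega>\<bar> > \<kappa>} + L \<delta> * \<kappa>"
  shows "null_in_prob N V"
  unfolding null_in_prob_def
proof (intro conjI allI impI)
  fix \<delta> :: real assume \<delta>: "0 < \<delta>"
  show "(\<lambda>n. measure (N n) {\<omega> \<in> space (N n). \<bar>V n \<omega>\<bar> > \<delta>}) \<longlonglongrightarrow> 0"
  proof (rule tendstoI)
    fix \<epsilon> :: real assume \<epsilon>: "0 < \<epsilon>"
    \<comment> \<open>Adding 1 keeps the divisor positive when \<open>L \<delta>\<close> is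
      0.\<close>
    define \<kappa> where "\<kappa> = \<epsilon> / 2 / (\<bar>L \<delta>\<bar> + 1)"
    have \<kappa>: "0 < \<kappa>" using \<epsilon> by (simp add: \<kappa>_def)
    have "L \<delta> * \<kappa> \<le> (\<bar>L \<delta>\<bar> + 1) * \<kappa>" using \<kappa> by (intro mult_right_mono) auto
    also have "\<dots> = \<epsilon> / 2"
    proof -
      have "y * (x / y) = x" if "0 < y" for x y :: real using that by simp
      then show ?thesis unfolding \<kappa>_def by (metis abs_ge_zero add_nonneg_pos zero_less_one)
    qed
    finally have L: "L \<delta> * \<kappa> \<le> \<epsilon> / 2" .
    have "eventually (\<lambda>n. measure (N n) {\<omega> \<in> space (N n). \<bar>B n \<omega>\<bar> > \<kappa>} < \<epsilon> / 2) sequentially"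
      using \<epsilon> by (intro null_in_prob_eventually[OF B \<kappa>]) simp
    then show "eventually (\<lambda>n. dist (measure (N n) {\<omega> \<in> space (N n). \<bar>V n \<omega>\<bar> > \<delta>}) 0 < \<epsilon>) sequentially"
    proof eventually_elim
      case (elim n)
      then have "measure (N n) {\<omega> \<in> space (N n). \<bar>V n \<omega>\<bar> > \<delta>} < \<epsilon>"
        using bound[OF \<delta> \<kappa>, of n] L by linarith
      then show ?case by simp
    qed
  qed
qed (rule V)

section \<open>Regression errors along a sequence of laws: measurability, invariance, tail
  bounds\<close>

definition regr_err_f :: "('d::finite) regr \<Rightarrow> 'd pt measure \<Rightarrow> nat \<Rightarrow> (nat \<Rightarrow> 'd pt) \<Rightarrow> nat \<Rightarrow> real" where
  "regr_err_f fh P n \<omega> i = fP P (Zv (\<omega> i)) - fh n (xdat n \<omega>) (zdat n \<omega>) (Zv (\<omega> i))"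

definition regr_err_g :: "('d::finite) regr \<Rightarrow> 'd pt measure \<Rightarrow> nat \<Rightarrow> (nat \<Rightarrow> 'd pt) \<Rightarrow> nat \<Rightarrow> real" where
  "regr_err_g gh P n \<omega> i = gP P (Zv (\<omega> i)) - gh n (ydat n \<omega>) (zdat n \<omega>) (Zv (\<omega> i))"

lemma measurable_regr_fitted:
  fixes r :: "('d::finite) regr"
  assumes r: "measurable_regr r" and \<xi>: "\<xi> \<in> borel_measurable borel" and P: "sets P = sets borel" and i: "i < n"
  shows "(\<lambda>\<omega>. r n (\<lambda>i\<in>{..<n}. \<xi> (\<omega> i)) (zdat n \<omega>) (Zv (\<omega> i))) \<in> borel_measurable (sample P n)"
proof -
  note [measurable] = \<xi> and [measurable_cong] = P
  have m: "(\<lambda>(a, b, z). r n a b z) \<in> borel_measurable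
      (PiM {..<n} (\<lambda>_. borel) \<Otimes>\<^sub>M (PiM {..<n} (\<lambda>_. borel) \<Otimes>\<^sub>M borel))"
    using r by (simp add: measurable_regr_def)
  have c: "(\<lambda>\<omega>. \<omega> j) \<in> sample P n \<rightarrow>\<^sub>M borel" if "j < n" for j
    unfolding sample_def using that measurable_component_singleton[of j "{..<n}" "\<lambda>_. P"]
    by (simp add: measurable_cong_sets[OF refl P])
  have 1: "(\<lambda>\<omega>. \<lambda>i\<in>{..<n}. \<xi> (\<omega> i)) \<in> sample P n \<rightarrow>\<^sub>M PiM {..<n} (\<lambda>_. borel)"
    by (rule measurable_restrict) (use measurable_compose[OF c \<xi>] in simp)
  have 2: "(\<lambda>\<omega>. zdat n \<omega>) \<in> sample P n \<rightarrow>\<^sub>M PiM {..<n} (\<lambda>_. borel)"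
    unfolding zdat_def by (rule measurable_restrict) (use measurable_compose[OF c Zv_measurable] in simp)
  have 3: "(\<lambda>\<omega>. Zv (\<omega> i)) \<in> borel_measurable (sample P n)"
    using measurable_compose[OF c[OF i] Zv_measurable] .
  show ?thesis
    using measurable_compose[OF measurable_Pair[OF 1 measurable_Pair[OF 2 3]] m] by simp
qed

text \<open>The sample of size \<open>n\<close> has its own law \<open>P n\<close>, so a sequence
  picked from a class can be inserted. The hypotheses are what both parts of the theorem share: a
  lower variance bound and uniform integrability of the squared residual products.\<close>

locale gcm_sequence =
  fixes P :: "nat \<Rightarrow> ('d::finite) pt measure" and w :: "real ^ 'd \<Rightarrow> real" and fh gh :: "'d regr" and C c :: real
  assumes model: "\<And>n. null_model (P n)"
    and w_meas[measurable]: "w \<in> borel_measurable borel" and w_le: "\<And>z. \<bar>w z\<bar> \<le> C"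
    and fh_meas: "measurable_regr fh" and gh_meas: "measurable_regr gh"
    and c_pos: "0 < c" and sigma2_ge: "\<And>n. c \<le> sigma2 w (P n)"
    and ui: "uniformly_integrable P (\<lambda>n p. (epsP (P n) p)\<^sup>2 * (xiP (P n) p)\<^sup>2)"
    and AA_tail: "\<And>\<delta>. 0 < \<delta> \<Longrightarrow> (\<lambda>n. measure (sample (P n) n) {\<omega> \<in> space (sample (P n) n).
        \<bar>real n * (Af fh (P n) n \<omega> * Ag gh (P n) n \<omega>)\<bar> > \<delta>}) \<longlonglongrightarrow> 0"
    and Bf_tail: "\<And>\<delta>. 0 < \<delta> \<Longrightarrow> (\<lambda>n. measure (sample (P n) n) {\<omega> \<in> space (sample (P n) n).
        \<bar>Bf fh (P n) n \<omega>\<bar> > \<delta>}) \<longlonglongrightarrow> 0"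
    and Bg_tail: "\<And>\<delta>. 0 < \<delta> \<Longrightarrow> (\<lambda>n. measure (sample (P n) n) {\<omega> \<in> space (sample (P n) n).
        \<bar>Bg gh (P n) n \<omega>\<bar> > \<delta>}) \<longlonglongrightarrow> 0"
begin

sublocale P: null_model "P n" for n by (rule model)

abbreviation "N \<equiv> \<lambda>n. sample (P n) n"
abbreviation "df n i \<omega> \<equiv> regr_err_f fh (P n) n \<omega> i"
abbreviation "dg n i \<omega> \<equiv> regr_err_g gh (P n) n \<omega> i"

lemma prob_N: "prob_space (N n)"
  unfolding sample_def by (rule prob_space_PiM) (rule P.prob_space_axioms)

lemma component_measurable[measurable]: "i < n \<Longrightarrow> (\<lambda>\<omega>. \<omega> i) \<in> N n \<rightarrow>\<^sub>M borel"
  unfolding sample_def using measurable_component_singleton[of i "{..<n}" "\<lambda>_. P n"]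
  by (simp add: measurable_cong_sets[OF refl P.sets_P])

lemma borel_component: "f \<in> borel_measurable borel \<Longrightarrow> i < n \<Longrightarrow> (\<lambda>\<omega>. f (\<omega> i)) \<in> borel_measurable (N n)"
  by (rule measurable_compose[OF component_measurable])

lemma err_measurable[measurable]:
  assumes "i < n"
  shows "(\<lambda>\<omega>. df n i \<omega>) \<in> borel_measurable (N n)" "(\<lambda>\<omega>. dg n i \<omega>) \<in> borel_measurable (N n)"
  using measurable_regr_fitted[OF fh_meas Xv_measurable P.sets_P assms]
    measurable_regr_fitted[OF gh_meas Yv_measurable P.sets_P assms]
    borel_component[OF measurable_compose[OF Zv_measurable P.cond_fun_measurable(1)] assms]
    borel_component[OF measurable_compose[OF Zv_measurable P.cond_fun_measurable(2)] assms]
  unfolding regr_err_f_def regr_err_g_def xdat_def ydat_def by (auto intro: borel_measurable_diff)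

text \<open>The fit for X sees only the x and z data, so overwriting a y value leaves it unchanged,
  and symmetrically. Hence \<open>df\<close> is paired with the noise \<open>xiP\<close> and
  \<open>dg\<close> with \<open>epsP\<close>.\<close>

lemma err_invariant:
  assumes "i < n" "j < n"
  shows "P.xi.invariant_at n {..<n} j (\<lambda>\<omega>. df n i \<omega>)" "P.eps.invariant_at n {..<n} j (\<lambda>\<omega>. dg n i \<omega>)"
proof -
  have z: "Zv ((\<omega> (j := (Xv (\<omega> j), 0, Zv (\<omega> j)))) k) = Zv (\<omega> k)"
    "Zv ((\<omega> (j := (0, Yv (\<omega> j), Zv (\<omega> j)))) k) = Zv (\<omega> k)" for \<omega> :: "nat \<Rightarrow> 'd pt" and k
    by (auto simp: Zv_def)
  have x: "Xv ((\<omega> (j := (Xv (\<omega> j), 0, Zv (\<omega> j)))) k) = Xv (\<omega> k)"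
    "Yv ((\<omega> (j := (0, Yv (\<omega> j), Zv (\<omega> j)))) k) = Yv (\<omega> k)" for \<omega> :: "nat \<Rightarrow> 'd pt" and k
    by (auto simp: Xv_def Yv_def)
  show "P.xi.invariant_at n {..<n} j (\<lambda>\<omega>. df n i \<omega>)" "P.eps.invariant_at n {..<n} j (\<lambda>\<omega>. dg n i \<omega>)"
    unfolding P.xi.invariant_at_def P.eps.invariant_at_def regr_err_f_def regr_err_g_def xdat_def ydat_def zdat_def z x
    by auto
qed

lemma weight_invariant:
  assumes "i < n" "j < n"
  shows "P.xi.invariant_at n {..<n} j (\<lambda>\<omega>. w (Zv (\<omega> i)))" "P.eps.invariant_at n {..<n} j (\<lambda>\<omega>. w (Zv (\<omega> i)))"
  unfolding P.xi.invariant_at_def P.eps.invariant_at_def by (auto simp: Zv_def)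

text \<open>With 1/n moved into the square, B_f is the conditional variance sum of
  \<open>weighted_tail_bounds\<close> for \<open>df\<close> over \<open>sqrt n\<close>, and likewise
  B_g for \<open>dg\<close>.\<close>

lemma Af_eq: "Af fh (P n) n \<omega> = (\<Sum>i<n. (df n i \<omega>)\<^sup>2) / n"
  and Ag_eq: "Ag gh (P n) n \<omega> = (\<Sum>i<n. (dg n i \<omega>)\<^sup>2) / n"
  and Bf_eq: "Bf fh (P n) n \<omega> = (\<Sum>i<n. vP (P n) (Zv (\<omega> i)) * (df n i \<omega> / sqrt n)\<^sup>2)"
  and Bg_eq: "Bg gh (P n) n \<omega> = (\<Sum>i<n. uP (P n) (Zv (\<omega> i)) * (dg n i \<omega> / sqrt n)\<^sup>2)"
  by (simp_all add: Af_def Ag_def Bf_def Bg_def regr_err_f_def regr_err_g_def sum_divide_distrib power_divide mult.commute)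

lemma null_AA: "null_in_prob N (\<lambda>n \<omega>. real n * (Af fh (P n) n \<omega> * Ag gh (P n) n \<omega>))"
  unfolding null_in_prob_def using AA_tail by (auto simp: Af_eq Ag_eq)

lemma Bf_Bg_measurable: "Bf fh (P n) n \<in> borel_measurable (N n)" "Bg gh (P n) n \<in> borel_measurable (N n)"
proof -
  have [measurable]: "(\<lambda>\<omega>. uP (P n) (Zv (\<omega> i))) \<in> borel_measurable (N n)" "(\<lambda>\<omega>. vP (P n) (Zv (\<omega> i))) \<in> borel_measurable (N n)"
    if "i < n" for i
    using borel_component[OF measurable_compose[OF Zv_measurable P.cond_fun_measurable(3)] that]
      borel_component[OF measurable_compose[OF Zv_measurable P.cond_fun_measurable(4)] that] by auto
  show "Bf fh (P n) n \<in> borel_measurable (N n)" "Bg gh (P n) n \<in> borel_measurable (N n)"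
    by (subst measurable_cong[OF Bf_eq], measurable) (subst measurable_cong[OF Bg_eq], measurable)
qed

lemma null_Bf: "null_in_prob N (\<lambda>n. Bf fh (P n) n)"
  unfolding null_in_prob_def using Bf_tail Bf_Bg_measurable(1) by blast

lemma null_Bg: "null_in_prob N (\<lambda>n. Bg gh (P n) n)"
  unfolding null_in_prob_def using Bg_tail Bf_Bg_measurable(2) by blast

lemma cross_term_bounds:
  assumes \<delta>: "0 < \<delta>" and \<kappa>: "0 < \<kappa>"
  shows "measure (N n) {\<omega> \<in> space (N n). \<bar>\<Sum>i<n. xiP (P n) (\<omega> i) * (df n i \<omega> / sqrt n * w (Zv (\<omega> i)))\<bar> > \<delta>}
      \<le> measure (N n) {\<omega> \<in> space (N n). \<bar>Bf fh (P n) n \<omega>\<bar> > \<kappa>} + C\<^sup>2 * \<kappa> / \<delta>\<^sup>2"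
    and "measure (N n) {\<omega> \<in> space (N n). (\<Sum>i<n. (xiP (P n) (\<omega> i) * (df n i \<omega> / sqrt n * w (Zv (\<omega> i))))\<^sup>2) > \<delta>}
      \<le> measure (N n) {\<omega> \<in> space (N n). \<bar>Bf fh (P n) n \<omega>\<bar> > \<kappa>} + C\<^sup>2 * \<kappa> / \<delta>"
    and "measure (N n) {\<omega> \<in> space (N n). \<bar>\<Sum>i<n. epsP (P n) (\<omega> i) * (dg n i \<omega> / sqrt n * w (Zv (\<omega> i)))\<bar> > \<delta>}
      \<le> measure (N n) {\<omega> \<in> space (N n). \<bar>Bg gh (P n) n \<omega>\<bar> > \<kappa>} + C\<^sup>2 * \<kappa> / \<delta>\<^sup>2"
    and "measure (N n) {\<omega> \<in> space (N n). (\<Sum>i<n. (epsP (P n) (\<omega> i) * (dg n i \<omega> / sqrt n * w (Zv (\<omega> i))))\<^sup>2) > \<delta>}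
      \<le> measure (N n) {\<omega> \<in> space (N n). \<bar>Bg gh (P n) n \<omega>\<bar> > \<kappa>} + C\<^sup>2 * \<kappa> / \<delta>"
proof -
  let ?w = "\<lambda>i \<omega>. w (Zv (\<omega> i))"
  have m: "(\<lambda>\<omega>. df n i \<omega> / sqrt n) \<in> borel_measurable (PiM {..<n} (\<lambda>_. P n))"
    "(\<lambda>\<omega>. dg n i \<omega> / sqrt n) \<in> borel_measurable (PiM {..<n} (\<lambda>_. P n))"
    "?w i \<in> borel_measurable (PiM {..<n} (\<lambda>_. P n))" if "i \<in> {..<n}" for i
    using that err_measurable[of i n] borel_component[OF measurable_compose[OF Zv_measurable w_meas], of i n]
    by (auto simp: sample_def[symmetric])
  have inv: "P.xi.invariant_at n {..<n} j (\<lambda>\<omega>. df n i \<omega> / sqrt n)" "P.eps.invariant_at n {..<n} j (\<lambda>\<omega>. dg n i \<omega> / sqrt n)"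
    if "i \<in> {..<n}" "j \<in> {..<n}" for i j
    using err_invariant[of i n j] that by (auto simp: P.xi.invariant_at_def P.eps.invariant_at_def)
  have winv: "P.xi.invariant_at n {..<n} j (?w i)" "P.eps.invariant_at n {..<n} j (?w i)"
    if "i \<in> {..<n}" "j \<in> {..<n}" for i j
    using weight_invariant[of i n j] that by auto
  note f = P.xi.weighted_tail_bounds[of "{..<n}" "\<lambda>i \<omega>. df n i \<omega> / sqrt n" n ?w C \<kappa> \<delta>,
      OF _ m(1) m(3) inv(1) winv(1) w_le less_imp_le[OF \<kappa>] \<delta>, simplified]
  note g = P.eps.weighted_tail_bounds[of "{..<n}" "\<lambda>i \<omega>. dg n i \<omega> / sqrt n" n ?w C \<kappa> \<delta>,
      OF _ m(2) m(3) inv(2) winv(2) w_le less_imp_le[OF \<kappa>] \<delta>, simplified]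
  show "measure (N n) {\<omega> \<in> space (N n). \<bar>\<Sum>i<n. xiP (P n) (\<omega> i) * (df n i \<omega> / sqrt n * w (Zv (\<omega> i)))\<bar> > \<delta>}
      \<le> measure (N n) {\<omega> \<in> space (N n). \<bar>Bf fh (P n) n \<omega>\<bar> > \<kappa>} + C\<^sup>2 * \<kappa> / \<delta>\<^sup>2"
    using f(1) by (simp add: sample_def Bf_eq)
  show "measure (N n) {\<omega> \<in> space (N n). (\<Sum>i<n. (xiP (P n) (\<omega> i) * (df n i \<omega> / sqrt n * w (Zv (\<omega> i))))\<^sup>2) > \<delta>}
      \<le> measure (N n) {\<omega> \<in> space (N n). \<bar>Bf fh (P n) n \<omega>\<bar> > \<kappa>} + C\<^sup>2 * \<kappa> / \<delta>"
    using f(2) by (simp add: sample_def Bf_eq)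
  show "measure (N n) {\<omega> \<in> space (N n). \<bar>\<Sum>i<n. epsP (P n) (\<omega> i) * (dg n i \<omega> / sqrt n * w (Zv (\<omega> i)))\<bar> > \<delta>}
      \<le> measure (N n) {\<omega> \<in> space (N n). \<bar>Bg gh (P n) n \<omega>\<bar> > \<kappa>} + C\<^sup>2 * \<kappa> / \<delta>\<^sup>2"
    using g(1) by (simp add: sample_def Bg_eq)
  show "measure (N n) {\<omega> \<in> space (N n). (\<Sum>i<n. (epsP (P n) (\<omega> i) * (dg n i \<omega> / sqrt n * w (Zv (\<omega> i))))\<^sup>2) > \<delta>}
      \<le> measure (N n) {\<omega> \<in> space (N n). \<bar>Bg gh (P n) n \<omega>\<bar> > \<kappa>} + C\<^sup>2 * \<kappa> / \<delta>"
    using g(2) by (simp add: sample_def Bg_eq)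
qed

section \<open>Normalised decomposition of the statistic and bounds for its remainder\<close>

definition sg :: "nat \<Rightarrow> real" where "sg n = sqrt (sigma2 w (P n))"

definition \<zeta> :: "nat \<Rightarrow> 'd pt \<Rightarrow> real" where
  "\<zeta> n p = epsP (P n) p * xiP (P n) p * w (Zv p) / sg n"

text \<open>The negligible b_i: what the expansion of the product of \<open>epsP + df\<close>,
  \<open>xiP + dg\<close> and \<open>w\<close> leaves once the leading product is removed.\<close>

definition rem :: "nat \<Rightarrow> nat \<Rightarrow> (nat \<Rightarrow> 'd pt) \<Rightarrow> real" where
  "rem n i \<omega> = (xiP (P n) (\<omega> i) * (df n i \<omega> * w (Zv (\<omega> i))) + epsP (P n) (\<omega> i) * (dg n i \<omega> * w (Zv (\<omega> i)))
      + df n i \<omega> * w (Zv (\<omega> i)) * dg n i \<omega>) / sg n"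

definition S :: "nat \<Rightarrow> (nat \<Rightarrow> 'd pt) \<Rightarrow> real" where
  "S n \<omega> = (\<Sum>i<n. \<zeta> n (\<omega> i) / sqrt n)"

text \<open>The quantities \<open>\<bar>r\<bar>\<close>, \<open>\<bar>q\<bar>\<close> and
  \<open>E\<close> of \<open>studentization_bound\<close>, added up so that one convergence
  statement controls them all.\<close>

definition err :: "nat \<Rightarrow> (nat \<Rightarrow> 'd pt) \<Rightarrow> real" where
  "err n \<omega> = \<bar>\<Sum>i<n. rem n i \<omega> / sqrt n\<bar> + \<bar>(\<Sum>i<n. (\<zeta> n (\<omega> i))\<^sup>2) / n - 1\<bar> + (\<Sum>i<n. (rem n i \<omega>)\<^sup>2) / n"

lemma sg_ge: "sqrt c \<le> sg n" and sg_pos: "0 < sg n" and sg_sq: "(sg n)\<^sup>2 = sigma2 w (P n)"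
  using sigma2_ge[of n] c_pos by (auto simp: sg_def)

lemma C_nonneg: "0 \<le> C"
  using w_le[of 0] by linarith

lemma \<zeta>_measurable[measurable]: "\<zeta> n \<in> borel_measurable borel"
  unfolding \<zeta>_def[abs_def] by measurable

lemma \<zeta>_measurable_P: "\<zeta> n \<in> borel_measurable (P n)"
  by (simp add: measurable_cong_sets[OF P.sets_P refl])

lemma \<zeta>_mean: "(\<integral>p. \<zeta> n p \<partial>P n) = 0"
  using P.weighted_product_mean_zero[OF w_meas, of n] by (simp add: \<zeta>_def)

lemma \<zeta>_square: "(\<zeta> n p)\<^sup>2 = (epsP (P n) p)\<^sup>2 * (xiP (P n) p)\<^sup>2 * (w (Zv p))\<^sup>2 / sigma2 w (P n)"
  by (simp add: \<zeta>_def power_mult_distrib power_divide sg_sq)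

lemma \<zeta>_variance: "(\<integral>p. (\<zeta> n p)\<^sup>2 \<partial>P n) = 1"
  using sigma2_ge[of n] c_pos by (simp add: \<zeta>_square) (simp add: sigma2_def)

lemma \<zeta>_ui: "uniformly_integrable P (\<lambda>n p. (\<zeta> n p)\<^sup>2)"
proof (rule uniformly_integrable_scaled[OF ui])
  show "(\<lambda>p. (\<zeta> n p)\<^sup>2) \<in> borel_measurable (P n)" for n
    using \<zeta>_measurable_P by measurable
  \<comment> \<open>Adding 1 keeps the factor positive when \<open>C\<close> is 0.\<close>
  show "0 < (C\<^sup>2 + 1) / c" using c_pos by (simp add: add_nonneg_pos)
  fix n and p :: "'d pt"
  have "(w (Zv p))\<^sup>2 \<le> C\<^sup>2 + 1"
    using power_mono[OF w_le[of "Zv p"], of 2] by simp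
  moreover have "c \<le> sigma2 w (P n)" by (rule sigma2_ge)
  ultimately have "(w (Zv p))\<^sup>2 / sigma2 w (P n) \<le> (C\<^sup>2 + 1) / c"
    using c_pos by (intro frac_le) auto
  then have "(epsP (P n) p)\<^sup>2 * (xiP (P n) p)\<^sup>2 * ((w (Zv p))\<^sup>2 / sigma2 w (P n))
      \<le> (epsP (P n) p)\<^sup>2 * (xiP (P n) p)\<^sup>2 * ((C\<^sup>2 + 1) / c)"
    by (intro mult_left_mono) auto
  then show "\<bar>(\<zeta> n p)\<^sup>2\<bar> \<le> (C\<^sup>2 + 1) / c * \<bar>(epsP (P n) p)\<^sup>2 * (xiP (P n) p)\<^sup>2\<bar>"
    using sigma2_ge[of n] c_pos by (simp add: \<zeta>_square mult.commute abs_of_pos)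
qed

lemma pt_component_measurable[measurable]:
  assumes "i < n"
  shows "(\<lambda>\<omega>. \<zeta> n (\<omega> i)) \<in> borel_measurable (N n)" "(\<lambda>\<omega>. epsP (P n) (\<omega> i)) \<in> borel_measurable (N n)"
    "(\<lambda>\<omega>. xiP (P n) (\<omega> i)) \<in> borel_measurable (N n)" "(\<lambda>\<omega>. w (Zv (\<omega> i))) \<in> borel_measurable (N n)"
  using borel_component[OF \<zeta>_measurable assms] borel_component[OF P.residual_measurable(1) assms]
    borel_component[OF P.residual_measurable(2) assms]
    borel_component[OF measurable_compose[OF Zv_measurable w_meas] assms] by auto

lemma rem_measurable[measurable]: "i < n \<Longrightarrow> rem n i \<in> borel_measurable (N n)"
  unfolding rem_def[abs_def] by measurable

lemma S_measurable[measurable]: "S n \<in> borel_measurable (N n)"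
  unfolding S_def[abs_def] by measurable

lemma Rres_eq: "Rres w fh gh n \<omega> i = sg n * (\<zeta> n (\<omega> i) + rem n i \<omega>)"
proof -
  have "Rres w fh gh n \<omega> i = (epsP (P n) (\<omega> i) + df n i \<omega>) * (xiP (P n) (\<omega> i) + dg n i \<omega>) * w (Zv (\<omega> i))"
    by (simp add: Rres_def epsP_def xiP_def regr_err_f_def regr_err_g_def)
  also have "\<dots> = sg n * (\<zeta> n (\<omega> i) + rem n i \<omega>)"
    using sg_pos[of n] unfolding \<zeta>_def rem_def by (simp add: field_simps)
  finally show ?thesis .
qed

lemma Rres_measurable[measurable]: "i < n \<Longrightarrow> (\<lambda>\<omega>. Rres w fh gh n \<omega> i) \<in> borel_measurable (N n)"
  unfolding Rres_eq[abs_def] by measurable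

lemma Tstat_measurable[measurable]: "Tstat w fh gh n \<in> borel_measurable (N n)"
  unfolding Tstat_def[abs_def] tauN_def tauD_def by measurable

text \<open>\<open>sg n\<close> cancels between numerator and denominator, and the rest is arranged
  in the shape of \<open>studentization_bound\<close>, with \<open>m = 1 / n\<close>.\<close>

lemma Tstat_eq:
  assumes n: "0 < n"
  shows "Tstat w fh gh n \<omega> = (S n \<omega> + (\<Sum>i<n. rem n i \<omega> / sqrt n)) /
    sqrt (1 + ((\<Sum>i<n. (\<zeta> n (\<omega> i))\<^sup>2) / n - 1) + 2 * ((\<Sum>i<n. \<zeta> n (\<omega> i) * rem n i \<omega>) / n) + (\<Sum>i<n. (rem n i \<omega>)\<^sup>2) / n
      - 1 / n * (S n \<omega> + (\<Sum>i<n. rem n i \<omega> / sqrt n))\<^sup>2)"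
    (is "_ = ?A / sqrt ?B")
proof -
  have sum: "(\<Sum>i<n. Rres w fh gh n \<omega> i) = sg n * (sqrt n * ?A)"
    using n by (simp add: Rres_eq S_def sum_distrib_left[symmetric] sum.distrib sum_divide_distrib[symmetric] field_simps)
  have tauN: "tauN w fh gh n \<omega> = sg n * ?A"
    using n by (simp add: tauN_def sum)
  have sq: "(\<Sum>i<n. (Rres w fh gh n \<omega> i)\<^sup>2)
      = (sg n)\<^sup>2 * ((\<Sum>i<n. (\<zeta> n (\<omega> i))\<^sup>2) + 2 * (\<Sum>i<n. \<zeta> n (\<omega> i) * rem n i \<omega>) + (\<Sum>i<n. (rem n i \<omega>)\<^sup>2))"
    by (simp add: Rres_eq power_mult_distrib power2_sum sum.distrib sum_distrib_left[symmetric] mult.assoc add_ac)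
  have e: "(1 / real n * (s * (sqrt n * a)))\<^sup>2 = s\<^sup>2 * (1 / n * a\<^sup>2)" for s a :: real
    using n by (simp add: power_mult_distrib power_divide power2_eq_square[of "real n"])
  have "1 / m * (s2 * (a + 2 * b + d)) - s2 * (1 / m * A2) = s2 * (1 + (a / m - 1) + 2 * (b / m) + d / m - 1 / m * A2)"
    for m s2 a b d A2 :: real
    by (simp add: algebra_simps add_divide_distrib)
  then have "1 / real n * (\<Sum>i<n. (Rres w fh gh n \<omega> i)\<^sup>2) - (1 / real n * (\<Sum>r<n. Rres w fh gh n \<omega> r))\<^sup>2 = (sg n)\<^sup>2 * ?B"
    unfolding sum sq e .
  \<comment> \<open>\<open>sqrt\<close> is odd on the reals, so its product rule also covers a
    negative radicand.\<close>
  then have tauD: "tauD w fh gh n \<omega> = sg n * sqrt ?B"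
    using sg_pos[of n] by (simp only: tauD_def real_sqrt_mult) simp
  show ?thesis
    using sg_pos[of n] by (simp add: Tstat_def tauN tauD)
qed

lemma null_q: "null_in_prob N (\<lambda>n \<omega>. (\<Sum>i<n. (\<zeta> n (\<omega> i))\<^sup>2) / n - 1)"
  using row_iid_weak_law[OF P.prob_space_axioms \<zeta>_ui] by (simp add: \<zeta>_variance sample_def)

lemma null_cross_terms:
  "null_in_prob N (\<lambda>n \<omega>. \<Sum>i<n. xiP (P n) (\<omega> i) * (df n i \<omega> / sqrt n * w (Zv (\<omega> i))))" (is "null_in_prob N ?V1")
  "null_in_prob N (\<lambda>n \<omega>. \<Sum>i<n. (xiP (P n) (\<omega> i) * (df n i \<omega> / sqrt n * w (Zv (\<omega> i))))\<^sup>2)" (is "null_in_prob N ?V2")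
  "null_in_prob N (\<lambda>n \<omega>. \<Sum>i<n. epsP (P n) (\<omega> i) * (dg n i \<omega> / sqrt n * w (Zv (\<omega> i))))" (is "null_in_prob N ?V3")
  "null_in_prob N (\<lambda>n \<omega>. \<Sum>i<n. (epsP (P n) (\<omega> i) * (dg n i \<omega> / sqrt n * w (Zv (\<omega> i))))\<^sup>2)" (is "null_in_prob N ?V4")
proof -
  have m: "?V1 n \<in> borel_measurable (N n)" "?V2 n \<in> borel_measurable (N n)"
    "?V3 n \<in> borel_measurable (N n)" "?V4 n \<in> borel_measurable (N n)" for n
    by measurable
  show "null_in_prob N ?V1"
    by (rule null_in_prob_tail_bound[where L="\<lambda>\<delta>. C\<^sup>2 / \<delta>\<^sup>2", OF m(1) null_Bf]) (use cross_term_bounds(1) in simp)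
  show "null_in_prob N ?V2"
    by (rule null_in_prob_tail_bound[where L="\<lambda>\<delta>. C\<^sup>2 / \<delta>", OF m(2) null_Bf])
       (use cross_term_bounds(2) in \<open>simp add: sum_nonneg\<close>)
  show "null_in_prob N ?V3"
    by (rule null_in_prob_tail_bound[where L="\<lambda>\<delta>. C\<^sup>2 / \<delta>\<^sup>2", OF m(3) null_Bg]) (use cross_term_bounds(3) in simp)
  show "null_in_prob N ?V4"
    by (rule null_in_prob_tail_bound[where L="\<lambda>\<delta>. C\<^sup>2 / \<delta>", OF m(4) null_Bg])
       (use cross_term_bounds(4) in \<open>simp add: sum_nonneg\<close>)
qed

text \<open>By Cauchy-Schwarz the sum of the doubly erroneous terms over \<open>sqrt n\<close> is at
  most \<open>C * sqrt (V0 \<omega>)\<close>. The sum of their squares is at most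
  \<open>C\<^sup>2\<close> times the product of the two sums of squared errors, so the same
  \<open>V0\<close> serves both estimates.\<close>

lemma err_bound:
  assumes n: "0 < n"
  defines "V0 \<equiv> \<lambda>\<omega>. real n * (Af fh (P n) n \<omega> * Ag gh (P n) n \<omega>)"
    and "V1 \<equiv> \<lambda>\<omega>. \<Sum>i<n. xiP (P n) (\<omega> i) * (df n i \<omega> / sqrt n * w (Zv (\<omega> i)))"
    and "V2 \<equiv> \<lambda>\<omega>. \<Sum>i<n. (xiP (P n) (\<omega> i) * (df n i \<omega> / sqrt n * w (Zv (\<omega> i))))\<^sup>2"
    and "V3 \<equiv> \<lambda>\<omega>. \<Sum>i<n. epsP (P n) (\<omega> i) * (dg n i \<omega> / sqrt n * w (Zv (\<omega> i)))"
    and "V4 \<equiv> \<lambda>\<omega>. \<Sum>i<n. (epsP (P n) (\<omega> i) * (dg n i \<omega> / sqrt n * w (Zv (\<omega> i))))\<^sup>2"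
  shows "\<bar>\<Sum>i<n. rem n i \<omega> / sqrt n\<bar> \<le> (\<bar>V1 \<omega>\<bar> + \<bar>V3 \<omega>\<bar> + C * sqrt (V0 \<omega>)) / sqrt c"
    and "(\<Sum>i<n. (rem n i \<omega>)\<^sup>2) / n \<le> 3 * (V2 \<omega> + V4 \<omega> + C\<^sup>2 * V0 \<omega>) / c"
proof -
  let ?w = "\<lambda>i. w (Zv (\<omega> i))"
  have w2: "(?w i)\<^sup>2 \<le> C\<^sup>2" for i using power_mono[OF w_le[of "Zv (\<omega> i)"], of 2] by simp
  have V0: "V0 \<omega> = (\<Sum>i<n. (df n i \<omega>)\<^sup>2) * (\<Sum>i<n. (dg n i \<omega>)\<^sup>2) / n"
    using n by (simp add: V0_def Af_eq Ag_eq)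
  have V0_nonneg: "0 \<le> V0 \<omega>"
    unfolding V0 by (intro divide_nonneg_nonneg mult_nonneg_nonneg sum_nonneg) auto
  have dfw: "(\<Sum>i<n. (df n i \<omega> * ?w i)\<^sup>2) \<le> C\<^sup>2 * (\<Sum>i<n. (df n i \<omega>)\<^sup>2)"
  proof -
    have "(df n i \<omega> * ?w i)\<^sup>2 \<le> C\<^sup>2 * (df n i \<omega>)\<^sup>2" for i
      using mult_right_mono[OF w2[of i], of "(df n i \<omega>)\<^sup>2"] by (simp add: power_mult_distrib mult.commute)
    then show ?thesis unfolding sum_distrib_left by (intro sum_mono)
  qed
  define G where "G = (\<Sum>i<n. df n i \<omega> * ?w i * dg n i \<omega>)"
  have "G\<^sup>2 \<le> (\<Sum>i<n. (df n i \<omega> * ?w i)\<^sup>2) * (\<Sum>i<n. (dg n i \<omega>)\<^sup>2)"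
    unfolding G_def by (rule Cauchy_Schwarz_ineq_sum)
  also have "\<dots> \<le> C\<^sup>2 * (\<Sum>i<n. (df n i \<omega>)\<^sup>2) * (\<Sum>i<n. (dg n i \<omega>)\<^sup>2)"
    by (intro mult_right_mono dfw sum_nonneg) auto
  finally have "G\<^sup>2 / n \<le> C\<^sup>2 * V0 \<omega>"
    unfolding V0 using n by (simp add: divide_right_mono mult.assoc)
  then have "(G / sqrt n)\<^sup>2 \<le> C\<^sup>2 * V0 \<omega>" by (simp add: power_divide)
  then have "\<bar>G / sqrt n\<bar> \<le> sqrt (C\<^sup>2 * V0 \<omega>)" by (rule real_le_rsqrt[of "\<bar>_\<bar>", simplified])
  then have G: "\<bar>G / sqrt n\<bar> \<le> C * sqrt (V0 \<omega>)" using C_nonneg by (simp add: real_sqrt_mult)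
  have "(\<Sum>i<n. rem n i \<omega> / sqrt n) = (V1 \<omega> + V3 \<omega> + G / sqrt n) / sg n"
    unfolding rem_def V1_def V3_def G_def sum_divide_distrib sum.distrib[symmetric]
    by (intro sum.cong refl) (simp add: add_divide_distrib mult.commute)
  then have "\<bar>\<Sum>i<n. rem n i \<omega> / sqrt n\<bar> = \<bar>V1 \<omega> + V3 \<omega> + G / sqrt n\<bar> / sg n"
    using sg_pos[of n] by simp
  also have "\<dots> \<le> (\<bar>V1 \<omega>\<bar> + \<bar>V3 \<omega>\<bar> + C * sqrt (V0 \<omega>)) / sqrt c"
  proof (rule frac_le)
    show le: "\<bar>V1 \<omega> + V3 \<omega> + G / sqrt n\<bar> \<le> \<bar>V1 \<omega>\<bar> + \<bar>V3 \<omega>\<bar> + C * sqrt (V0 \<omega>)"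
      using G by linarith
    show "0 \<le> \<bar>V1 \<omega>\<bar> + \<bar>V3 \<omega>\<bar> + C * sqrt (V0 \<omega>)"
      using le by linarith
  qed (use sg_ge[of n] c_pos in auto)
  finally show "\<bar>\<Sum>i<n. rem n i \<omega> / sqrt n\<bar> \<le> (\<bar>V1 \<omega>\<bar> + \<bar>V3 \<omega>\<bar> + C * sqrt (V0 \<omega>)) / sqrt c" .
  define H where "H = (\<Sum>i<n. (df n i \<omega> * ?w i * dg n i \<omega>)\<^sup>2)"
  \<comment> \<open>Each single \<open>(dg n i \<omega>)\<^sup>2\<close> is at most the whole
    sum.\<close>
  have "H \<le> (\<Sum>i<n. (df n i \<omega> * ?w i)\<^sup>2 * (\<Sum>i<n. (dg n i \<omega>)\<^sup>2))"
    unfolding H_def power_mult_distrib[of "_ * _"]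
    by (intro sum_mono mult_left_mono member_le_sum[of _ "{..<n}" "\<lambda>i. (dg n i \<omega>)\<^sup>2"]) auto
  also have "\<dots> = (\<Sum>i<n. (df n i \<omega> * ?w i)\<^sup>2) * (\<Sum>i<n. (dg n i \<omega>)\<^sup>2)" by (simp add: sum_distrib_right)
  also have "\<dots> \<le> C\<^sup>2 * (\<Sum>i<n. (df n i \<omega>)\<^sup>2) * (\<Sum>i<n. (dg n i \<omega>)\<^sup>2)"
    by (intro mult_right_mono dfw sum_nonneg) auto
  finally have H: "H / n \<le> C\<^sup>2 * V0 \<omega>"
    unfolding V0 using n by (simp add: divide_right_mono mult.assoc)
  \<comment> \<open>The difference of the two sides is the sum of the squares of the three pairwise
    differences.\<close>
  have three: "(x + y + z)\<^sup>2 \<le> 3 * (x\<^sup>2 + y\<^sup>2 + z\<^sup>2)" for x y z :: real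
    using sum_squares_ge_zero[of "x - y" "y - z"] zero_le_power2[of "x - z"]
    by (simp add: power2_eq_square algebra_simps)
  have "(\<Sum>i<n. (rem n i \<omega>)\<^sup>2) / n \<le> (\<Sum>i<n. 3 * ((xiP (P n) (\<omega> i) * (df n i \<omega> * ?w i))\<^sup>2
      + (epsP (P n) (\<omega> i) * (dg n i \<omega> * ?w i))\<^sup>2 + (df n i \<omega> * ?w i * dg n i \<omega>)\<^sup>2) / sigma2 w (P n)) / n"
    unfolding rem_def power_divide sg_sq using sigma2_ge[of n] c_pos
    by (intro divide_right_mono sum_mono three) auto
  also have "\<dots> = 3 * (V2 \<omega> + V4 \<omega> + H / n) / sigma2 w (P n)"
    using n unfolding V2_def V4_def H_def
    by (simp add: sum_divide_distrib[symmetric] sum_distrib_left[symmetric] sum.distrib power_mult_distrib power_divide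
        add_divide_distrib sum_distrib_left[symmetric])
       (simp add: sum_divide_distrib add_divide_distrib mult_ac)
  also have "\<dots> \<le> 3 * (V2 \<omega> + V4 \<omega> + C\<^sup>2 * V0 \<omega>) / c"
    using H sigma2_ge[of n] c_pos V0_nonneg
    by (intro frac_le) (auto simp: V2_def V4_def intro!: add_nonneg_nonneg sum_nonneg mult_nonneg_nonneg)
  finally show "(\<Sum>i<n. (rem n i \<omega>)\<^sup>2) / n \<le> 3 * (V2 \<omega> + V4 \<omega> + C\<^sup>2 * V0 \<omega>) / c" .
qed

end

section \<open>Normal limit of the studentized statistic\<close>

lemma Phi_cdf:
  "continuous_on UNIV Phi" "mono Phi" "(Phi \<longlongrightarrow> 1) at_top" "(Phi \<longlongrightarrow> 0) at_bot"
  "Phi t = cdf std_normal_distribution t"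
proof -
  interpret real_distribution std_normal_distribution by (rule real_dist_normal_dist)
  have eq: "Phi = cdf std_normal_distribution" by (auto simp: Phi_def cdf_def)
  show "Phi t = cdf std_normal_distribution t" by (simp add: eq)
  have "measure std_normal_distribution {x} = 0" for x
  proof -
    have "{x} \<in> null_sets lborel" by (auto simp: null_sets_def)
    then have "{x} \<in> null_sets std_normal_distribution"
      using absolutely_continuousI_density[of std_normal_density lborel] by (auto simp: absolutely_continuous_def)
    then show ?thesis by (simp add: null_sets_def measure_def)
  qed
  then show "continuous_on UNIV Phi"
    by (simp add: eq continuous_on_eq_continuous_at isCont_cdf)
  show "mono Phi" by (auto simp: eq mono_def cdf_nondecreasing)
  show "(Phi \<longlongrightarrow> 1) at_top" "(Phi \<longlongrightarrow> 0) at_bot"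
    unfolding eq by (rule cdf_lim_at_top_prob, rule cdf_lim_at_bot)
qed

context gcm_sequence
begin

lemma null_err: "null_in_prob N err"
proof -
  define V0 where "V0 = (\<lambda>n \<omega>. real n * (Af fh (P n) n \<omega> * Ag gh (P n) n \<omega>))"
  define V1 where "V1 = (\<lambda>n \<omega>. \<Sum>i<n. xiP (P n) (\<omega> i) * (df n i \<omega> / sqrt n * w (Zv (\<omega> i))))"
  define V2 where "V2 = (\<lambda>n \<omega>. \<Sum>i<n. (xiP (P n) (\<omega> i) * (df n i \<omega> / sqrt n * w (Zv (\<omega> i))))\<^sup>2)"
  define V3 where "V3 = (\<lambda>n \<omega>. \<Sum>i<n. epsP (P n) (\<omega> i) * (dg n i \<omega> / sqrt n * w (Zv (\<omega> i))))"
  define V4 where "V4 = (\<lambda>n \<omega>. \<Sum>i<n. (epsP (P n) (\<omega> i) * (dg n i \<omega> / sqrt n * w (Zv (\<omega> i))))\<^sup>2)"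
  define q where "q = (\<lambda>n \<omega>. (\<Sum>i<n. (\<zeta> n (\<omega> i))\<^sup>2) / n - 1)"
  note V_defs = V0_def V1_def V2_def V3_def V4_def q_def
  have null: "null_in_prob N V0" "null_in_prob N V1" "null_in_prob N V2" "null_in_prob N V3" "null_in_prob N V4" "null_in_prob N q"
    unfolding V_defs by (rule null_AA null_cross_terms null_q)+
  define W where "W = (\<lambda>n \<omega>. \<bar>V0 n \<omega>\<bar> + (\<bar>V1 n \<omega>\<bar> + (\<bar>V2 n \<omega>\<bar> + (\<bar>V3 n \<omega>\<bar> + (\<bar>V4 n \<omega>\<bar> + \<bar>q n \<omega>\<bar>)))))"
  have "null_in_prob N W"
    unfolding W_def by (intro null_in_prob_add[OF prob_N] null_in_prob_abs null)
  then show ?thesis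
  proof (rule null_in_prob_dominated[OF prob_N])
    show "err n \<in> borel_measurable (N n)" for n
      unfolding err_def[abs_def] by measurable
    fix \<delta> :: real assume \<delta>: "0 < \<delta>"
    \<comment> \<open>Sum of the coefficients in \<open>err_bound\<close>, plus 1 for
      \<open>q\<close>: if every term is at most \<open>h\<close>, then \<open>err\<close> is at
      most \<open>h * L\<close>.\<close>
    define L where "L = (2 + C) / sqrt c + 1 + 3 * (2 + C\<^sup>2) / c"
    have L: "0 < L"
      using c_pos C_nonneg by (auto simp: L_def intro!: add_nonneg_pos add_pos_nonneg)
    define h where "h = min 1 (\<delta> / L)"
    have h: "0 < h" "h \<le> 1" and hL: "h * L \<le> \<delta>"
    proof -
      have "h \<le> \<delta> / L" by (simp add: h_def)
      then show "h * L \<le> \<delta>" using L by (simp add: pos_le_divide_eq)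
    qed (use \<delta> L in \<open>auto simp: h_def\<close>)
    have hh: "h\<^sup>2 \<le> h" using h by (simp add: power2_eq_square mult_left_le)
    \<comment> \<open>The level is \<open>h\<^sup>2\<close> because \<open>V0\<close> enters
      \<open>err_bound\<close> through its square root.\<close>
    have "eventually (\<lambda>n. \<forall>\<omega>\<in>space (N n). \<bar>W n \<omega>\<bar> \<le> h\<^sup>2 \<longrightarrow> \<bar>err n \<omega>\<bar> \<le> \<delta>) sequentially"
      using eventually_gt_at_top[of 0]
    proof (eventually_elim, intro ballI impI)
      fix n :: nat and \<omega> assume n: "0 < n" and W: "\<bar>W n \<omega>\<bar> \<le> h\<^sup>2"
      have six: "a \<le> k \<and> a1 \<le> k \<and> a2 \<le> k \<and> a3 \<le> k \<and> a4 \<le> k \<and> a5 \<le> k"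
        if "a + (a1 + (a2 + (a3 + (a4 + a5)))) \<le> k" "0 \<le> a" "0 \<le> a1" "0 \<le> a2" "0 \<le> a3" "0 \<le> a4" "0 \<le> a5"
        for a a1 a2 a3 a4 a5 k :: real
        using that by (intro conjI) linarith+
      have le: "\<bar>V0 n \<omega>\<bar> \<le> h\<^sup>2 \<and> \<bar>V1 n \<omega>\<bar> \<le> h\<^sup>2 \<and> \<bar>V2 n \<omega>\<bar> \<le> h\<^sup>2 \<and> \<bar>V3 n \<omega>\<bar> \<le> h\<^sup>2
          \<and> \<bar>V4 n \<omega>\<bar> \<le> h\<^sup>2 \<and> \<bar>q n \<omega>\<bar> \<le> h\<^sup>2"
        by (rule six) (use abs_le_D1[OF W] in \<open>auto simp: W_def\<close>)
      have V: "\<bar>V0 n \<omega>\<bar> \<le> h\<^sup>2" "\<bar>V1 n \<omega>\<bar> \<le> h" "V2 n \<omega> \<le> h" "\<bar>V3 n \<omega>\<bar> \<le> h" "V4 n \<omega> \<le> h" "\<bar>q n \<omega>\<bar> \<le> h"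
        using conjunct1[OF le] order_trans[OF _ hh] le by (auto intro: order_trans[OF abs_ge_self])
      have sV0: "sqrt (V0 n \<omega>) \<le> h"
        using V(1) h by (intro real_le_lsqrt) auto
      have V0h: "V0 n \<omega> \<le> h" using V(1) hh by linarith
      note b = err_bound[OF n, of \<omega>, folded V_defs]
      have "\<bar>\<Sum>i<n. rem n i \<omega> / sqrt n\<bar> \<le> (\<bar>V1 n \<omega>\<bar> + \<bar>V3 n \<omega>\<bar> + C * sqrt (V0 n \<omega>)) / sqrt c"
        using b(1) by (simp add: V_defs)
      also have "\<dots> \<le> (h + h + C * h) / sqrt c"
        using V sV0 C_nonneg c_pos by (intro divide_right_mono add_mono mult_left_mono) auto
      finally have 1: "\<bar>\<Sum>i<n. rem n i \<omega> / sqrt n\<bar> \<le> (h + h + C * h) / sqrt c" .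
      have "(\<Sum>i<n. (rem n i \<omega>)\<^sup>2) / n \<le> 3 * (V2 n \<omega> + V4 n \<omega> + C\<^sup>2 * V0 n \<omega>) / c"
        using b(2) by (simp add: V_defs)
      also have "\<dots> \<le> 3 * (h + h + C\<^sup>2 * h) / c"
        using V V0h c_pos by (intro divide_right_mono add_mono mult_left_mono) auto
      finally have 2: "(\<Sum>i<n. (rem n i \<omega>)\<^sup>2) / n \<le> 3 * (h + h + C\<^sup>2 * h) / c" .
      have nn: "0 \<le> (\<Sum>i<n. (rem n i \<omega>)\<^sup>2) / n" by (intro divide_nonneg_nonneg sum_nonneg) auto
      have "\<bar>err n \<omega>\<bar> = \<bar>\<Sum>i<n. rem n i \<omega> / sqrt n\<bar> + \<bar>q n \<omega>\<bar> + (\<Sum>i<n. (rem n i \<omega>)\<^sup>2) / n"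
        using nn by (simp add: err_def q_def)
      also have "\<dots> \<le> (h + h + C * h) / sqrt c + h + 3 * (h + h + C\<^sup>2 * h) / c"
        by (intro add_mono 1 2 V)
      also have "\<dots> = h * L"
        by (simp add: L_def algebra_simps add_divide_distrib)
      finally show "\<bar>err n \<omega>\<bar> \<le> \<delta>" using hL by linarith
    qed
    then show "\<exists>\<kappa>>0. eventually (\<lambda>n. \<forall>\<omega>\<in>space (N n). \<bar>W n \<omega>\<bar> \<le> \<kappa> \<longrightarrow> \<bar>err n \<omega>\<bar> \<le> \<delta>) sequentially"
      using h by (intro exI[of _ "h\<^sup>2"]) simp
  qed
qed

lemma S_tight:
  assumes "0 < \<epsilon>"
  shows "\<exists>K>0. eventually (\<lambda>n. measure (N n) {\<omega> \<in> space (N n). \<bar>S n \<omega>\<bar> > K} \<le> \<epsilon>) sequentially"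
proof (intro exI conjI)
  \<comment> \<open>\<open>S n\<close> has variance 1, so Chebyshev's inequality gives the
    probability bound \<open>1 / ?K\<^sup>2 = \<epsilon>\<close>.\<close>
  let ?K = "1 / sqrt \<epsilon>"
  show "0 < ?K" using assms by simp
  show "eventually (\<lambda>n. measure (N n) {\<omega> \<in> space (N n). \<bar>S n \<omega>\<bar> > ?K} \<le> \<epsilon>) sequentially"
    using eventually_gt_at_top[of 0]
  proof eventually_elim
    case (elim n)
    have "\<bar>S n \<omega>\<bar> > ?K \<longleftrightarrow> \<bar>\<Sum>i<n. \<zeta> n (\<omega> i)\<bar> > ?K * sqrt n" for \<omega>
      using elim by (simp add: S_def sum_divide_distrib[symmetric] abs_divide pos_less_divide_eq)
    then have "measure (N n) {\<omega> \<in> space (N n). \<bar>S n \<omega>\<bar> > ?K}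
        \<le> card {..<n} * (\<integral>p. (\<zeta> n p)\<^sup>2 \<partial>P n) / (?K * sqrt n)\<^sup>2"
      unfolding sample_def
      using P.measure_PiM_sum_le[where n=n and g="\<zeta> n" and I="{..<n}" and \<delta>="?K * sqrt n", OF _ \<zeta>_measurable_P _ \<zeta>_mean]
        \<zeta>_ui elim assms by (simp add: uniformly_integrable_def)
    also have "\<dots> = \<epsilon>"
      using elim assms by (simp add: \<zeta>_variance power_mult_distrib power_divide)
    finally show ?case .
  qed
qed

text \<open>The relative error of the denominator multiplies \<open>S n\<close>, which must
  therefore be bounded in probability for the difference to vanish.\<close>

lemma null_T_S: "null_in_prob N (\<lambda>n \<omega>. Tstat w fh gh n \<omega> - S n \<omega>)"
proof (rule null_in_prob_tight[OF prob_N S_measurable S_tight null_err])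
  show "(\<lambda>\<omega>. Tstat w fh gh n \<omega> - S n \<omega>) \<in> borel_measurable (N n)" for n by measurable
  fix K \<delta> :: real assume "0 < K" "0 < \<delta>"
  then obtain \<kappa> where \<kappa>: "0 < \<kappa>"
    and b: "\<And>s r q E X m. \<lbrakk>\<bar>s\<bar> \<le> K; \<bar>r\<bar> + \<bar>q\<bar> + E \<le> \<kappa>; 0 \<le> E; X\<^sup>2 \<le> (1 + q) * E; 0 \<le> m; m \<le> \<kappa>\<rbrakk>
      \<Longrightarrow> \<bar>(s + r) / sqrt (1 + q + 2 * X + E - m * (s + r)\<^sup>2) - s\<bar> \<le> \<delta>"
    using studentization_bound by metis
  have "eventually (\<lambda>n. 1 / real n < \<kappa>) sequentially"
    using \<kappa> by (intro order_tendstoD(2)[OF lim_const_over_n])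
  then have "eventually (\<lambda>n. \<forall>\<omega>\<in>space (N n). \<bar>S n \<omega>\<bar> \<le> K \<longrightarrow> \<bar>err n \<omega>\<bar> \<le> \<kappa> \<longrightarrow>
      \<bar>Tstat w fh gh n \<omega> - S n \<omega>\<bar> \<le> \<delta>) sequentially"
    using eventually_gt_at_top[of 0]
  proof (eventually_elim, intro ballI impI)
    fix n :: nat and \<omega> assume n: "1 / real n < \<kappa>" "0 < n" and S: "\<bar>S n \<omega>\<bar> \<le> K" and e: "\<bar>err n \<omega>\<bar> \<le> \<kappa>"
    \<comment> \<open>Supplies the bound on \<open>X\<^sup>2\<close> in
      \<open>studentization_bound\<close>, where \<open>1 + q\<close> is the mean of the squares of
      \<open>\<zeta> n\<close>.\<close>
    have "(\<Sum>i<n. \<zeta> n (\<omega> i) * rem n i \<omega>)\<^sup>2 \<le> (\<Sum>i<n. (\<zeta> n (\<omega> i))\<^sup>2) * (\<Sum>i<n. (rem n i \<omega>)\<^sup>2)"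
      by (rule Cauchy_Schwarz_ineq_sum)
    then have "((\<Sum>i<n. \<zeta> n (\<omega> i) * rem n i \<omega>) / n)\<^sup>2
        \<le> (1 + ((\<Sum>i<n. (\<zeta> n (\<omega> i))\<^sup>2) / n - 1)) * ((\<Sum>i<n. (rem n i \<omega>)\<^sup>2) / n)"
      by (simp add: power_divide power2_eq_square[of "real n"] divide_right_mono)
    then show "\<bar>Tstat w fh gh n \<omega> - S n \<omega>\<bar> \<le> \<delta>"
      unfolding Tstat_eq[OF n(2)] using S e n(1)
      by (intro b) (auto simp: err_def intro!: divide_nonneg_nonneg sum_nonneg)
  qed
  then show "\<exists>\<kappa>>0. eventually (\<lambda>n. \<forall>\<omega>\<in>space (N n). \<bar>S n \<omega>\<bar> \<le> K \<longrightarrow> \<bar>err n \<omega>\<bar> \<le> \<kappa> \<longrightarrow>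
      \<bar>Tstat w fh gh n \<omega> - S n \<omega>\<bar> \<le> \<delta>) sequentially"
    using \<kappa> by blast
qed

lemma S_cdf: "(\<lambda>n. measure (N n) {\<omega> \<in> space (N n). S n \<omega> \<le> t}) \<longlonglongrightarrow> Phi t"
proof -
  have "weak_conv_m (\<lambda>n. distr (N n) borel (S n)) std_normal_distribution"
    unfolding S_def[abs_def] sample_def
    by (rule row_iid_clt[OF P.prob_space_axioms \<zeta>_measurable_P \<zeta>_mean \<zeta>_variance \<zeta>_ui])
  moreover have "isCont (cdf std_normal_distribution) t"
    using Phi_cdf(1) unfolding Phi_cdf(5)[abs_def]
    by (simp add: continuous_on_eq_continuous_at)
  ultimately have "(\<lambda>n. cdf (distr (N n) borel (S n)) t) \<longlonglongrightarrow> Phi t"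
    by (simp add: weak_conv_m_def weak_conv_def Phi_cdf(5))
  moreover have "cdf (distr (N n) borel (S n)) t = measure (N n) {\<omega> \<in> space (N n). S n \<omega> \<le> t}" for n
    unfolding cdf_def by (subst measure_distr) (auto intro!: arg_cong[where f="measure (N n)"])
  ultimately show ?thesis by simp
qed

theorem cdf_dist_uniform:
  assumes "0 < \<epsilon>"
  shows "eventually (\<lambda>n. \<forall>t. cdf_dist w fh gh (P n) n t \<le> \<epsilon>) sequentially"
  unfolding cdf_dist_def
proof (rule continuous_cdf_uniform_convergence[OF Phi_cdf(1-4) _ _ _ _ assms])
  fix n :: nat and t :: real
  interpret NP: prob_space "N n" by (rule prob_N)
  show "mono (\<lambda>t. measure (N n) {\<omega> \<in> space (N n). Tstat w fh gh n \<omega> \<le> t})"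
    by (intro monoI NP.finite_measure_mono) auto
  show "measure (N n) {\<omega> \<in> space (N n). Tstat w fh gh n \<omega> \<le> t} \<le> 1" by simp
  show "(\<lambda>n. measure (N n) {\<omega> \<in> space (N n). Tstat w fh gh n \<omega> \<le> t}) \<longlonglongrightarrow> Phi t"
    by (rule cdf_convergence_perturb[OF prob_N S_measurable Tstat_measurable S_cdf Phi_cdf(1) null_T_S])
qed simp

end

section \<open>Uniformity over a class of distributions\<close>

text \<open>Any choice of one law per sample size stays below the supremum over the class.\<close>

lemma o_unif_tendsto:
  assumes o: "o_unif Q V W" and P: "\<And>n. P n \<in> Q" and \<delta>: "0 < \<delta>"
  shows "(\<lambda>n. measure (sample (P n) n) {\<omega> \<in> space (sample (P n) n). \<bar>V (P n) n \<omega> / W n\<bar> > \<delta>}) \<longlonglongrightarrow> 0"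
proof -
  let ?m = "\<lambda>P n. measure (sample P n) {\<omega> \<in> space (sample P n). \<bar>V P n \<omega> / W n\<bar> > \<delta>}"
  have "(\<lambda>n. ennreal (?m (P n) n)) \<longlonglongrightarrow> 0"
  proof (rule tendsto_sandwich[OF _ _ tendsto_const])
    show "(\<lambda>n. \<Squnion>P\<in>Q. ennreal (?m P n)) \<longlonglongrightarrow> 0" using o \<delta> by (simp add: o_unif_def)
    show "eventually (\<lambda>n. ennreal (?m (P n) n) \<le> (\<Squnion>P\<in>Q. ennreal (?m P n))) sequentially"
      by (intro always_eventually allI SUP_upper P)
  qed simp
  then show ?thesis
    by (subst (asm) tendsto_ennreal_iff[where x=0, simplified]) auto
qed

lemma ennreal_tendsto_0I:
  fixes f :: "nat \<Rightarrow> ennreal"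
  assumes "\<And>\<epsilon>. 0 < \<epsilon> \<Longrightarrow> eventually (\<lambda>n. f n \<le> ennreal \<epsilon>) sequentially"
  shows "f \<longlonglongrightarrow> 0"
proof (rule order_tendstoI)
  fix a :: ennreal assume "0 < a"
  then obtain r where r: "0 < r" "ennreal r < a"
    by (metis ennreal_less_zero_iff dense ennreal_cases less_top_ennreal not_less_zero order_less_trans top.not_eq_extremum)
  show "eventually (\<lambda>n. f n < a) sequentially"
    using assms[OF r(1)] by eventually_elim (use r(2) in auto)
qed simp

text \<open>The supremum need not be attained. For fixed \<open>\<epsilon>\<close> it is enough to
  pick, at every \<open>n\<close>, a law whose distance exceeds \<open>\<epsilon>\<close> at some
  \<open>t\<close>, if there is one; convergence along the picked sequence shows that eventually
  there is none.\<close>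

lemma uniform_clt:
  fixes w :: "real ^ ('d::finite) \<Rightarrow> real" and fh gh :: "'d regr" and Q :: "'d pt measure set"
  assumes w: "w \<in> borel_measurable borel" "\<And>z. \<bar>w z\<bar> \<le> C"
    and fh: "measurable_regr fh" and gh: "measurable_regr gh"
    and Q: "Q \<subseteq> P0" "\<And>P. P \<in> Q \<Longrightarrow> integrable P Xv" "\<And>P. P \<in> Q \<Longrightarrow> integrable P Yv"
    and A: "o_unif Q (\<lambda>P n \<omega>. Af fh P n \<omega> * Ag gh P n \<omega>) (\<lambda>n. 1 / real n)"
    and B: "o_unif Q (Bf fh) (\<lambda>n. 1)" "o_unif Q (Bg gh) (\<lambda>n. 1)"
    and c: "0 < c" "\<And>P. P \<in> Q \<Longrightarrow> c \<le> sigma2 w P"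
    and int: "\<And>P. P \<in> Q \<Longrightarrow> integrable P (\<lambda>p. (epsP P p)\<^sup>2 * (xiP P p)\<^sup>2)"
    and ui: "\<And>\<epsilon>. 0 < \<epsilon> \<Longrightarrow> \<exists>K>0. \<forall>P\<in>Q.
      (\<integral>p. (epsP P p)\<^sup>2 * (xiP P p)\<^sup>2 * indicator {p. (epsP P p)\<^sup>2 * (xiP P p)\<^sup>2 > K} p \<partial>P) \<le> \<epsilon>"
  shows "(\<lambda>n. \<Squnion>P\<in>Q. \<Squnion>t. ennreal (cdf_dist w fh gh P n t)) \<longlonglongrightarrow> 0"
proof (cases "Q = {}")
  case False
  then obtain P1 where P1: "P1 \<in> Q" by blast
  have "\<exists>n0. \<forall>n\<ge>n0. \<forall>P\<in>Q. \<forall>t. cdf_dist w fh gh P n t \<le> \<epsilon>" if \<epsilon>: "0 < \<epsilon>" for \<epsilon>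
  proof -
    define bad where "bad n P \<longleftrightarrow> P \<in> Q \<and> (\<exists>t. \<epsilon> < cdf_dist w fh gh P n t)" for n P
    \<comment> \<open>The default \<open>P1\<close> keeps the sequence inside \<open>Q\<close> where
      no law violates the bound.\<close>
    define P where "P n = (if \<exists>P. bad n P then SOME P. bad n P else P1)" for n
    have PQ: "P n \<in> Q" for n
      using someI_ex[of "bad n"] P1 by (auto simp: P_def bad_def)
    have worst: "bad n (P n)" if "bad n P'" for n P'
      using someI_ex[of "bad n"] that by (auto simp: P_def)
    interpret gcm_sequence P w fh gh C c
    proof
      fix n
      show "P n \<in> P0" "integrable (P n) Xv" "integrable (P n) Yv" "c \<le> sigma2 w (P n)"
        using PQ Q c(2) by auto
      show "(\<integral>\<^sup>+ p. ennreal ((epsP (P n) p)\<^sup>2 * (xiP (P n) p)\<^sup>2) \<partial>P n) < \<infinity>"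
        using int[OF PQ[of n]] by (simp add: nn_integral_eq_integral)
    next
      show "uniformly_integrable P (\<lambda>n p. (epsP (P n) p)\<^sup>2 * (xiP (P n) p)\<^sup>2)"
        unfolding uniformly_integrable_def
      proof (intro conjI allI impI int PQ)
        fix \<epsilon> :: real assume "0 < \<epsilon>"
        from ui[OF this] show "\<exists>K>0. \<forall>n. (\<integral>p. \<bar>(epsP (P n) p)\<^sup>2 * (xiP (P n) p)\<^sup>2\<bar> *
            indicator {p. \<bar>(epsP (P n) p)\<^sup>2 * (xiP (P n) p)\<^sup>2\<bar> > K} p \<partial>P n) \<le> \<epsilon>"
          using PQ by auto
      qed
    next
      fix \<delta> :: real assume \<delta>: "0 < \<delta>"
      show "(\<lambda>n. measure (sample (P n) n) {\<omega> \<in> space (sample (P n) n). \<bar>real n * (Af fh (P n) n \<omega> * Ag gh (P n) n \<omega>)\<bar> > \<delta>}) \<longlonglongrightarrow> 0"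
        using o_unif_tendsto[OF A PQ \<delta>] by (simp add: mult_ac)
      show "(\<lambda>n. measure (sample (P n) n) {\<omega> \<in> space (sample (P n) n). \<bar>Bf fh (P n) n \<omega>\<bar> > \<delta>}) \<longlonglongrightarrow> 0"
        using o_unif_tendsto[OF B(1) PQ \<delta>] by simp
      show "(\<lambda>n. measure (sample (P n) n) {\<omega> \<in> space (sample (P n) n). \<bar>Bg gh (P n) n \<omega>\<bar> > \<delta>}) \<longlonglongrightarrow> 0"
        using o_unif_tendsto[OF B(2) PQ \<delta>] by simp
    qed (use w fh gh c in auto)
    obtain n0 where "\<And>n t. n \<ge> n0 \<Longrightarrow> cdf_dist w fh gh (P n) n t \<le> \<epsilon>"
      using cdf_dist_uniform[OF \<epsilon>] by (auto simp: eventually_sequentially)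
    then have "\<not> bad n P'" if "n \<ge> n0" for n P'
      using worst[of n P'] that by (auto simp: bad_def not_less[symmetric])
    then show ?thesis by (auto simp: bad_def not_less)
  qed
  note ev = this
  show ?thesis
  proof (rule ennreal_tendsto_0I)
    fix \<epsilon> :: real assume "0 < \<epsilon>"
    show "eventually (\<lambda>n. (\<Squnion>P\<in>Q. \<Squnion>t. ennreal (cdf_dist w fh gh P n t)) \<le> ennreal \<epsilon>) sequentially"
      using ev[OF \<open>0 < \<epsilon>\<close>] by (auto simp: eventually_sequentially intro!: SUP_least ennreal_leI)
  qed
\<comment> \<open>For empty \<open>Q\<close> the supremum is the least element 0.\<close>
qed (simp add: bot_ennreal)

section \<open>Uniform integrability from the moment assumptions\<close>

lemma tail_integral_vanishes:
  fixes f :: "'a \<Rightarrow> real"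
  assumes f: "integrable M f" and nn: "\<And>x. 0 \<le> f x" and "0 < \<epsilon>"
  shows "\<exists>K>0. (\<integral>x. f x * indicator {x. f x > K} x \<partial>M) \<le> \<epsilon>"
proof -
  have [measurable]: "f \<in> borel_measurable M" using f by simp
  have "(\<lambda>n. \<integral>x. f x * indicator {x. f x > real n} x \<partial>M) \<longlonglongrightarrow> (\<integral>x. 0 \<partial>M)"
  proof (rule integral_dominated_convergence[where w=f])
    show "AE x in M. (\<lambda>n. f x * indicator {x. f x > real n} x) \<longlonglongrightarrow> 0"
    proof (rule AE_I2, rule tendsto_eventually)
      fix x
      obtain n0 where "f x \<le> real n0" using real_arch_simple by blast
      then show "eventually (\<lambda>n. f x * indicator {x. f x > real n} x = 0) sequentially"
        by (auto simp: eventually_sequentially indicator_def intro!: exI[of _ n0])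
    qed
  qed (use f nn in \<open>auto simp: indicator_def\<close>)
  then have "eventually (\<lambda>n. (\<integral>x. f x * indicator {x. f x > real n} x \<partial>M) < \<epsilon>) sequentially"
    using \<open>0 < \<epsilon>\<close> by (intro order_tendstoD) auto
  then have "eventually (\<lambda>n. 0 < real n \<and> (\<integral>x. f x * indicator {x. f x > real n} x \<partial>M) < \<epsilon>) sequentially"
    using eventually_gt_at_top[of 0] by eventually_elim simp
  from eventually_happens'[OF sequentially_bot this] obtain n :: nat
    where "0 < real n" "(\<integral>x. f x * indicator {x. f x > real n} x \<partial>M) < \<epsilon>" by blast
  then show ?thesis by (intro exI[of _ "real n"]) simp
qed

text \<open>Where \<open>(g x)\<^sup>2 > K\<close>, the factor
  \<open>((g x)\<^sup>2 / K) powr (\<eta> / 2)\<close> is at least 1, and inserting it turns the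
  square into the power \<open>2 + \<eta>\<close>. The bound refers to the law only through
  \<open>B\<close>, hence is uniform over a class.\<close>

lemma higher_moment_tail:
  fixes g :: "'a \<Rightarrow> real"
  assumes [measurable]: "g \<in> borel_measurable M" and fin: "finite_measure M" and \<eta>: "0 < \<eta>"
    and M: "(\<integral>\<^sup>+x. ennreal (\<bar>g x\<bar> powr (2 + \<eta>)) \<partial>M) \<le> ennreal B"
  shows "integrable M (\<lambda>x. (g x)\<^sup>2)"
    and "0 < K \<Longrightarrow> (\<integral>x. (g x)\<^sup>2 * indicator {x. (g x)\<^sup>2 > K} x \<partial>M) \<le> \<bar>B\<bar> / K powr (\<eta> / 2)"
proof -
  interpret finite_measure M by fact
  have int: "integrable M (\<lambda>x. \<bar>g x\<bar> powr (2 + \<eta>))"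
    by (rule integrableI_bounded) (use M in \<open>auto simp: le_less_trans\<close>)
  \<comment> \<open>\<open>ennreal B\<close> is 0 for negative \<open>B\<close>, hence the absolute
    value.\<close>
  have le: "(\<integral>x. \<bar>g x\<bar> powr (2 + \<eta>) \<partial>M) \<le> \<bar>B\<bar>"
  proof -
    have "ennreal (\<integral>x. \<bar>g x\<bar> powr (2 + \<eta>) \<partial>M) = (\<integral>\<^sup>+x. ennreal (\<bar>g x\<bar> powr (2 + \<eta>)) \<partial>M)"
      by (rule nn_integral_eq_integral[OF int, symmetric]) simp
    also note M
    also have "ennreal B \<le> ennreal \<bar>B\<bar>" by (rule ennreal_leI) simp
    finally show ?thesis by (subst (asm) ennreal_le_iff) auto
  qed
  have sq: "(g x)\<^sup>2 = \<bar>g x\<bar> powr 2" for x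
    by (cases "g x = 0") (auto simp: powr_numeral)
  show sqi: "integrable M (\<lambda>x. (g x)\<^sup>2)"
  proof (rule Bochner_Integration.integrable_bound[of _ "\<lambda>x. 1 + \<bar>g x\<bar> powr (2 + \<eta>)"])
    have "(g x)\<^sup>2 \<le> 1 + \<bar>g x\<bar> powr (2 + \<eta>)" for x
    proof (cases "\<bar>g x\<bar> \<le> 1")
      case True
      then have "(g x)\<^sup>2 \<le> 1" by (simp add: abs_square_le_1)
      moreover have "0 \<le> \<bar>g x\<bar> powr (2 + \<eta>)" by simp
      ultimately show ?thesis by linarith
    next
      case False
      then show ?thesis unfolding sq using powr_mono[of 2 "2 + \<eta>" "\<bar>g x\<bar>"] \<eta> by simp
    qed
    then show "AE x in M. norm ((g x)\<^sup>2) \<le> norm (1 + \<bar>g x\<bar> powr (2 + \<eta>))" by simp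
  qed (use int in auto)
  assume K: "0 < K"
  have pw: "(g x)\<^sup>2 * indicator {x. (g x)\<^sup>2 > K} x \<le> \<bar>g x\<bar> powr (2 + \<eta>) / K powr (\<eta> / 2)" for x
  proof (cases "(g x)\<^sup>2 > K")
    case True
    then have gx: "0 < \<bar>g x\<bar>" using K by auto
    have "K powr (\<eta> / 2) \<le> ((g x)\<^sup>2) powr (\<eta> / 2)"
      using True K \<eta> by (intro powr_mono2) auto
    also have "\<dots> = \<bar>g x\<bar> powr \<eta>" by (simp only: sq powr_powr) simp
    finally have "(g x)\<^sup>2 * K powr (\<eta> / 2) \<le> \<bar>g x\<bar> powr 2 * \<bar>g x\<bar> powr \<eta>"
      unfolding sq by (intro mult_left_mono) auto
    then show ?thesis using True K by (simp add: pos_le_divide_eq powr_add)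
  qed simp
  have "(\<integral>x. (g x)\<^sup>2 * indicator {x. (g x)\<^sup>2 > K} x \<partial>M) \<le> (\<integral>x. \<bar>g x\<bar> powr (2 + \<eta>) / K powr (\<eta> / 2) \<partial>M)"
  proof (rule integral_mono[OF _ _ pw])
    show "integrable M (\<lambda>x. (g x)\<^sup>2 * indicator {x. (g x)\<^sup>2 > K} x)"
      by (rule Bochner_Integration.integrable_bound[OF sqi]) (auto simp: indicator_def)
  qed (use int in simp)
  also have "\<dots> \<le> \<bar>B\<bar> / K powr (\<eta> / 2)" using le by (simp add: divide_right_mono)
  finally show "(\<integral>x. (g x)\<^sup>2 * indicator {x. (g x)\<^sup>2 > K} x \<partial>M) \<le> \<bar>B\<bar> / K powr (\<eta> / 2)" .
qed

lemma residual_measurable_P: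
  assumes "P \<in> P0"
  shows "epsP P \<in> borel_measurable P" "xiP P \<in> borel_measurable P"
proof -
  have s: "sets P = sets borel" using assms by (simp add: P0_def E0_def)
  have [measurable]: "fP P \<in> borel_measurable borel" "gP P \<in> borel_measurable borel"
    by (auto simp: fP_def gP_def intro: cond_fun_spec[OF s])
  show "epsP P \<in> borel_measurable P" "xiP P \<in> borel_measurable P"
    unfolding measurable_cong_sets[OF s refl] epsP_def[abs_def] xiP_def[abs_def] by measurable
qed

text \<open>Both parts are instances of \<open>uniform_clt\<close>: the first for the class
  \<open>{P}\<close> with \<open>c = sigma2 w P\<close> and tails from dominated convergence, the
  second with tails from the higher moment.\<close>

theorem theorem1:
  fixes w :: "real ^ 'd \<Rightarrow> real" and fh gh :: "'d regr"
  assumes w_meas: "w \<in> borel_measurable borel"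
    and w_bdd: "\<exists>C>0. \<forall>z. \<bar>w z\<bar> \<le> C"
    and fh_meas: "measurable_regr fh" and gh_meas: "measurable_regr gh"
  shows
    "(\<forall>P. P \<in> P0 \<and> integrable P Xv \<and> integrable P Yv
        \<and> o_unif {P} (\<lambda>P n \<omega>. Af fh P n \<omega> * Ag gh P n \<omega>) (\<lambda>n. 1 / real n)
        \<and> o_unif {P} (Bf fh) (\<lambda>n. 1) \<and> o_unif {P} (Bg gh) (\<lambda>n. 1)
        \<and> sigma2 w P > 0
        \<and> (\<integral>\<^sup>+ p. ennreal ((epsP P p)\<^sup>2 * (xiP P p)\<^sup>2) \<partial>P) < \<infinity>
      \<longrightarrow> (\<lambda>n. \<Squnion>t. ennreal (cdf_dist w fh gh P n t)) \<longlonglongrightarrow> 0)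
   \<and>
    (\<forall>Q. Q \<subseteq> P0 \<and> (\<forall>P\<in>Q. integrable P Xv \<and> integrable P Yv)
        \<and> o_unif Q (\<lambda>P n \<omega>. Af fh P n \<omega> * Ag gh P n \<omega>) (\<lambda>n. 1 / real n)
        \<and> o_unif Q (Bf fh) (\<lambda>n. 1) \<and> o_unif Q (Bg gh) (\<lambda>n. 1)
        \<and> (\<exists>c>0. \<forall>P\<in>Q. sigma2 w P \<ge> c)
        \<and> (\<exists>\<eta>>0. \<exists>M::real. \<forall>P\<in>Q.
             (\<integral>\<^sup>+ p. ennreal (\<bar>epsP P p * xiP P p\<bar> powr (2 + \<eta>)) \<partial>P) \<le> ennreal M)
      \<longrightarrow> (\<lambda>n. \<Squnion>P\<in>Q. \<Squnion>t. ennreal (cdf_dist w fh gh P n t)) \<longlonglongrightarrow> 0)"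
proof (intro conjI allI impI)
  obtain C where C: "\<And>z. \<bar>w z\<bar> \<le> C" using w_bdd by blast
  note uniform_clt = uniform_clt[OF w_meas C fh_meas gh_meas]
  {
    fix P :: "'d pt measure"
    assume *: "P \<in> P0 \<and> integrable P Xv \<and> integrable P Yv
        \<and> o_unif {P} (\<lambda>P n \<omega>. Af fh P n \<omega> * Ag gh P n \<omega>) (\<lambda>n. 1 / real n)
        \<and> o_unif {P} (Bf fh) (\<lambda>n. 1) \<and> o_unif {P} (Bg gh) (\<lambda>n. 1)
        \<and> sigma2 w P > 0
        \<and> (\<integral>\<^sup>+ p. ennreal ((epsP P p)\<^sup>2 * (xiP P p)\<^sup>2) \<partial>P) < \<infinity>"
    then have [measurable]: "epsP P \<in> borel_measurable P" "xiP P \<in> borel_measurable P"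
      using residual_measurable_P by auto
    have int: "integrable P (\<lambda>p. (epsP P p)\<^sup>2 * (xiP P p)\<^sup>2)"
      by (rule integrableI_bounded) (use * in auto)
    have "(\<lambda>n. \<Squnion>P\<in>{P}. \<Squnion>t. ennreal (cdf_dist w fh gh P n t)) \<longlonglongrightarrow> 0"
      by (rule uniform_clt[where c="sigma2 w P"]) (use * int tail_integral_vanishes[OF int] in auto)
    then show "(\<lambda>n. \<Squnion>t. ennreal (cdf_dist w fh gh P n t)) \<longlonglongrightarrow> 0" by simp
  next
    fix Q :: "'d pt measure set"
    assume *: "Q \<subseteq> P0 \<and> (\<forall>P\<in>Q. integrable P Xv \<and> integrable P Yv)
        \<and> o_unif Q (\<lambda>P n \<omega>. Af fh P n \<omega> * Ag gh P n \<omega>) (\<lambda>n. 1 / real n)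
        \<and> o_unif Q (Bf fh) (\<lambda>n. 1) \<and> o_unif Q (Bg gh) (\<lambda>n. 1)
        \<and> (\<exists>c>0. \<forall>P\<in>Q. sigma2 w P \<ge> c)
        \<and> (\<exists>\<eta>>0. \<exists>M::real. \<forall>P\<in>Q.
             (\<integral>\<^sup>+ p. ennreal (\<bar>epsP P p * xiP P p\<bar> powr (2 + \<eta>)) \<partial>P) \<le> ennreal M)"
    then obtain c \<eta> M where c: "0 < c" "\<And>P. P \<in> Q \<Longrightarrow> c \<le> sigma2 w P" and \<eta>: "0 < \<eta>"
      and M: "\<And>P. P \<in> Q \<Longrightarrow> (\<integral>\<^sup>+ p. ennreal (\<bar>epsP P p * xiP P p\<bar> powr (2 + \<eta>)) \<partial>P) \<le> ennreal M"
      by blast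
    have g: "(\<lambda>p. epsP P p * xiP P p) \<in> borel_measurable P" "finite_measure P" if "P \<in> Q" for P
    proof -
      have "P \<in> P0" using that * by blast
      with residual_measurable_P[OF this] show "(\<lambda>p. epsP P p * xiP P p) \<in> borel_measurable P" "finite_measure P"
        by (auto simp: P0_def E0_def prob_space.finite_measure)
    qed
    note tail = higher_moment_tail[OF g \<eta> M, unfolded power_mult_distrib]
    show "(\<lambda>n. \<Squnion>P\<in>Q. \<Squnion>t. ennreal (cdf_dist w fh gh P n t)) \<longlonglongrightarrow> 0"
    proof (rule uniform_clt[OF _ _ _ _ _ _ c])
      fix \<epsilon> :: real assume \<epsilon>: "0 < \<epsilon>"
      \<comment> \<open>Solves
        \<open>K powr (\<eta> / 2) = (\<bar>M\<bar> + 1) / \<epsilon>\<close>; the 1 keeps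
        \<open>K\<close> positive when \<open>M\<close> is 0.\<close>
      define K where "K = ((\<bar>M\<bar> + 1) / \<epsilon>) powr (2 / \<eta>)"
      have K: "0 < K" "K powr (\<eta> / 2) = (\<bar>M\<bar> + 1) / \<epsilon>"
        using \<epsilon> \<eta> by (auto simp: K_def powr_powr)
      have "\<bar>M\<bar> / K powr (\<eta> / 2) \<le> \<epsilon>"
        unfolding K using \<epsilon> by (simp add: pos_divide_le_eq mult_left_mono)
      then show "\<exists>K>0. \<forall>P\<in>Q. (\<integral>p. (epsP P p)\<^sup>2 * (xiP P p)\<^sup>2 *
          indicator {p. (epsP P p)\<^sup>2 * (xiP P p)\<^sup>2 > K} p \<partial>P) \<le> \<epsilon>"
        using tail(2) K(1) by (meson order_trans)
    qed (use * tail(1) in auto)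
  }
qed

end
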